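(* Let $k\geq 2$ be a fixed integer and define $D_{k,\omega}(n) := \dfrac{d(n)}{k^{\omega(n)}}$. Then, for all $x\geq 1$ sufficiently large, \[ \sum_{n\leq x}D_{k,\omega}(n) = \frac{x(\log x)^{2/k-1}}{\Gamma(2/k)}\prod_{p}\Bigl(1-\frac{1}{p}\Bigr)^{2/k}\Bigl(1+\frac{2p-1}{k(p-1)^{2}}\Bigr) + O_{k}\bigl(x(\log x)^{2/k-2}\bigr), \] where the product runs over all primes $p$.
   Context: For a positive integer $n$, $d(n)=\sum_{d\mid n}1$ is the number of divisors of $n$ and $\omega(n)=\sum_{p\mid n}1$ is the number of distinct prime divisors of $n$. $\Gamma$ denotes the Euler Gamma function. $O_k$ means the implied constant may depend on $k$. *)

theory Defs
  imports
    "HOL-Analysis.Analysis"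
    "HOL-Computational_Algebra.Primes"
    "HOL-Library.Landau_Symbols"
    "HOL-Real_Asymp.Real_Asymp"
begin

definition divisor_count :: "nat \<Rightarrow> nat" where
  "divisor_count n = card {d. d dvd n}"

definition omega :: "nat \<Rightarrow> nat" where
  "omega n = card {p. prime p \<and> p dvd n}"

definition D_omega :: "nat \<Rightarrow> nat \<Rightarrow> real" where
  "D_omega k n = real (divisor_count n) / real k ^ omega n"

definition local_factor :: "nat \<Rightarrow> nat \<Rightarrow> real" where
  "local_factor k p =
     (1 - 1 / real p) powr (2 / real k) * (1 + (2 * real p - 1) / (real k * (real p - 1)\<^sup>2))"

text \<open>
  The product over the primes is the library's \<^const>\<open>prodinf\<close> over all natural numbers,
  with factor 1 at the non-primes. The lemma after the definition shows that it converges
  absolutely, so its value is not a default value.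
\<close>

definition euler_product :: "nat \<Rightarrow> real" where
  "euler_product k = (\<Prod>p. if prime p then local_factor k p else 1)"

lemma abs_convergent_local_factors:
  assumes "k \<ge> 2"
  shows "abs_convergent_prod (\<lambda>p. if prime p then local_factor k p else 1)"
proof -
  have k: "real k > 0"
    using assms by simp
  define c where "c = real k"
  define A where "A = (\<lambda>n::nat. (1 - 1 / real n) powr (2 / c))"
  define B where "B = (\<lambda>n::nat. (2 * real n - 1) / (real n - 1)\<^sup>2)"
  have c: "c > 0"
    using k by (simp add: c_def)
  have A1: "(\<lambda>n. A n - 1) \<in> O(\<lambda>n. 1 / real n)"
    unfolding A_def using c by real_asymp
  have A2: "(\<lambda>n. A n - 1 + (2 / c) / real n) \<in> O(\<lambda>n. 1 / real n ^ 2)"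
  proof -
    have "(\<lambda>n::nat. (1 - 1 / real n) powr s - 1 + s / real n) \<in> O(\<lambda>n. 1 / real n ^ 2)"
      if "s > 0" for s :: real
      using that by real_asymp
    from this[of "2 / c"] show ?thesis
      unfolding A_def using c by simp
  qed
  have B1: "B \<in> O(\<lambda>n. 1 / real n)" and B2: "(\<lambda>n. B n - 2 / real n) \<in> O(\<lambda>n. 1 / real n ^ 2)"
    unfolding B_def by real_asymp+
  have AB: "(\<lambda>n. (A n - 1) * B n) \<in> O(\<lambda>n. 1 / real n ^ 2)"
    using landau_o.big.mult[OF A1 B1] by (simp add: power2_eq_square)
  have "(\<lambda>n. (A n - 1 + (2 / c) / real n) + (1 / c) * (B n - 2 / real n)
            + (1 / c) * ((A n - 1) * B n)) \<in> O(\<lambda>n. 1 / real n ^ 2)"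
    by (rule sum_in_bigo(1)[OF sum_in_bigo(1)[OF A2]]; simp only: cmult_in_bigo_iff B2 AB simp_thms)
  moreover have "(\<lambda>n. (A n - 1 + (2 / c) / real n) + (1 / c) * (B n - 2 / real n)
            + (1 / c) * ((A n - 1) * B n)) = (\<lambda>n. local_factor k n - 1)"
  proof
    fix n
    have "local_factor k n = A n * (1 + B n / c)"
      by (simp add: local_factor_def A_def B_def c_def mult.commute)
    moreover have "(A n - 1 + (2 / c) / real n) + (1 / c) * (B n - 2 / real n)
        + (1 / c) * ((A n - 1) * B n) = A n * (1 + B n / c) - 1"
      by (simp add: diff_divide_distrib algebra_simps)
    ultimately show "(A n - 1 + (2 / c) / real n) + (1 / c) * (B n - 2 / real n)
        + (1 / c) * ((A n - 1) * B n) = local_factor k n - 1"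
      by simp
  qed
  ultimately have *: "(\<lambda>n. local_factor k n - 1) \<in> O(\<lambda>n. 1 / real n ^ 2)"
    by simp
  have "(\<lambda>p. (if prime p then local_factor k p else 1) - 1) \<in> O(\<lambda>n. local_factor k n - 1)"
    by (rule bigoI[of _ 1], rule always_eventually) simp
  from landau_o.big_trans[OF this *]
  have bigo: "(\<lambda>p. \<bar>(if prime p then local_factor k p else 1) - 1\<bar>) \<in> O(\<lambda>n. 1 / real n ^ 2)"
    by (simp only: landau_o.big.abs_in_iff)
  have "summable (\<lambda>n. norm (1 / real n ^ 2))"
    using inverse_power_summable[of 2, where ?'a = real] by (simp add: field_simps)
  from summable_comparison_test_bigo[OF this bigo] show ?thesis
    by (intro summable_imp_abs_convergent_prod) (simp only: real_norm_def)
qed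

end

theory Submission
  imports Defs
    "HOL-Complex_Analysis.Complex_Analysis"
    "HOL-Probability.Sinc_Integral"
begin

text \<open>
  Write \<open>z = 2/k\<close> and \<open>F(s)\<close> for the Dirichlet series of \<open>D_omega k\<close>. The Euler product gives
  \<open>F = E exp (z log_zeta)\<close> for \<open>Re s > 1\<close>, where \<open>E\<close> (\<open>euler_limit\<close>) is holomorphic and bounded for
  \<open>Re s > 3/4\<close> and \<open>E(1)\<close> is the Euler product of the theorem. Hence, for \<open>Re s > 1\<close>, the second
  derivative \<open>F''\<close> is \<open>E(1) z (z + 1) (s - 1)^(-z - 2) + O(|s - 1|^(-z - 1))\<close> near 1 and
  \<open>O(|s|^\<epsilon>)\<close> away from 1. The latter needs only \<open>1/zeta(s) = O(|s|^\<epsilon>)\<close> for \<open>Re s > 1\<close>, which follows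
  from the 3-4-1 inequality; no zero-free region to the left of the line \<open>Re s = 1\<close> is used.

  The main term of \<open>F''\<close> is the Laplace transform of a multiple of \<open>v^(z + 1) exp v\<close>. The Perron formula
  with kernel \<open>1/s^2\<close> on the line \<open>Re s = 1 + 1/Y\<close>, \<open>Y = ln x\<close>, is applied to the difference of the
  Riesz means at two points at distance \<open>1/Y\<close>. As the coefficients are nonnegative, this gives the
  sum of \<open>D_omega k n (ln n)^2\<close> up to a relative error \<open>O(1/Y)\<close>. The weight is removed by
  \<open>1 - (ln n / Y)^2 \<le> 2 (Y - ln n) / Y\<close> and the trivial bound for the Riesz mean. Two derivatives
  are taken so that the contribution of the singularity outweighs that of \<open>O(|s|^\<epsilon>)\<close>, which is
  false for \<open>F\<close> itself.
\<close>

subsection \<open>The kernel of the second-order Perron formula\<close>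

text \<open>The obstacle is the far part of the line. Dividing a difference of Riesz means with step
  \<open>h = 1 / Y\<close> by \<open>h\<close> leaves the kernel
  \<open>(exp (h s) - 1) / (h s^2)\<close>, which decays only like \<open>1 / |s|\<close> up to
  height about \<open>Y\<close>; against \<open>|s|^\<epsilon>\<close> it costs a small positive
  power of \<open>Y\<close>. After \<open>j\<close> derivatives the error that may be tolerated,
  relative to \<open>exp Y\<close>, is \<open>Y^(z - 2 + j)\<close>. As \<open>z \<le> 1\<close>,
  with equality for \<open>k = 2\<close>, this is a positive power of \<open>Y\<close> for every
  \<open>k\<close> only if \<open>j \<ge> 2\<close>; then there is room for the exponent
  \<open>z / 2\<close> in the growth bound.

  The step \<open>1 / Y\<close> is forced from the other side: a difference quotient of Riesz means
  perturbs \<open>Y^(z + 1) exp Y\<close> by the relative size of the step, and the relative error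
  allowed is \<open>1 / Y\<close>. The singular part is not evaluated by deforming the line. It is
  recognised as the Perron integral of an explicit weight on the same line, and only the difference
  of the two integrands is estimated.\<close>

lemma norm_contour_integral_three_segments_le:
  assumes "f contour_integrable_on linepath a b" "f contour_integrable_on linepath b c" "f contour_integrable_on linepath c d"
    and "0 \<le> B" "\<And>x. x \<in> closed_segment a b \<union> closed_segment b c \<union> closed_segment c d \<Longrightarrow> norm (f x) \<le> B"
  shows "norm (contour_integral (linepath a b) f + contour_integral (linepath b c) f + contour_integral (linepath c d) f)
           \<le> B * (norm (b - a) + norm (c - b) + norm (d - c))"
  unfolding distrib_left using assms
  by (intro order.trans[OF norm_triangle_ineq] add_mono contour_integral_bound_linepath) auto

text \<open>For \<open>v \<le> 0\<close> the exponential does not grow to the right, so the segment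
  is closed by a rectangle of width \<open>R\<close> on that side, which avoids the pole at 0. The
  three added sides have total length \<open>4 * R\<close> and stay at distance at least
  \<open>R\<close> from 0.\<close>

lemma perron_truncated_neg:
  fixes c v R :: real
  assumes "c > 0" "R > 0" "v \<le> 0"
  shows "norm (integral {-R..R} (\<lambda>t. exp (of_real v * Complex c t) / (Complex c t)^2)) \<le> 4 * exp (v * c) / R"
proof -
  define f where "f = (\<lambda>s::complex. exp (of_real v * s) / s^2)"
  define a1 where "a1 = Complex c (-R)"
  define a2 where "a2 = Complex (c+R) (-R)"
  define a3 where "a3 = Complex (c+R) R"
  define a4 where "a4 = Complex c R"
  have bd: "norm (f s) \<le> exp (v * c) / R^2" if "Re s \<ge> c" "\<bar>Re s\<bar> \<ge> R \<or> \<bar>Im s\<bar> \<ge> R" for s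
  proof -
    have "R \<le> norm s" using that abs_Re_le_cmod[of s] abs_Im_le_cmod[of s] by linarith
    then have "R^2 \<le> norm s ^2" using assms by (intro power_mono) auto
    moreover have "v * Re s \<le> v * c" using that assms by (simp add: mult_left_mono_neg)
    ultimately show ?thesis unfolding f_def using assms
      by (auto simp: norm_divide norm_power intro!: frac_le)
  qed
  have hol: "f holomorphic_on {s. Re s > 0}"
    unfolding f_def by (auto intro!: holomorphic_intros)
  have cont: "continuous_on (closed_segment a b) f" if "Re a > 0" "Re b > 0" for a b
  proof (rule holomorphic_on_imp_continuous_on, rule holomorphic_on_subset[OF hol])
    show "closed_segment a b \<subseteq> {s. Re s > 0}"
      using that by (intro closed_segment_subset convex_halfspace_Re_gt) auto
  qed
  have pos: "Re a1 > 0" "Re a2 > 0" "Re a3 > 0" "Re a4 > 0"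
    using assms by (auto simp: a1_def a2_def a3_def a4_def)
  have ci: "f contour_integrable_on (linepath a b)" if "Re a > 0" "Re b > 0" for a b
    using cont[OF that] by (rule contour_integrable_continuous_linepath)
  have rp: "rectpath a1 a3 = linepath a1 a2 +++ linepath a2 a3 +++ linepath a3 a4 +++ linepath a4 a1"
    by (simp add: rectpath_def Let_def a1_def a2_def a3_def a4_def)
  have "path_image (rectpath a1 a3) \<subseteq> cbox a1 a3"
    using assms by (intro path_image_rectpath_subset_cbox) (auto simp: a1_def a3_def)
  also have "cbox a1 a3 \<subseteq> {s. Re s > 0}"
    using assms by (auto simp: a1_def a3_def in_cbox_complex_iff)
  finally have "path_image (rectpath a1 a3) \<subseteq> {s. Re s > 0}" .
  then have "(f has_contour_integral 0) (rectpath a1 a3)"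
    by (intro Cauchy_theorem_convex_simple[OF hol convex_halfspace_Re_gt]) auto
  then have "0 = contour_integral (rectpath a1 a3) f"
    by (simp add: contour_integral_unique)
  also have "\<dots> = contour_integral (linepath a1 a2) f + contour_integral (linepath a2 a3) f
     + contour_integral (linepath a3 a4) f + contour_integral (linepath a4 a1) f"
    unfolding rp using pos by (simp add: ci add_ac)
  also have "contour_integral (linepath a4 a1) f = - contour_integral (linepath a1 a4) f"
    by (metis contour_integral_reversepath reversepath_linepath valid_path_linepath)
  finally have eq: "contour_integral (linepath a1 a4) f = contour_integral (linepath a1 a2) f + contour_integral (linepath a2 a3) f
     + contour_integral (linepath a3 a4) f" by simp
  have "norm (contour_integral (linepath a1 a4) f) \<le> exp (v * c) / R^2 * (norm (a2 - a1) + norm (a3 - a2) + norm (a4 - a3))"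
    unfolding eq using assms
    by (intro norm_contour_integral_three_segments_le ci pos bd)
      (auto simp: a1_def a2_def a3_def a4_def closed_segment_same_Re closed_segment_same_Im closed_segment_eq_real_ivl)
  also have "a2 - a1 = of_real R" "a3 - a2 = \<i> * of_real (2*R)" "a4 - a3 = - of_real R"
    by (simp_all add: a1_def a2_def a3_def a4_def complex_eq_iff)
  then have "norm (a2 - a1) + norm (a3 - a2) + norm (a4 - a3) = 4 * R"
    using assms by (simp add: norm_mult)
  also have "exp (v * c) / R^2 * (4 * R) = 4 * exp (v * c) / R"
    using assms by (simp add: power2_eq_square)
  finally have "norm (contour_integral (linepath a1 a4) f) \<le> 4 * exp (v * c) / R" .
  moreover have "contour_integral (linepath a1 a4) f = \<i> * integral {-R..R} (\<lambda>t. f (Complex c t))"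
    by (rule contour_integral_linepath_same_Re) (use assms in \<open>auto simp: a1_def a4_def\<close>)
  ultimately show ?thesis by (simp add: f_def norm_mult)
qed

text \<open>For \<open>v \<ge> 0\<close> the left is the cheap side. The rectangle now encloses the
  double pole at 0, whose residue \<open>v\<close> is the linear coefficient of
  \<open>exp (v s)\<close>.\<close>

lemma perron_truncated_pos:
  fixes c v R :: real
  assumes "c > 0" "R > 0" "v \<ge> 0"
  shows "norm (integral {-R..R} (\<lambda>t. exp (of_real v * Complex c t) / (Complex c t)^2) - of_real (2 * pi * v))
           \<le> exp (v * c) * (4 * R + 2 * c) / R^2"
proof -
  define f where "f = (\<lambda>s::complex. exp (of_real v * s) / s^2)"
  define a1 where "a1 = Complex (-R) (-R)"
  define a2 where "a2 = Complex c (-R)"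
  define a3 where "a3 = Complex c R"
  define a4 where "a4 = Complex (-R) R"
  have bd: "norm (f s) \<le> exp (v * c) / R^2" if "Re s \<le> c" "\<bar>Re s\<bar> \<ge> R \<or> \<bar>Im s\<bar> \<ge> R" for s
  proof -
    have "R \<le> norm s" using that abs_Re_le_cmod[of s] abs_Im_le_cmod[of s] by linarith
    then have "R^2 \<le> norm s ^2" using assms by (intro power_mono) auto
    moreover have "v * Re s \<le> v * c" using that assms by (simp add: mult_left_mono)
    ultimately show ?thesis unfolding f_def using assms
      by (auto simp: norm_divide norm_power intro!: frac_le)
  qed
  have hol: "f holomorphic_on UNIV - {0}"
    unfolding f_def by (auto intro!: holomorphic_intros)
  have rp: "rectpath a1 a3 = linepath a1 a2 +++ linepath a2 a3 +++ linepath a3 a4 +++ linepath a4 a1"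
    by (simp add: rectpath_def Let_def a1_def a2_def a3_def a4_def)
  have zb: "0 \<in> box a1 a3" using assms by (simp add: a1_def a3_def in_box_complex_iff)
  have z: "0 \<notin> path_image (rectpath a1 a3)"
    using assms zb by (subst path_image_rectpath_cbox_minus_box) (auto simp: a1_def a3_def)
  have z4: "0 \<notin> closed_segment a1 a2" "0 \<notin> closed_segment a2 a3" "0 \<notin> closed_segment a3 a4" "0 \<notin> closed_segment a4 a1"
    using z unfolding rp by (auto simp: path_image_join)
  have ci: "f contour_integrable_on (linepath a b)" if "0 \<notin> closed_segment a b" for a b
    using that by (intro contour_integrable_continuous_linepath holomorphic_on_imp_continuous_on holomorphic_on_subset[OF hol]) auto
  have "contour_integral (rectpath a1 a3) f = 2 * pi * \<i> * (\<Sum>p\<in>{0}. winding_number (rectpath a1 a3) p * residue f p)"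
    by (rule Residue_theorem[where S = UNIV]) (use hol z in auto)
  also have "(\<Sum>p\<in>{0}. winding_number (rectpath a1 a3) p * residue f p) = winding_number (rectpath a1 a3) 0 * residue f 0"
    by simp
  also have "residue f 0 = of_real v"
  proof -
    have "residue (\<lambda>z. exp (of_real v * z) / z ^ Suc 1) 0 = (deriv ^^ 1) (\<lambda>z. exp (of_real v * z)) 0 / fact 1"
      by (rule residue_holomorphic_over_power'[where A = UNIV]) (auto intro!: holomorphic_intros)
    moreover have "deriv (\<lambda>z. exp (complex_of_real v * z)) 0 = of_real v"
      by (rule DERIV_imp_deriv) (auto intro!: derivative_eq_intros)
    ultimately show ?thesis by (simp add: f_def power2_eq_square)
  qed
  also have "winding_number (rectpath a1 a3) 0 = 1" using zb by (rule winding_number_rectpath)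
  finally have "2 * pi * \<i> * of_real v = contour_integral (rectpath a1 a3) f"
    by simp
  also have "\<dots> = contour_integral (linepath a1 a2) f + contour_integral (linepath a2 a3) f
     + contour_integral (linepath a3 a4) f + contour_integral (linepath a4 a1) f"
    unfolding rp using z4 by (simp add: ci add_ac)
  finally have eq: "2 * pi * \<i> * of_real v - contour_integral (linepath a2 a3) f = contour_integral (linepath a3 a4) f
     + contour_integral (linepath a4 a1) f + contour_integral (linepath a1 a2) f" by simp
  have "norm (2 * pi * \<i> * of_real v - contour_integral (linepath a2 a3) f) \<le> exp (v * c) / R^2 * (norm (a4 - a3) + norm (a1 - a4) + norm (a2 - a1))"
    unfolding eq using assms
    by (intro norm_contour_integral_three_segments_le ci z4 bd)
      (auto simp: a1_def a2_def a3_def a4_def closed_segment_same_Re closed_segment_same_Im closed_segment_eq_real_ivl)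
  also have "a4 - a3 = - of_real (R + c)" "a1 - a4 = - \<i> * of_real (2*R)" "a2 - a1 = of_real (R + c)"
    by (simp_all add: a1_def a2_def a3_def a4_def complex_eq_iff)
  then have "norm (a4 - a3) + norm (a1 - a4) + norm (a2 - a1) = 4 * R + 2 * c"
    using assms by (simp only: norm_minus_cancel norm_mult norm_of_real norm_ii)
  also have "exp (v * c) / R^2 * (4 * R + 2 * c) = exp (v * c) * (4 * R + 2 * c) / R^2" by simp
  finally have 1: "norm (2 * pi * \<i> * of_real v - contour_integral (linepath a2 a3) f) \<le> exp (v * c) * (4 * R + 2 * c) / R^2" .
  have "contour_integral (linepath a2 a3) f = \<i> * integral {-R..R} (\<lambda>t. f (Complex c t))"
    by (rule contour_integral_linepath_same_Re) (use assms in \<open>auto simp: a2_def a3_def\<close>)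
  then have "2 * pi * \<i> * of_real v - contour_integral (linepath a2 a3) f =
     - \<i> * (integral {-R..R} (\<lambda>t. f (Complex c t)) - of_real (2 * pi * v))"
    by (simp add: algebra_simps)
  with 1 show ?thesis by (simp add: f_def norm_mult)
qed

lemma integrable_inverse_square_plus:
  fixes c :: real assumes "c > 0"
  shows "integrable lborel (\<lambda>t. 1 / (c^2 + t^2))"
proof -
  have "integrable lborel (\<lambda>x::real. inverse (1 + x^2))"
    using integrable_inverse_1_plus_square by (simp add: set_integrable_def)
  then have "integrable lborel (\<lambda>x::real. inverse (1 + (0 + (1/c) * x)^2))"
    using assms by (intro lborel_integrable_real_affine[where c = "1/c"]) auto
  then have "integrable lborel (\<lambda>x::real. (1/c^2) * inverse (1 + (0 + (1/c) * x)^2))"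
    by (intro integrable_mult_right)
  also have "(\<lambda>x::real. (1/c^2) * inverse (1 + (0 + (1/c) * x)^2)) = (\<lambda>t. 1 / (c^2 + t^2))"
    using assms by (auto simp: field_simps)
  finally show ?thesis .
qed

lemma Complex_measurable [measurable]: "Complex c \<in> borel_measurable borel"
  by (intro borel_measurable_continuous_onI) (auto simp: Complex_eq intro!: continuous_intros)

lemma perron_integrable:
  fixes c v :: real
  assumes "c > 0"
  shows "integrable lborel (\<lambda>t. exp (of_real v * Complex c t) / (Complex c t)^2)"
proof (rule Bochner_Integration.integrable_bound[OF integrable_mult_right[where c = "exp (v * c)", OF integrable_inverse_square_plus[OF assms]]])
  show "(\<lambda>t. exp (of_real v * Complex c t) / (Complex c t)^2) \<in> borel_measurable lborel"
    by measurable
qed (use assms in \<open>auto simp: norm_divide norm_power cmod_power2\<close>)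

text \<open>The square in the denominator makes the integral absolutely convergent, which Fubini
  needs later; in exchange the kernel is a hinge in \<open>v\<close> instead of a jump, so that
  Riesz means appear in place of sums.\<close>

theorem perron_kernel:
  fixes c v :: real
  assumes "c > 0"
  shows "(LBINT t. exp (of_real v * Complex c t) / (Complex c t)^2) = of_real (2 * pi * max v 0)"
proof -
  define g where "g = (\<lambda>t. exp (of_real v * Complex c t) / (Complex c t)^2)"
  have int: "integrable lborel g" unfolding g_def by (rule perron_integrable[OF assms])
  have "((\<lambda>R. \<integral>t. indicator {-R..R} t *\<^sub>R g t \<partial>lborel) \<longlongrightarrow> (LBINT t. g t)) at_top"
  proof (rule integral_dominated_convergence_at_top[where w = "\<lambda>t. norm (g t)"])
    show "AE t in lborel. ((\<lambda>R. indicator {-R..R} t *\<^sub>R g t) \<longlongrightarrow> g t) at_top"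
    proof (rule AE_I2)
      fix t
      have "eventually (\<lambda>R. indicator {-R..R} t *\<^sub>R g t = g t) at_top"
        using eventually_ge_at_top[of "\<bar>t\<bar>"] by eventually_elim (auto simp: indicator_def)
      then show "((\<lambda>R. indicator {-R..R} t *\<^sub>R g t) \<longlongrightarrow> g t) at_top" by (rule tendsto_eventually)
    qed
  qed (use int in \<open>auto simp: indicator_def\<close>)
  moreover have "(\<integral>t. indicator {-R..R} t *\<^sub>R g t \<partial>lborel) = integral {-R..R} g" for R
    using int set_borel_integral_eq_integral(2)[of "{-R..R}" g]
    by (simp add: set_integrable_def set_lebesgue_integral_def integrable_mult_indicator)
  ultimately have lim: "((\<lambda>R. integral {-R..R} g) \<longlongrightarrow> (LBINT t. g t)) at_top" by simp
  have "((\<lambda>R. integral {-R..R} g - of_real (2 * pi * max v 0)) \<longlongrightarrow> 0) at_top"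
  proof (rule Lim_null_comparison)
    show "eventually (\<lambda>R. norm (integral {-R..R} g - of_real (2 * pi * max v 0)) \<le> exp (v * c) * (4 * R + 2 * c) / R^2) at_top"
      using eventually_gt_at_top[of 0]
    proof eventually_elim
      case (elim R)
      show ?case
      proof (cases "v \<ge> 0")
        case True
        then show ?thesis using perron_truncated_pos[OF assms elim True] by (simp add: g_def)
      next
        case False
        then have "norm (integral {-R..R} g - of_real (2 * pi * max v 0)) \<le> 4 * exp (v * c) / R"
          using perron_truncated_neg[OF assms elim, of v] by (simp add: g_def)
        also have "\<dots> \<le> exp (v * c) * (4 * R + 2 * c) / R^2"
          using elim assms by (simp add: field_simps power2_eq_square)
        finally show ?thesis .
      qed
    qed
    show "((\<lambda>R. exp (v * c) * (4 * R + 2 * c) / R^2) \<longlongrightarrow> 0) at_top"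
      by real_asymp
  qed
  then have "((\<lambda>R. integral {-R..R} g) \<longlongrightarrow> of_real (2 * pi * max v 0)) at_top"
    by (subst (asm) LIM_zero_iff)
  from tendsto_unique[OF _ lim this] show ?thesis
    by (simp add: g_def)
qed

subsection \<open>Laplace transforms\<close>

text \<open>Stated for a general measure so that one application of Fubini serves both the sum over
  \<open>n\<close> (counting measure) and the Laplace integral of the comparison weight (Lebesgue
  measure).\<close>

lemma perron_measure:
  fixes M :: "'a measure" and w g :: "'a \<Rightarrow> real" and c X :: real
  defines "D \<equiv> \<lambda>s::complex. (LINT m|M. of_real (w m) * exp (- s * of_real (g m)))"
  assumes M: "sigma_finite_measure M" and c: "c > 0"
    and w [measurable]: "w \<in> borel_measurable M" and g [measurable]: "g \<in> borel_measurable M"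
    and int: "integrable M (\<lambda>m. w m * exp (- c * g m))"
  shows "integrable lborel (\<lambda>t. D (Complex c t) * exp (of_real X * Complex c t) / (Complex c t)^2)"
    and "(LBINT t. D (Complex c t) * exp (of_real X * Complex c t) / (Complex c t)^2)
           = of_real (2 * pi * (LINT m|M. w m * max (X - g m) 0))"
    and "integrable M (\<lambda>m. w m * max (X - g m) 0)"
proof -
  interpret M: sigma_finite_measure M by fact
  interpret P: pair_sigma_finite lborel M ..
  define f where "f = (\<lambda>t m. of_real (w m) * (exp (of_real (X - g m) * Complex c t) / (Complex c t)^2))"
  have mf: "case_prod f \<in> borel_measurable (lborel \<Otimes>\<^sub>M M)"
    unfolding f_def by measurable
  have int': "integrable M (\<lambda>m. \<bar>w m\<bar> * exp (c * (X - g m)))"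
  proof -
    have "integrable M (\<lambda>m. exp (c * X) * \<bar>w m * exp (- c * g m)\<bar>)"
      using int by (intro integrable_mult_right) auto
    also have "(\<lambda>m. exp (c * X) * \<bar>w m * exp (- c * g m)\<bar>) = (\<lambda>m. \<bar>w m\<bar> * exp (c * (X - g m)))"
      by (simp add: abs_mult algebra_simps flip: exp_add)
    finally show ?thesis .
  qed
  \<comment> \<open>On the line the modulus is a function of \<open>m\<close> times a function of
    \<open>t\<close>, so integrability over the product reduces to convergence at the single real
    point \<open>c\<close>.\<close>
  have nf: "norm (f t m) = \<bar>w m\<bar> * exp (c * (X - g m)) * (1 / (c^2 + t^2))" for t m
    using c by (simp add: f_def norm_mult norm_divide norm_power cmod_power2 algebra_simps)
  have intf: "integrable (lborel \<Otimes>\<^sub>M M) (case_prod f)"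
  proof (rule P.Fubini_integrable[OF mf])
    show "integrable lborel (\<lambda>t. LINT m|M. norm (case_prod f (t, m)))"
      using integrable_inverse_square_plus[OF c] by (simp only: prod.case nf) (simp only: integral_mult_left_zero integrable_mult_right)
    show "AE t in lborel. integrable M (\<lambda>m. case_prod f (t, m))"
    proof (rule AE_I2)
      fix t
      have "integrable M (\<lambda>m. \<bar>w m\<bar> * exp (c * (X - g m)) * (1 / (c^2 + t^2)))"
        using int' by (rule integrable_mult_left)
      then show "integrable M (\<lambda>m. case_prod f (t, m))"
      proof (rule Bochner_Integration.integrable_bound)
        show "(\<lambda>m. case_prod f (t, m)) \<in> borel_measurable M" unfolding f_def by simp
        show "AE m in M. norm (case_prod f (t, m)) \<le> norm (\<bar>w m\<bar> * exp (c * (X - g m)) * (1 / (c^2 + t^2)))"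
          by (simp add: nf)
      qed
    qed
  qed
  have fD: "(LINT m|M. f t m) = D (Complex c t) * exp (of_real X * Complex c t) / (Complex c t)^2" for t
  proof -
    have "f t m = of_real (w m) * exp (- Complex c t * of_real (g m)) * (exp (of_real X * Complex c t) / (Complex c t)^2)" for m
      by (simp add: f_def algebra_simps flip: exp_add)
    then show ?thesis by (simp only: D_def integral_mult_left_zero) simp
  qed
  have fK: "(LBINT t. f t m) = of_real (w m * (2 * pi * max (X - g m) 0))" for m
    unfolding f_def by (simp only: integral_mult_right_zero perron_kernel[OF c] of_real_mult)
  show "integrable lborel (\<lambda>t. D (Complex c t) * exp (of_real X * Complex c t) / (Complex c t)^2)"
    using P.integrable_fst[OF intf] by (simp only: fD)
  have "integrable M (\<lambda>m. LBINT t. f t m)" using P.integrable_snd[OF intf] .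
  then have "integrable M (\<lambda>m. w m * (2 * pi * max (X - g m) 0))"
    unfolding fK of_real_eq_iff by (rule complex_of_real_integrable_eq[THEN iffD1])
  then have "integrable M (\<lambda>m. (1/(2*pi)) * (w m * (2 * pi * max (X - g m) 0)))" by (rule integrable_mult_right)
  then show "integrable M (\<lambda>m. w m * max (X - g m) 0)" by (simp add: field_simps)
  have "(LBINT t. (LINT m|M. f t m)) = (LINT m|M. (LBINT t. f t m))"
    using P.Fubini_integral[OF intf] by simp
  moreover have "(LINT m|M. w m * (2 * pi * max (X - g m) 0)) = 2 * pi * (LINT m|M. w m * max (X - g m) 0)"
    by (subst integral_mult_right_zero[symmetric]) (simp add: mult_ac)
  ultimately show "(LBINT t. D (Complex c t) * exp (of_real X * Complex c t) / (Complex c t)^2)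
           = of_real (2 * pi * (LINT m|M. w m * max (X - g m) 0))"
    unfolding fD fK integral_complex_of_real by simp
qed

lemma has_bochner_integral_laplace_real:
  fixes a x :: real
  assumes "a > 0" "x > 0"
  shows "has_bochner_integral lborel (\<lambda>v. indicator {0..} v * (v powr a * exp (- x * v))) (Gamma (a + 1) * x powr (-a-1))"
proof -
  have "has_bochner_integral lborel (\<lambda>t. indicator {0..} t * t powr (a + 1 - 1) / exp t) (Gamma (a + 1))"
    by (rule has_bochner_integral_nn_integral)
       (use assms Gamma_conv_nn_integral_real[of "a + 1"] in \<open>auto simp: Gamma_real_pos less_imp_le\<close>)
  then have "has_bochner_integral lborel (\<lambda>v. indicator {0..} (0 + x * v) * (0 + x * v) powr (a + 1 - 1) / exp (0 + x * v)) (Gamma (a + 1) /\<^sub>R \<bar>x\<bar>)"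
    using assms by (subst (asm) lborel_has_bochner_integral_real_affine_iff[where c = x and t = 0]) auto
  then have "has_bochner_integral lborel (\<lambda>v. x powr (-a) * (indicator {0..} (0 + x * v) * (0 + x * v) powr (a + 1 - 1) / exp (0 + x * v))) (x powr (-a) * (Gamma (a + 1) /\<^sub>R \<bar>x\<bar>))"
    by (rule has_bochner_integral_mult_right)
  also have "(\<lambda>v. x powr (-a) * (indicator {0..} (0 + x * v) * (0 + x * v) powr (a + 1 - 1) / exp (0 + x * v))) = (\<lambda>v. indicator {0..} v * (v powr a * exp (- x * v)))"
    using assms by (auto simp: indicator_def powr_mult powr_minus exp_minus field_simps zero_le_mult_iff)
  also have "x powr (-a) * (Gamma (a + 1) /\<^sub>R \<bar>x\<bar>) = Gamma (a + 1) * x powr (-a-1)"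
    using assms by (simp add: powr_diff powr_minus field_simps)
  finally show ?thesis .
qed

text \<open>Both sides are holomorphic for \<open>Re s > 0\<close> and agree on the positive reals,
  so the identity theorem applies. Holomorphy of the left side comes from the integrals over
  \<open>{0..N}\<close>, which converge to it locally uniformly.\<close>

lemma laplace_powr_complex:
  fixes a :: real and s :: complex
  assumes a: "a > 0" and s: "Re s > 0"
  shows "(LBINT v. of_real (indicator {0..} v * v powr a) * exp (- s * of_real v)) = of_real (Gamma (a + 1)) * s powr (-of_real a - 1)"
proof -
  define f where "f = (\<lambda>s v. of_real (indicator {0..} v * v powr a) * exp (- s * complex_of_real v))"
  define F where "F = (\<lambda>s. LBINT v. f s v)"
  define G where "G = (\<lambda>N s. integral (cbox 0 (real N)) (\<lambda>v. of_real (v powr a) * exp (- s * complex_of_real v)))"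
  have norm_f: "norm (f s v) = indicator {0..} v * (v powr a * exp (- Re s * v))" for s v
    by (simp add: f_def norm_mult indicator_def)
  have f_meas [measurable]: "f s \<in> borel_measurable lborel" for s
    unfolding f_def by measurable
  have intf: "integrable lborel (f s)" if "Re s > 0" for s
    by (rule Bochner_Integration.integrable_bound[where f = "\<lambda>v. indicator {0..} v * (v powr a * exp (- Re s * v))"])
       (use has_bochner_integral_laplace_real[OF a that] norm_f in \<open>auto simp: has_bochner_integral_iff\<close>)
  have G_eq: "G N s = (LBINT v. indicator {..real N} v *\<^sub>R f s v)" for N s
  proof -
    have "set_integrable lborel {0..real N} (\<lambda>v. of_real (v powr a) * exp (- s * complex_of_real v))"
      using a by (intro borel_integrable_atLeastAtMost' continuous_intros continuous_on_powr') auto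
    then have "G N s = (LBINT v:{0..real N}. of_real (v powr a) * exp (- s * complex_of_real v))"
      unfolding G_def by (simp add: set_borel_integral_eq_integral)
    also have "\<dots> = (LBINT v. indicator {..real N} v *\<^sub>R f s v)"
      unfolding set_lebesgue_integral_def f_def by (intro Bochner_Integration.integral_cong) (auto simp: indicator_def)
    finally show ?thesis .
  qed
  have holG: "G N holomorphic_on UNIV" for N
    unfolding G_def
  proof (rule leibniz_rule_holomorphic)
    show "continuous_on (UNIV \<times> cbox 0 (real N)) (\<lambda>(s, v). of_real (v powr a) * (exp (- s * complex_of_real v) * (- of_real v)))"
      using a unfolding case_prod_unfold by (intro continuous_intros continuous_on_powr') auto
    show "((\<lambda>s. of_real (v powr a) * exp (- s * complex_of_real v)) has_field_derivative of_real (v powr a) * (exp (- s * complex_of_real v) * (- of_real v))) (at s within UNIV)" for s v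
      by (auto intro!: derivative_eq_intros)
    show "(\<lambda>v. of_real (v powr a) * exp (- s * complex_of_real v)) integrable_on cbox 0 (real N)" for s
      using a by (intro integrable_continuous continuous_intros continuous_on_powr') auto
  qed auto
  have "F holomorphic_on {s. Re s > 0}"
  proof (rule holomorphic_uniform_sequence)
    show "open {s. Re s > 0}" by (rule open_halfspace_Re_gt)
    show "G N holomorphic_on {s. Re s > 0}" for N using holG by (rule holomorphic_on_subset) auto
    fix s assume "s \<in> {s. Re s > 0}"
    then have s: "Re s > 0" by simp
    \<comment> \<open>On the disc of radius \<open>Re s / 2\<close> the real part stays at least
      \<open>d\<close>, so the integrand at the real point \<open>d\<close> dominates all tails at
      once.\<close>
    define d where "d = Re s / 2"
    have d: "d > 0" using s by (simp add: d_def)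
    have ge: "Re u \<ge> d" if "u \<in> cball s d" for u
      using that abs_Re_le_cmod[of "s - u"] by (auto simp: dist_norm d_def)
    define T where "T = (\<lambda>v. indicator {0..} v * (v powr a * exp (- d * v)))"
    have intT: "integrable lborel T"
      unfolding T_def using has_bochner_integral_laplace_real[OF a d] by (simp add: has_bochner_integral_iff)
    have "uniform_limit (cball s d) G F sequentially"
      unfolding uniform_limit_iff
    proof (intro allI impI)
      fix e :: real assume e: "e > 0"
      let ?I = "\<lambda>N. LBINT v. indicator {..real N} v *\<^sub>R T v"
      have "((\<lambda>y. LBINT v. indicator {..y} v *\<^sub>R T v) \<longlongrightarrow> integral\<^sup>L lborel T) at_top"
        by (rule tendsto_integral_at_top) (use intT in auto)
      then have "?I \<longlonglongrightarrow> integral\<^sup>L lborel T"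
        by (rule filterlim_compose) (rule filterlim_real_sequentially)
      then have "\<forall>\<^sub>F N in sequentially. dist (?I N) (integral\<^sup>L lborel T) < e"
        using e by (rule tendstoD)
      then show "\<forall>\<^sub>F N in sequentially. \<forall>u\<in>cball s d. dist (G N u) (F u) < e"
      proof eventually_elim
        case (elim N)
        have T_int: "integrable lborel (\<lambda>v. indicator {..real N} v *\<^sub>R T v)"
          using intT by (intro integrable_mult_indicator) auto
        show ?case
        proof
          fix u assume u: "u \<in> cball s d"
          have "Re u > 0" using ge[OF u] d by simp
          note iu = intf[OF this]
          have iu': "integrable lborel (\<lambda>v. indicator {..real N} v *\<^sub>R f u v)"
            using iu by (intro integrable_mult_indicator) auto
          have "dist (G N u) (F u) = norm (LBINT v. f u v - indicator {..real N} v *\<^sub>R f u v)"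
            unfolding G_eq F_def dist_commute[of "LBINT v. indicator {..real N} v *\<^sub>R f u v"] dist_norm
            by (subst Bochner_Integration.integral_diff[OF iu iu']) (simp add: norm_minus_commute)
          also have "\<dots> \<le> (LBINT v. T v - indicator {..real N} v *\<^sub>R T v)"
          proof (rule Bochner_Integration.integral_norm_bound_integral)
            fix v
            have "norm (f u v) \<le> T v"
              unfolding norm_f T_def using ge[OF u]
              by (auto simp: indicator_def intro!: mult_left_mono mult_right_mono)
            then show "norm (f u v - indicator {..real N} v *\<^sub>R f u v) \<le> T v - indicator {..real N} v *\<^sub>R T v"
              by (auto simp: indicator_def)
          qed (use iu iu' T_int intT in auto)
          also have "\<dots> = integral\<^sup>L lborel T - ?I N"
            by (rule Bochner_Integration.integral_diff[OF intT T_int])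
          also have "\<dots> < e" using elim by (simp add: dist_real_def)
          finally show "dist (G N u) (F u) < e" .
        qed
      qed
    qed
    moreover have "cball s d \<subseteq> {s. Re s > 0}" using ge d by force
    ultimately show "\<exists>d>0. cball s d \<subseteq> {s. 0 < Re s} \<and> uniform_limit (cball s d) G F sequentially"
      using d by blast
  qed
  moreover have "(\<lambda>s. of_real (Gamma (a + 1)) * s powr (-of_real a - 1)) holomorphic_on {s. Re s > 0}"
    by (auto intro!: holomorphic_intros simp: complex_nonpos_Reals_iff)
  ultimately have hol: "(\<lambda>s. F s - of_real (Gamma (a + 1)) * s powr (-of_real a - 1)) holomorphic_on {s. Re s > 0}"
    by (rule holomorphic_on_diff)
  have "F s - of_real (Gamma (a + 1)) * s powr (-of_real a - 1) = 0"
  proof (rule analytic_continuation[OF hol open_halfspace_Re_gt, where U = "of_real ` {0<..}" and \<xi> = 1])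
    show "connected {s. Re s > 0}" by (intro convex_connected convex_halfspace_Re_gt)
    have "(\<lambda>n. complex_of_real (1 + 1 / real (Suc n))) \<longlonglongrightarrow> of_real (1 + 0)"
      by (intro tendsto_of_real tendsto_add tendsto_const LIMSEQ_Suc[OF lim_1_over_n])
    then show "1 islimpt complex_of_real ` {0<..}"
      unfolding islimpt_sequential
      by (intro exI[of _ "\<lambda>n. complex_of_real (1 + 1 / real (Suc n))"]) (auto simp del: of_real_add of_real_divide simp: of_real_eq_1_iff intro!: imageI add_pos_pos)
    fix z assume "z \<in> complex_of_real ` {0<..}"
    then obtain x where x: "z = of_real x" "x > 0" by auto
    have "F z = (LBINT v. complex_of_real (indicator {0..} v * (v powr a * exp (- x * v))))"
      unfolding F_def f_def x by (intro Bochner_Integration.integral_cong) (auto simp: exp_of_real[symmetric])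
    also have "\<dots> = of_real (Gamma (a + 1) * x powr (-a-1))"
      unfolding integral_complex_of_real using has_bochner_integral_laplace_real[OF a x(2)]
      by (simp add: has_bochner_integral_iff)
    finally show "F z - of_real (Gamma (a + 1)) * z powr (-of_real a - 1) = 0"
      using x by (simp add: powr_of_real[symmetric])
  qed (use s in auto)
  then show ?thesis by (simp add: F_def f_def)
qed

subsection \<open>Euler products of multiplicative functions\<close>

text \<open>The strict bound fits the products over \<open>p < N\<close>: the induction on
  \<open>N\<close> starts from \<open>{1}\<close>, and passing to \<open>Suc N\<close> admits at
  most the one new prime \<open>N\<close>.\<close>

definition smooth_numbers :: "nat \<Rightarrow> nat set" where
  "smooth_numbers N = {n. n > 0 \<and> (\<forall>p. prime p \<longrightarrow> p dvd n \<longrightarrow> p < N)}"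

lemma smooth_numbers_0: "smooth_numbers 0 = {1}"
  unfolding smooth_numbers_def using prime_factor_nat by fastforce

lemma smooth_numbers_Suc_not_prime: "\<not> prime N \<Longrightarrow> smooth_numbers (Suc N) = smooth_numbers N"
  unfolding smooth_numbers_def using less_Suc_eq by auto

lemma smooth_numbers_not_dvd: "prime p \<Longrightarrow> m \<in> smooth_numbers p \<Longrightarrow> \<not> p dvd m"
  unfolding smooth_numbers_def by auto

text \<open>The exponent is recovered as the multiplicity of \<open>p\<close>, since the cofactor
  has only prime factors below \<open>p\<close>.\<close>

lemma bij_betw_smooth_numbers_Suc:
  assumes "prime p"
  shows "bij_betw (\<lambda>(a, m). p ^ a * m) (UNIV \<times> smooth_numbers p) (smooth_numbers (Suc p))"
  unfolding bij_betw_def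
proof
  show "inj_on (\<lambda>(a, m). p ^ a * m) (UNIV \<times> smooth_numbers p)"
  proof (rule inj_onI, clarsimp)
    fix a m b n assume *: "m \<in> smooth_numbers p" "n \<in> smooth_numbers p" "p ^ a * m = p ^ b * n"
    have "multiplicity p (p ^ a * m) = a" if "m \<in> smooth_numbers p" for a m
      using assms smooth_numbers_not_dvd[OF assms that] by (intro multiplicity_eqI) auto
    with * have "a = b" by metis
    with * assms show "a = b \<and> m = n" by auto
  qed
  show "(\<lambda>(a, m). p ^ a * m) ` (UNIV \<times> smooth_numbers p) = smooth_numbers (Suc p)"
  proof (intro equalityI subsetI)
    fix n assume "n \<in> (\<lambda>(a, m). p ^ a * m) ` (UNIV \<times> smooth_numbers p)"
    then obtain a m where "n = p ^ a * m" "m \<in> smooth_numbers p" by auto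
    moreover have "q < Suc p" if "prime q" "q dvd p ^ a * m" "m \<in> smooth_numbers p" for q
    proof -
      have "q dvd p \<or> q dvd m" using that by (meson prime_dvd_mult_iff prime_dvd_power)
      then show ?thesis
        using that assms primes_dvd_imp_eq[of q p] by (auto simp: smooth_numbers_def)
    qed
    ultimately show "n \<in> smooth_numbers (Suc p)"
      using assms by (auto simp: smooth_numbers_def prime_gt_0_nat)
  next
    fix n assume n: "n \<in> smooth_numbers (Suc p)"
    then have "n \<noteq> 0" by (auto simp: smooth_numbers_def)
    then obtain m where m: "n = p ^ multiplicity p n * m" "\<not> p dvd m"
      using assms by (metis multiplicity_decompose' not_prime_unit)
    have "m \<in> smooth_numbers p" unfolding smooth_numbers_def
    proof (safe)
      show "m > 0" using m \<open>n \<noteq> 0\<close> by (cases m) auto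
      fix q assume q: "prime q" "q dvd m"
      then have "q < Suc p" using n m(1) unfolding smooth_numbers_def by (metis (mono_tags, lifting) dvd_mult mem_Collect_eq)
      then show "q < p" using q m(2) by (metis less_SucE)
    qed
    with m(1) show "n \<in> (\<lambda>(a, m). p ^ a * m) ` (UNIV \<times> smooth_numbers p)" by force
  qed
qed

text \<open>Absolute convergence permits unordered sums, for which the bijection at a prime turns
  the sum into a product of two independent sums.\<close>

lemma infsum_smooth_numbers:
  fixes h :: "nat \<Rightarrow> complex"
  assumes h1: "h 1 = 1"
    and mult: "\<And>m n. coprime m n \<Longrightarrow> h (m * n) = h m * h n"
    and summ: "summable (\<lambda>n. norm (h n))"
  shows "infsum h (smooth_numbers N) = (\<Prod>p<N. if prime p then (\<Sum>a. h (p ^ a)) else 1)"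
proof (induction N)
  case 0
  then show ?case by (simp add: smooth_numbers_0 h1[simplified])
next
  case (Suc N)
  have abs: "h summable_on A" for A
    using norm_summable_imp_summable_on[OF summ] by (rule summable_on_subset) auto
  show ?case
  proof (cases "prime N")
    case False
    then show ?thesis using Suc by (simp add: smooth_numbers_Suc_not_prime)
  next
    case True
    note bij = bij_betw_smooth_numbers_Suc[OF True]
    have h': "h (case x of (a, m) \<Rightarrow> N ^ a * m) = (case x of (a, m) \<Rightarrow> h (N ^ a) * h m)"
      if x': "x \<in> UNIV \<times> smooth_numbers N" for x
    proof -
      obtain a m where x: "x = (a, m)" "m \<in> smooth_numbers N" using x' by (cases x) auto
      have "coprime (N ^ a) m" using smooth_numbers_not_dvd[OF True x(2)] True
        by (simp add: prime_imp_coprime coprime_power_left_iff)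
      then show ?thesis by (simp add: x mult)
    qed
    have summ2: "(\<lambda>(a, m). h (N ^ a) * h m) summable_on (UNIV \<times> smooth_numbers N)"
      using summable_on_reindex_bij_betw[OF bij, of h] abs by (simp add: h' cong: summable_on_cong)
    have "inj (\<lambda>a::nat. N ^ a)" using True prime_gt_1_nat[OF True] by (auto intro!: injI)
    then have "(\<lambda>n. norm (h n)) summable_on range (\<lambda>a. N ^ a)"
      by (intro summable_on_subset[OF norm_summable_imp_summable_on]) (use summ in auto)
    then have "(\<lambda>a. norm (h (N ^ a))) summable_on UNIV"
      using \<open>inj (\<lambda>a::nat. N ^ a)\<close> by (subst (asm) summable_on_reindex) (auto simp: o_def)
    then have pw: "(\<Sum>\<^sub>\<infinity>a. h (N ^ a)) = (\<Sum>a. h (N ^ a))"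
      by (metis has_sum_imp_sums has_sum_infsum sums_iff abs_summable_summable)
    have "infsum h (smooth_numbers (Suc N)) = infsum (\<lambda>x. h (case x of (a, m) \<Rightarrow> N ^ a * m)) (UNIV \<times> smooth_numbers N)"
      using infsum_reindex_bij_betw[OF bij, of h] by simp
    also have "\<dots> = infsum (\<lambda>(a, m). h (N ^ a) * h m) (UNIV \<times> smooth_numbers N)"
      by (rule infsum_cong) (rule h')
    also have "\<dots> = (\<Sum>\<^sub>\<infinity>a. \<Sum>\<^sub>\<infinity>m\<in>smooth_numbers N. h (N ^ a) * h m)"
      using infsum_Sigma'_banach[of "\<lambda>a m. h (N ^ a) * h m" UNIV "\<lambda>_. smooth_numbers N"] summ2 by simp
    also have "\<dots> = (\<Sum>a. h (N ^ a)) * infsum h (smooth_numbers N)"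
      by (simp only: infsum_cmult_right' infsum_cmult_left' pw)
    finally show ?thesis using Suc True by (simp add: mult.commute)
  qed
qed

text \<open>The sums over smooth numbers exhaust the series with dominated terms (Tannery), as every
  positive \<open>n\<close> is included once \<open>N > n\<close>. Only a limit of partial products
  is claimed; this suffices because Euler products are later identified by uniqueness of
  limits.\<close>

theorem euler_product_tendsto:
  fixes h :: "nat \<Rightarrow> complex"
  assumes h0: "h 0 = 0" and h1: "h 1 = 1"
    and mult: "\<And>m n. coprime m n \<Longrightarrow> h (m * n) = h m * h n"
    and summ: "summable (\<lambda>n. norm (h n))"
  shows "(\<lambda>N. \<Prod>p<N. if prime p then (\<Sum>a. h (p ^ a)) else 1) \<longlonglongrightarrow> (\<Sum>n. h n)"
proof -
  define g where "g = (\<lambda>N n. if n \<in> smooth_numbers N then h n else 0)"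
  have "(\<lambda>N. g N n) \<longlonglongrightarrow> h n" for n
  proof -
    have "eventually (\<lambda>N. g N n = h n) sequentially"
      using eventually_gt_at_top[of n]
    proof eventually_elim
      case (elim N)
      show ?case
      proof (cases "n = 0")
        case False
        then have "n \<in> smooth_numbers N"
          using elim by (auto simp: smooth_numbers_def dest!: dvd_imp_le)
        then show ?thesis by (simp add: g_def)
      qed (simp add: g_def h0)
    qed
    then show ?thesis by (rule tendsto_eventually)
  qed
  moreover have "\<forall>\<^sub>F (n, N) in at_top \<times>\<^sub>F sequentially. norm (g N n) \<le> norm (h n)"
    by (intro always_eventually) (auto simp: g_def)
  ultimately have "(\<lambda>N. suminf (g N)) \<longlonglongrightarrow> suminf h"
    using tannerys_theorem[of "\<lambda>n N. g N n" h sequentially "\<lambda>n. norm (h n)"] summ by simp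
  moreover have "suminf (g N) = (\<Prod>p<N. if prime p then (\<Sum>a. h (p ^ a)) else 1)" for N
  proof -
    have "summable (\<lambda>n. norm (g N n))"
      by (rule summable_comparison_test'[OF summ]) (simp add: g_def)
    then have "suminf (g N) = infsum (g N) UNIV"
      by (metis has_sum_imp_sums has_sum_infsum sums_iff norm_summable_imp_summable_on)
    also have "\<dots> = infsum h (smooth_numbers N)"
      by (rule infsum_cong_neutral) (auto simp: g_def)
    finally show ?thesis using infsum_smooth_numbers[OF h1 mult summ] by simp
  qed
  ultimately show ?thesis by simp
qed

subsection \<open>The zeta function to the left of the line Re s = 1\<close>

text \<open>Cauchy's inequality. Since \<open>r \<le> 1\<close>, the bound for the second derivative
  covers the lower orders too, so a function and its first two derivatives are estimated in one
  go.\<close>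

lemma norm_higher_deriv_le_2:
  fixes f :: "complex \<Rightarrow> complex"
  assumes f: "f holomorphic_on A" and sub: "cball s r \<subseteq> A" and r: "0 < r" "r \<le> 1" and j: "j \<le> 2"
    and B: "\<And>w. w \<in> cball s r \<Longrightarrow> norm (f w) \<le> B"
  shows "norm ((deriv ^^ j) f s) \<le> 2 * B / r\<^sup>2"
proof -
  have "norm (f s) \<le> B" using r by (intro B) simp
  then have "0 \<le> B" by (rule order.trans[OF norm_ge_zero])
  have "norm ((deriv ^^ j) f s) \<le> fact j * B / r ^ j"
  proof (rule Cauchy_inequality)
    show "f holomorphic_on ball s r"
      using sub ball_subset_cball by (blast intro: holomorphic_on_subset[OF f])
    show "continuous_on (cball s r) f"
      by (rule holomorphic_on_imp_continuous_on[OF holomorphic_on_subset[OF f sub]])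
    show "norm (f w) \<le> B" if "norm (s - w) = r" for w
      using that by (intro B) (simp add: dist_norm)
  qed (rule r)
  also have "\<dots> \<le> 2 * B / r\<^sup>2"
  proof (rule frac_le)
    show "fact j * B \<le> 2 * B"
      using \<open>0 \<le> B\<close> fact_mono[OF j, where 'a = real] by (intro mult_right_mono) (auto simp: fact_numeral)
    show "r\<^sup>2 \<le> r ^ j" using r j by (intro power_decreasing) auto
  qed (use r \<open>0 \<le> B\<close> in auto)
  finally show ?thesis .
qed

lemma holomorphic_on_suminf:
  fixes f :: "nat \<Rightarrow> complex \<Rightarrow> complex"
  assumes A: "open A" and f: "\<And>n. f n holomorphic_on A"
    and M: "\<And>s. s \<in> A \<Longrightarrow> \<exists>d>0. \<exists>M. cball s d \<subseteq> A \<and> summable M \<and> (\<forall>n. \<forall>u\<in>cball s d. norm (f n u) \<le> M n)"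
  shows "(\<lambda>s. \<Sum>n. f n s) holomorphic_on A"
proof (rule holomorphic_uniform_sequence[OF A])
  show "(\<lambda>s. \<Sum>n<N. f n s) holomorphic_on A" for N
    by (intro holomorphic_intros f)
  fix s assume "s \<in> A"
  from M[OF this] obtain d M where "d > 0" "cball s d \<subseteq> A" "summable M" "\<And>n u. u \<in> cball s d \<Longrightarrow> norm (f n u) \<le> M n"
    by blast
  moreover from this have "uniform_limit (cball s d) (\<lambda>N s. \<Sum>n<N. f n s) (\<lambda>s. \<Sum>n. f n s) sequentially"
    by (intro Weierstrass_m_test) auto
  ultimately show "\<exists>d>0. cball s d \<subseteq> A \<and> uniform_limit (cball s d) (\<lambda>N s. \<Sum>n<N. f n s) (\<lambda>s. \<Sum>n. f n s) sequentially"
    by blast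
qed

text \<open>The error of replacing \<open>of_nat n powr (-s)\<close> by the integral of
  \<open>u powr (-s)\<close> over the next unit interval. For \<open>Re s > 1\<close> these errors
  sum to the zeta function minus \<open>1 / (s - 1)\<close>, and their sum still converges to the
  left of \<open>Re s = 1\<close>.\<close>

definition zeta_term :: "nat \<Rightarrow> complex \<Rightarrow> complex" where
  "zeta_term n s = integral {real n..real n + 1} (\<lambda>u. of_nat n powr (-s) - of_real u powr (-s))"

definition zeta_rem :: "complex \<Rightarrow> complex" where
  "zeta_rem s = (\<Sum>n. zeta_term (Suc n) s)"

text \<open>The trivial bound does not grow with \<open>s\<close>; the mean value bound gains a
  factor \<open>1 / a\<close> at the price of \<open>norm s\<close>. Their geometric mean with
  weights \<open>1 - \<theta>\<close> and \<open>\<theta>\<close> buys a small gain in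
  \<open>a\<close> for a small power of \<open>norm s\<close>.\<close>

lemma norm_powr_diff_le:
  fixes s :: complex and a u :: real
  assumes "0 < a" "a \<le> u" "u \<le> a + 1" "Re s > 0" "0 < \<theta>" "\<theta> \<le> 1"
  shows "norm (of_real a powr (-s) - of_real u powr (-s)) \<le> 2 * norm s powr \<theta> * a powr (- Re s - \<theta>)"
proof -
  define m where "m = norm (of_real a powr (-s) - of_real u powr (-s))"
  have "m \<le> norm (of_real a powr (-s)) + norm (of_real u powr (-s))"
    unfolding m_def by (rule norm_triangle_ineq4)
  also have "\<dots> = a powr (- Re s) + u powr (- Re s)" using assms by (simp add: norm_powr_real_powr)
  also have "\<dots> \<le> 2 * a powr (- Re s)" using assms powr_mono2'[of "- Re s" a u] by simp
  finally have 1: "m \<le> 2 * a powr (- Re s)" .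
  have "norm (of_real u powr (-s) - of_real a powr (-s)) \<le> (norm s * a powr (- Re s - 1)) * norm (of_real u - of_real a :: complex)"
  proof (rule field_differentiable_bound[where f = "\<lambda>w. w powr (-s)" and f' = "\<lambda>z. - s * z powr (-s - 1)"])
    \<comment> \<open>A ray of the real axis written as a convex complex set, so that the complex
      mean value bound needs the derivative only at real points.\<close>
    define S where "S = {w. Re w \<ge> a} \<inter> ({w. Im w \<le> 0} \<inter> {w. Im w \<ge> 0})"
    show "convex S" unfolding S_def
      by (intro convex_Int convex_halfspace_Re_ge convex_halfspace_Im_le convex_halfspace_Im_ge)
    show "of_real u \<in> S" "of_real a \<in> S" using assms by (auto simp: S_def)
    fix z assume z: "z \<in> S"
    define v where "v = Re z"
    have v: "z = of_real v" "a \<le> v" using z by (auto simp: S_def v_def complex_eq_iff)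
    have "z \<notin> \<real>\<^sub>\<le>\<^sub>0" using v assms by (auto simp: complex_nonpos_Reals_iff)
    then show "((\<lambda>w. w powr (-s)) has_field_derivative (-s * z powr (-s - 1))) (at z within S)"
      by (rule has_field_derivative_at_within[OF has_field_derivative_powr])
    have "v powr (- Re s - 1) \<le> a powr (- Re s - 1)" using assms v by (intro powr_mono2') auto
    moreover have "norm (z powr (-s - 1)) = v powr (- Re s - 1)"
      using norm_powr_real_powr[of z "-s - 1"] v assms by simp
    ultimately show "norm (-s * z powr (-s - 1)) \<le> norm s * a powr (- Re s - 1)"
      by (simp add: norm_mult mult_left_mono)
  qed
  also have "norm (of_real u - of_real a :: complex) = u - a" using assms by (simp flip: of_real_diff)
  also have "norm s * a powr (- Re s - 1) * (u - a) \<le> norm s * a powr (- Re s - 1) * 1"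
    using assms by (intro mult_left_mono) auto
  finally have 2: "m \<le> norm s * a powr (- Re s - 1)"
    unfolding m_def by (simp only: norm_minus_commute mult_1_right)
  have "m \<ge> 0" by (simp add: m_def)
  show ?thesis
  proof (cases "m = 0")
    case True
    then show ?thesis by (simp add: m_def)
  next
    case False
    with \<open>m \<ge> 0\<close> have m: "m > 0" by simp
    have "s \<noteq> 0" using assms by auto
    have "m = m powr (1 - \<theta>) * m powr \<theta>" using m by (simp flip: powr_add)
    also have "\<dots> \<le> (2 * a powr (- Re s)) powr (1 - \<theta>) * (norm s * a powr (- Re s - 1)) powr \<theta>"
      using 1 2 m assms by (intro mult_mono powr_mono2) auto
    also have "\<dots> = 2 powr (1 - \<theta>) * (norm s powr \<theta> * a powr (- Re s - \<theta>))"
      using assms by (simp add: powr_mult powr_powr algebra_simps flip: powr_add)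
    also have "\<dots> \<le> 2 powr 1 * (norm s powr \<theta> * a powr (- Re s - \<theta>))"
      using assms by (intro mult_right_mono powr_mono) auto
    finally show ?thesis by (simp add: m_def)
  qed
qed

text \<open>The interpolation is used with \<open>\<theta> = 2 * \<delta>\<close>: one
  \<open>\<delta>\<close> compensates for a real part as small as \<open>1 - \<delta>\<close>, the
  other makes the sum over \<open>n\<close> converge.\<close>

lemma norm_zeta_term_le:
  fixes s :: complex and n :: nat
  assumes "n > 0" "0 < \<delta>" "\<delta> \<le> 1/2" "Re s \<ge> 1 - \<delta>"
  shows "norm (zeta_term n s) \<le> 2 * norm s powr (2 * \<delta>) * real n powr (- 1 - \<delta>)"
proof -
  have "norm (zeta_term n s) \<le> 2 * norm s powr (2 * \<delta>) * real n powr (- Re s - 2 * \<delta>) * (real n + 1 - real n)"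
    unfolding zeta_term_def
  proof (rule integral_bound)
    show "continuous_on {real n..real n + 1} (\<lambda>u. of_nat n powr (-s) - complex_of_real u powr (-s))"
      using assms by (auto intro!: continuous_intros simp: complex_nonpos_Reals_iff)
    fix u assume "u \<in> {real n..real n + 1}"
    then show "norm (of_nat n powr (-s) - complex_of_real u powr (-s)) \<le> 2 * norm s powr (2 * \<delta>) * real n powr (- Re s - 2 * \<delta>)"
      using norm_powr_diff_le[of "real n" u s "2 * \<delta>"] assms by auto
  qed auto
  also have "\<dots> \<le> 2 * norm s powr (2 * \<delta>) * real n powr (- 1 - \<delta>)"
    using assms by (auto intro!: mult_left_mono powr_mono)
  finally show ?thesis .
qed

lemma zeta_term_holomorphic:
  assumes "n > 0"
  shows "zeta_term n holomorphic_on UNIV"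
proof -
  have "(\<lambda>s. integral (cbox (real n) (real n + 1)) (\<lambda>u. of_nat n powr (-s) - of_real u powr (-s))) holomorphic_on UNIV"
  proof (rule leibniz_rule_holomorphic)
    define fx where "fx = (\<lambda>s u. Ln (of_nat n) * of_nat n powr (-s) * (-1) - Ln (of_real u) * complex_of_real u powr (-s) * (-1))"
    have powr_der: "((\<lambda>s. w powr (-s)) has_field_derivative Ln w * w powr (-s) * (-1)) (at s within UNIV)"
      if "w \<noteq> 0" for w s :: complex
      using that by (intro DERIV_chain2[OF has_field_derivative_powr_right]) (auto intro!: derivative_eq_intros)
    show "((\<lambda>s. of_nat n powr (-s) - complex_of_real u powr (-s)) has_field_derivative fx s u) (at s within UNIV)"
      if "u \<in> cbox (real n) (real n + 1)" for s u
      unfolding fx_def using that assms by (intro DERIV_diff powr_der) auto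
    show "continuous_on (UNIV \<times> cbox (real n) (real n + 1)) (\<lambda>(s, u). fx s u)"
      unfolding fx_def case_prod_unfold using assms
      by (intro continuous_intros) (auto simp: complex_nonpos_Reals_iff)
    show "(\<lambda>u. of_nat n powr (-s) - complex_of_real u powr (-s)) integrable_on cbox (real n) (real n + 1)" for s
      using assms by (intro integrable_continuous continuous_intros) (auto simp: complex_nonpos_Reals_iff)
  qed auto
  then show ?thesis by (simp add: zeta_term_def[abs_def])
qed

lemma summable_Suc_powr: "\<delta> > 0 \<Longrightarrow> summable (\<lambda>n. real (Suc n) powr (- 1 - \<delta>))"
  using summable_real_powr_iff[of "- 1 - \<delta>"] by (subst summable_Suc_iff) simp

lemma summable_norm_zeta_term:
  assumes "Re s > 1/2"
  shows "summable (\<lambda>n. norm (zeta_term (Suc n) s))"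
proof (rule summable_comparison_test')
  show "summable (\<lambda>n. 2 * norm s powr (2 * (1/2)) * real (Suc n) powr (- 1 - 1/2))"
    using summable_Suc_powr[of "1/2"] by (intro summable_mult) simp
  show "norm (norm (zeta_term (Suc n) s)) \<le> 2 * norm s powr (2 * (1/2)) * real (Suc n) powr (- 1 - 1/2)" for n
    using norm_zeta_term_le[of "Suc n" "1/2" s] assms by simp
qed

lemma zeta_rem_holomorphic: "zeta_rem holomorphic_on {s. Re s > 1/2}"
  unfolding zeta_rem_def[abs_def]
proof (rule holomorphic_on_suminf)
  show "open {s. Re s > 1/2}" by (rule open_halfspace_Re_gt)
  show "zeta_term (Suc n) holomorphic_on {s. Re s > 1/2}" for n
    by (rule holomorphic_on_subset[OF zeta_term_holomorphic]) auto
  fix s assume "s \<in> {s. Re s > 1/2}"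
  then obtain d where d: "d > 0" "cball s d \<subseteq> {s. Re s > 1/2}"
    using open_contains_cball open_halfspace_Re_gt by metis
  define M where "M = (\<lambda>n. 2 * (norm s + d) * real (Suc n) powr (- 1 - 1/2))"
  have "summable M"
    unfolding M_def using summable_Suc_powr[of "1/2"] by (intro summable_mult) simp
  moreover have "norm (zeta_term (Suc n) u) \<le> M n" if u: "u \<in> cball s d" for n u
  proof -
    have "norm u \<le> norm s + d"
      using u norm_triangle_ineq2[of u s] by (simp add: dist_norm norm_minus_commute)
    moreover have "Re u > 1/2" using u d by auto
    ultimately show ?thesis
      using norm_zeta_term_le[of "Suc n" "1/2" u]
      by (auto simp: M_def elim!: order.trans intro!: mult_right_mono)
  qed
  ultimately show "\<exists>d>0. \<exists>M. cball s d \<subseteq> {s. Re s > 1/2} \<and> summable M \<and> (\<forall>n. \<forall>u\<in>cball s d. norm (zeta_term (Suc n) u) \<le> M n)"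
    using d by blast
qed

lemma norm_zeta_rem_le:
  assumes "0 < \<delta>" "\<delta> < 1/2" "Re s \<ge> 1 - \<delta>"
  shows "norm (zeta_rem s) \<le> (\<Sum>n. real (Suc n) powr (- 1 - \<delta>)) * 2 * norm s powr (2 * \<delta>)"
proof -
  have "norm (zeta_rem s) \<le> (\<Sum>n. norm (zeta_term (Suc n) s))"
    unfolding zeta_rem_def by (rule summable_norm) (use summable_norm_zeta_term assms in auto)
  also have "\<dots> \<le> (\<Sum>n. 2 * norm s powr (2 * \<delta>) * real (Suc n) powr (- 1 - \<delta>))"
    using assms by (intro suminf_le summable_norm_zeta_term summable_mult summable_Suc_powr norm_zeta_term_le) auto
  also have "\<dots> = (\<Sum>n. real (Suc n) powr (- 1 - \<delta>)) * 2 * norm s powr (2 * \<delta>)"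
    using assms by (subst suminf_mult[OF summable_Suc_powr]) auto
  finally show ?thesis .
qed

text \<open>Cauchy's inequality on discs of the fixed radius \<open>\<delta>\<close>. These reach
  into \<open>Re w \<ge> 1 - \<delta>\<close>, which is why \<open>zeta_rem\<close> had to be
  bounded to the left of the line.\<close>

lemma zeta_rem_growth:
  assumes "\<epsilon> > 0"
  obtains C where "C > 0" "\<And>s j. Re s \<ge> 1 \<Longrightarrow> j \<le> 2 \<Longrightarrow> norm ((deriv ^^ j) zeta_rem s) \<le> C * norm s powr \<epsilon>"
proof -
  \<comment> \<open>The bound \<open>\<epsilon> / 2\<close> keeps the growth exponent
    \<open>2 * \<delta>\<close> at most \<open>\<epsilon>\<close>; \<open>1/3\<close> keeps the
    discs inside \<open>Re s > 1/2\<close>.\<close>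
  define \<delta> where "\<delta> = min (1/3) (\<epsilon> / 2)"
  have \<delta>: "0 < \<delta>" "\<delta> < 1/2" "2 * \<delta> \<le> \<epsilon>" using assms by (auto simp: \<delta>_def)
  define S where "S = (\<Sum>n. real (Suc n) powr (- 1 - \<delta>))"
  have S: "S \<ge> 0" unfolding S_def by (intro suminf_nonneg summable_Suc_powr \<delta>) auto
  define C where "C = 2 * (S * 2 * 2 powr \<epsilon>) / (\<delta>)^2 + 1"
  have C: "C > 0" using S \<delta> by (simp add: C_def add_nonneg_pos)
  show ?thesis
  proof (rule that[OF C])
    fix s :: complex and j :: nat
    assume s: "Re s \<ge> 1" and j: "j \<le> 2"
    have n1: "norm s \<ge> 1" using s complex_Re_le_cmod[of s] by linarith
    have Re_ge: "Re w \<ge> 1 - \<delta>" if "w \<in> cball s \<delta>" for w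
      using that s abs_Re_le_cmod[of "s - w"] by (auto simp: dist_norm)
    have sub: "cball s \<delta> \<subseteq> {s. Re s > 1/2}" using Re_ge \<delta> by force
    have "norm ((deriv ^^ j) zeta_rem s) \<le> 2 * (S * 2 * 2 powr \<epsilon> * norm s powr \<epsilon>) / \<delta>\<^sup>2"
    proof (rule norm_higher_deriv_le_2[OF zeta_rem_holomorphic sub \<delta>(1) _ j])
      fix w assume w: "w \<in> cball s \<delta>"
      have "norm w \<le> norm s + \<delta>" using norm_triangle_ineq2[of w s] w by (simp add: dist_norm norm_minus_commute)
      then have "norm w \<le> 2 * norm s" using n1 \<delta> by linarith
      have "norm (zeta_rem w) \<le> S * 2 * norm w powr (2 * \<delta>)"
        unfolding S_def using \<delta> Re_ge[OF w] by (intro norm_zeta_rem_le) auto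
      also have "norm w powr (2 * \<delta>) \<le> (2 * norm s) powr (2 * \<delta>)"
        using \<open>norm w \<le> 2 * norm s\<close> \<delta> by (intro powr_mono2) auto
      also have "\<dots> \<le> (2 * norm s) powr \<epsilon>" using n1 \<delta> by (intro powr_mono) auto
      finally show "norm (zeta_rem w) \<le> S * 2 * 2 powr \<epsilon> * norm s powr \<epsilon>"
        using S by (simp add: powr_mult mult_left_mono mult.assoc)
    qed (use \<delta> in auto)
    also have "\<dots> \<le> C * norm s powr \<epsilon>" using S \<delta> by (simp add: C_def field_simps)
    finally show "norm ((deriv ^^ j) zeta_rem s) \<le> C * norm s powr \<epsilon>" .
  qed
qed

text \<open>\<open>P\<close> consists of the values of an antiderivative of
  \<open>u powr (-s)\<close> at the positive integers, so the integrals telescope; the boundary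
  value \<open>P 0\<close> supplies \<open>1 / (s - 1)\<close>.\<close>

lemma zeta_sums:
  assumes s: "Re s > 1"
  shows "(\<lambda>n. of_nat (Suc n) powr (-s)) sums (1 / (s - 1) + zeta_rem s)"
proof -
  have s1: "s \<noteq> 1" using s by auto
  define P where "P = (\<lambda>n. - (complex_of_nat (Suc n) powr (1 - s)) / (s - 1))"
  have T: "zeta_term (Suc n) s = of_nat (Suc n) powr (-s) - (P (Suc n) - P n)" for n
  proof -
    have "((\<lambda>u. of_real u powr (-s)) has_integral ((- (of_real (real (Suc n) + 1) powr (1 - s)) / (s - 1)) - (- (of_real (real (Suc n)) powr (1 - s)) / (s - 1)))) {real (Suc n)..real (Suc n) + 1}"
    proof (rule fundamental_theorem_of_calculus)
      fix u assume u: "u \<in> {real (Suc n)..real (Suc n) + 1}"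
      then have "complex_of_real u \<notin> \<real>\<^sub>\<le>\<^sub>0" by (auto simp: complex_nonpos_Reals_iff)
      then have "((\<lambda>w. - (w powr (1 - s)) / (s - 1)) has_field_derivative (of_real u powr (-s))) (at (of_real u))"
        using s1 by (auto intro!: derivative_eq_intros simp: divide_simps) (simp add: algebra_simps)
      then show "((\<lambda>u. - (of_real u powr (1 - s)) / (s - 1)) has_vector_derivative (of_real u powr (-s))) (at u within {real (Suc n)..real (Suc n) + 1})"
        by (intro has_vector_derivative_real_field[where f = "\<lambda>w. - (w powr (1 - s)) / (s - 1)"])
    qed simp
    then have "((\<lambda>u. of_real u powr (-s)) has_integral (P (Suc n) - P n)) {real (Suc n)..real (Suc n) + 1}"
      by (simp add: P_def add_ac)
    moreover have "((\<lambda>u. complex_of_nat (Suc n) powr (-s)) has_integral (real (Suc n) + 1 - real (Suc n)) *\<^sub>R of_nat (Suc n) powr (-s)) {real (Suc n)..real (Suc n) + 1}"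
      by (rule has_integral_const_real[THEN has_integral_eq_rhs]) simp
    ultimately have "((\<lambda>u. of_nat (Suc n) powr (-s) - of_real u powr (-s)) has_integral ((real (Suc n) + 1 - real (Suc n)) *\<^sub>R of_nat (Suc n) powr (-s) - (P (Suc n) - P n))) {real (Suc n)..real (Suc n) + 1}"
      by (intro has_integral_diff)
    from integral_unique[OF this] show ?thesis by (simp add: zeta_term_def)
  qed
  have "P \<longlonglongrightarrow> 0"
  proof (rule tendsto_norm_zero_cancel)
    have "(\<lambda>n. real (Suc n) powr (1 - Re s)) \<longlonglongrightarrow> 0"
      using s by real_asymp
    from tendsto_divide[OF this tendsto_const[of "norm (s - 1)"]] s1
    have "(\<lambda>n. real (Suc n) powr (1 - Re s) / norm (s - 1)) \<longlonglongrightarrow> 0"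
      by simp
    then show "(\<lambda>n. norm (P n)) \<longlonglongrightarrow> 0"
      using norm_powr_real_powr[of "of_nat (Suc _)" "1 - s"]
      by (simp add: P_def norm_divide del: of_nat_Suc)
  qed
  from telescope_sums[OF this] have "(\<lambda>n. P (Suc n) - P n) sums (0 - P 0)" .
  moreover have "P 0 = - 1 / (s - 1)" by (simp add: P_def)
  moreover have "(\<lambda>n. zeta_term (Suc n) s) sums zeta_rem s"
    unfolding zeta_rem_def using summable_norm_zeta_term[of s] s
    by (intro summable_sums summable_norm_cancel[of "\<lambda>n. zeta_term (Suc n) s"]) auto
  ultimately have "(\<lambda>n. zeta_term (Suc n) s + (P (Suc n) - P n)) sums (zeta_rem s + (0 - (- 1 / (s - 1))))"
    by (intro sums_add) simp_all
  then show ?thesis by (simp add: T add.commute)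
qed

subsection \<open>The logarithm of the zeta function\<close>

text \<open>Defined by the continued expression, so that derivatives up to and including the line
  \<open>Re s = 1\<close> are covered away from the pole; for \<open>Re s > 1\<close> it is the
  Dirichlet series by \<open>zeta_sums\<close>.\<close>

definition zeta :: "complex \<Rightarrow> complex" where
  "zeta s = 1 / (s - 1) + zeta_rem s"

definition log_zeta_term :: "nat \<Rightarrow> complex \<Rightarrow> complex" where
  "log_zeta_term n s = (if prime n then - Ln (1 - of_nat n powr (-s)) else 0)"

text \<open>The branch of the logarithm that the Euler product provides. Each summand involves a
  principal logarithm of a number within \<open>1/2\<close> of 1, so the sum is holomorphic on
  \<open>Re s > 1\<close>, whereas \<open>Ln (zeta s)\<close> could jump.\<close>

definition log_zeta :: "complex \<Rightarrow> complex" where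
  "log_zeta s = (\<Sum>n. log_zeta_term n s)"

lemma norm_nat_powr: "n > 0 \<Longrightarrow> norm (of_nat n powr s) = real n powr Re s"
  using norm_powr_real_powr[of "of_nat n" s] by simp

lemma norm_prime_powr_less:
  assumes "prime n" "Re s > 1"
  shows "norm (of_nat n powr (-s)) < 1/2"
proof -
  have n: "n \<ge> 2" using assms by (simp add: prime_ge_2_nat)
  have "norm (of_nat n powr (-s)) = real n powr (- Re s)" using n by (simp add: norm_nat_powr)
  also have "\<dots> \<le> 2 powr (- Re s)" using n assms by (intro powr_mono2') auto
  also have "\<dots> < 2 powr (-1)" using assms by (intro powr_less_mono) auto
  finally show ?thesis by (simp add: powr_minus)
qed

lemma norm_log_zeta_term_le:
  assumes "Re s > 1"
  shows "norm (log_zeta_term n s) \<le> 2 * real n powr (- Re s)"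
proof (cases "prime n")
  case True
  have "norm (Ln (1 + (- (of_nat n powr (-s))))) \<le> 2 * norm (- (of_nat n powr (-s)) :: complex)"
    using norm_prime_powr_less[OF True assms] by (intro norm_Ln_le) simp
  then show ?thesis using True by (simp add: log_zeta_term_def norm_nat_powr prime_gt_0_nat)
qed (simp add: log_zeta_term_def)

lemma summable_nat_powr: "c > 1 \<Longrightarrow> summable (\<lambda>n. real n powr (- c))"
  by (simp add: summable_real_powr_iff)

lemma log_zeta_sums:
  assumes "Re s > 1"
  shows "(\<lambda>n. log_zeta_term n s) sums log_zeta s"
  unfolding log_zeta_def
proof (rule summable_sums, rule summable_comparison_test')
  show "summable (\<lambda>n. 2 * real n powr (- Re s))" using summable_nat_powr[OF assms] by (rule summable_mult)
qed (rule norm_log_zeta_term_le[OF assms])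

lemma log_zeta_term_holomorphic: "log_zeta_term n holomorphic_on {s. Re s > 1}"
proof (cases "prime n")
  case True
  have "1 - of_nat n powr (-s) \<notin> \<real>\<^sub>\<le>\<^sub>0" if "Re s > 1" for s
    using norm_prime_powr_less[OF True that] complex_Re_le_cmod[of "of_nat n powr (-s)"]
    by (auto simp: complex_nonpos_Reals_iff)
  then have "(\<lambda>s. - Ln (1 - of_nat n powr (-s))) holomorphic_on {s. Re s > 1}"
    using True by (intro holomorphic_intros) (auto simp: prime_gt_0_nat)
  then show ?thesis using True by (simp add: log_zeta_term_def[abs_def])
qed (simp add: log_zeta_term_def[abs_def])

lemma log_zeta_holomorphic: "log_zeta holomorphic_on {s. Re s > 1}"
  unfolding log_zeta_def[abs_def]
proof (rule holomorphic_on_suminf[OF open_halfspace_Re_gt log_zeta_term_holomorphic])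
  fix s assume s: "s \<in> {s. Re s > 1}"
  define d where "d = (Re s - 1) / 2"
  have d: "d > 0" using s by (simp add: d_def)
  have ge: "Re u \<ge> 1 + d" if "u \<in> cball s d" for u
    using that complex_Re_le_cmod[of "s - u"] by (simp add: dist_norm d_def field_simps)
  define M where "M = (\<lambda>n. 2 * real n powr (- (1 + d)))"
  have "summable M"
    unfolding M_def using summable_nat_powr[of "1 + d"] d by (intro summable_mult) simp
  moreover have "norm (log_zeta_term n u) \<le> M n" if u: "u \<in> cball s d" for n u
  proof -
    have "real n powr (- Re u) \<le> real n powr (- (1 + d))"
      using ge[OF u] by (cases "n = 0") (auto intro!: powr_mono)
    then show ?thesis
      using norm_log_zeta_term_le[of u n] ge[OF u] d by (simp add: M_def)
  qed
  moreover have "cball s d \<subseteq> {s. Re s > 1}" using ge d by force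
  ultimately show "\<exists>d>0. \<exists>M. cball s d \<subseteq> {s. Re s > 1} \<and> summable M \<and> (\<forall>n. \<forall>u\<in>cball s d. norm (log_zeta_term n u) \<le> M n)"
    using d by blast
qed

lemma nat_mult_powr: "of_nat (m * n) powr (s::complex) = of_nat m powr s * of_nat n powr s"
  using powr_times_real[of "of_nat m" "of_nat n" s] by simp

lemma nat_power_powr: "of_nat (m ^ a) powr (s::complex) = (of_nat m powr s) ^ a" if "m > 0"
  by (induction a) (use that in \<open>simp_all only: power_Suc nat_mult_powr power_0 of_nat_1 powr_one_eq_one\<close>)

text \<open>Both sides are limits of the same finite Euler products. In particular
  \<open>zeta\<close> has no zero for \<open>Re s > 1\<close>.\<close>

lemma exp_log_zeta:
  assumes s: "Re s > 1"
  shows "exp (log_zeta s) = zeta s"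
proof -
  define h where "h = (\<lambda>n. complex_of_nat n powr (-s))"
  have summ: "summable (\<lambda>n. norm (h n))"
  proof (rule summable_comparison_test'[OF summable_nat_powr[OF s]])
    show "norm (norm (h n)) \<le> real n powr (- Re s)" for n
      by (cases "n = 0") (auto simp: h_def norm_nat_powr)
  qed
  have "(\<lambda>n. h (Suc n)) sums zeta s" unfolding h_def zeta_def by (rule zeta_sums[OF s])
  then have "h sums (zeta s + h 0)" by (subst (asm) sums_Suc_iff)
  \<comment> \<open>\<open>0 powr (-s)\<close> is 0, so the added term with index 0 contributes
    nothing.\<close>
  then have zs: "(\<Sum>n. h n) = zeta s" by (simp add: h_def sums_iff)
  have "(\<lambda>N. \<Prod>p<N. if prime p then (\<Sum>a. h (p ^ a)) else 1) \<longlonglongrightarrow> (\<Sum>n. h n)"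
  proof (rule euler_product_tendsto)
    show "h (m * n) = h m * h n" for m n by (simp only: h_def nat_mult_powr)
  qed (use summ in \<open>auto simp: h_def\<close>)
  moreover have "(\<Prod>p<N. if prime p then (\<Sum>a. h (p ^ a)) else 1) = exp (\<Sum>n<N. log_zeta_term n s)" for N
    unfolding exp_sum[OF finite_lessThan]
  proof (rule prod.cong)
    fix p
    show "(if prime p then (\<Sum>a. h (p ^ a)) else 1) = exp (log_zeta_term p s)"
    proof (cases "prime p")
      case True
      have lt: "norm (of_nat p powr (-s)) < 1" using norm_prime_powr_less[OF True s] by simp
      have "(\<Sum>a. h (p ^ a)) = (\<Sum>a. (of_nat p powr (-s)) ^ a)"
        unfolding h_def using True by (simp only: nat_power_powr prime_gt_0_nat)
      also have "\<dots> = 1 / (1 - of_nat p powr (-s))" using lt by (rule suminf_geometric)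
      also have "1 - of_nat p powr (-s) \<noteq> 0" using lt by auto
      then have "1 / (1 - of_nat p powr (-s)) = exp (log_zeta_term p s)"
        using True by (simp add: log_zeta_term_def exp_minus inverse_eq_divide)
      finally show ?thesis using True by simp
    qed (simp add: log_zeta_term_def)
  qed simp
  ultimately have "(\<lambda>N. exp (\<Sum>n<N. log_zeta_term n s)) \<longlonglongrightarrow> zeta s" by (simp add: zs)
  moreover have "(\<lambda>N. exp (\<Sum>n<N. log_zeta_term n s)) \<longlonglongrightarrow> exp (log_zeta s)"
    using log_zeta_sums[OF s] by (intro tendsto_exp) (simp add: sums_def)
  ultimately show ?thesis using LIMSEQ_unique by blast
qed

lemma zeta_nonzero: "Re s > 1 \<Longrightarrow> zeta s \<noteq> 0"
  by (metis exp_log_zeta exp_not_eq_zero)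

lemma norm_zeta_eq: "Re s > 1 \<Longrightarrow> norm (zeta s) = exp (Re (log_zeta s))"
  by (metis exp_log_zeta norm_exp_eq_Re)

text \<open>Pins down the branch: this later fixes the additive constant when
  \<open>log_zeta\<close> is compared with \<open>Ln\<close> near 1.\<close>

lemma Im_log_zeta_of_real:
  assumes "x > 1"
  shows "Im (log_zeta (of_real x)) = 0"
proof -
  have "Im (log_zeta_term n (of_real x)) = 0" for n
  proof (cases "prime n")
    case True
    have "complex_of_nat n powr (- of_real x) = of_real (real n powr (- x))"
      using powr_of_real[of "real n" "- x"] by simp
    moreover from norm_prime_powr_less[OF True, of "of_real x"] assms this
    have "real n powr (- x) < 1" by simp
    ultimately have "Ln (1 - of_nat n powr (- of_real x)) = of_real (ln (1 - real n powr (- x)))"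
      by (metis Ln_of_real diff_gt_0_iff_gt of_real_1 of_real_diff)
    then show ?thesis by (simp add: log_zeta_term_def)
  qed (simp add: log_zeta_term_def)
  moreover have "(\<lambda>n. Im (log_zeta_term n (of_real x))) sums Im (log_zeta (of_real x))"
    using assms by (intro sums_Im log_zeta_sums) simp
  ultimately have "(\<lambda>n. 0) sums Im (log_zeta (of_real x))" by simp
  then show ?thesis using sums_0 sums_unique2 by blast
qed

text \<open>The inequality already holds prime by prime. In the power series of the logarithms each
  coefficient carries \<open>3 + 4 v + v^2\<close> with \<open>norm v = 1\<close>, whose real part
  is \<open>2 (1 + Re v)^2\<close>.\<close>

lemma log_zeta_term_341:
  assumes "\<sigma> > 1"
  shows "Re (3 * log_zeta_term n (of_real \<sigma>) + 4 * log_zeta_term n (Complex \<sigma> t) + log_zeta_term n (Complex \<sigma> (2 * t))) \<ge> 0" (is "Re ?L \<ge> 0")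
proof (cases "prime n")
  case True
  then have n: "n > 0" by (simp add: prime_gt_0_nat)
  define w where "w = real n powr (- \<sigma>)"
  define u where "u = complex_of_nat n powr (- Complex 0 t)"
  have u1: "norm u = 1" unfolding u_def using n by (subst norm_nat_powr) auto
  have e0: "complex_of_nat n powr (- of_real \<sigma>) = of_real w"
    using powr_of_real[of "real n" "- \<sigma>"] by (simp add: w_def)
  have e1: "complex_of_nat n powr (- Complex \<sigma> t) = of_real w * u"
  proof -
    have "- Complex \<sigma> t = - of_real \<sigma> + - Complex 0 t" by (simp add: complex_eq_iff)
    then show ?thesis by (simp only: powr_add e0 u_def)
  qed
  have e2: "complex_of_nat n powr (- Complex \<sigma> (2 * t)) = of_real w * u\<^sup>2"
  proof -
    have "- Complex \<sigma> (2 * t) = - of_real \<sigma> + - Complex 0 t + - Complex 0 t" by (simp add: complex_eq_iff)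
    then show ?thesis by (simp only: powr_add e0 u_def power2_eq_square mult.assoc)
  qed
  have w: "w \<ge> 0" "w < 1"
    using norm_prime_powr_less[OF True, of "of_real \<sigma>"] assms by (auto simp: e0 w_def)
  \<comment> \<open>The term with \<open>j = 0\<close> is a division by 0, hence 0, so the series
    effectively starts at \<open>j = 1\<close>.\<close>
  have ser: "(\<lambda>j. v ^ j / of_nat j) sums (- Ln (1 - v))" if "norm v < 1" for v :: complex
    using sums_minus[OF Ln_series'[of "- v"]] that by simp
  let ?P = "\<lambda>j. 3 * ((of_real w) ^ j / of_nat j) + 4 * ((of_real w * u) ^ j / of_nat j) + (of_real w * u\<^sup>2) ^ j / of_nat j"
  have "?P
     sums (?L)"
    unfolding log_zeta_term_def e0 e1 e2 if_P[OF True] using w u1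
    by (intro sums_add sums_mult ser) (auto simp: norm_mult norm_power)
  from sums_Re[OF this] have
    sR: "(\<lambda>j. Re (?P j))
     sums Re (?L)" .
  have "Re (?P j) \<ge> 0" for j
  proof -
    define v where "v = u ^ j"
    have "norm v = 1" by (simp add: v_def norm_power u1)
    then have v: "(Re v)\<^sup>2 + (Im v)\<^sup>2 = 1" using cmod_power2[of v] by simp
    have "?P j
       = of_real (w ^ j / real j) * (3 + 4 * v + v\<^sup>2)"
      by (simp add: v_def power_mult_distrib algebra_simps add_divide_distrib flip: power_mult)
    then have "Re (?P j)
      = w ^ j / real j * Re (3 + 4 * v + v\<^sup>2)"
      by simp
    also have "Re (3 + 4 * v + v\<^sup>2) = 2 * (1 + Re v)\<^sup>2"
      using v by (simp add: power2_eq_square algebra_simps)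
    also have "w ^ j / real j * (2 * (1 + Re v)\<^sup>2) \<ge> 0" using w by simp
    finally show ?thesis .
  qed
  from sums_le[OF this sums_zero sR] show ?thesis .
qed (simp add: log_zeta_term_def)

lemma zeta_341:
  assumes "\<sigma> > 1"
  shows "norm (zeta (of_real \<sigma>)) ^ 3 * norm (zeta (Complex \<sigma> t)) ^ 4 * norm (zeta (Complex \<sigma> (2 * t))) \<ge> 1"
proof -
  let ?L = "3 * log_zeta (of_real \<sigma>) + 4 * log_zeta (Complex \<sigma> t) + log_zeta (Complex \<sigma> (2 * t))"
  have "(\<lambda>n. Re (3 * log_zeta_term n (of_real \<sigma>) + 4 * log_zeta_term n (Complex \<sigma> t) + log_zeta_term n (Complex \<sigma> (2 * t))))
     sums Re ?L"
    using assms by (intro sums_Re sums_add sums_mult log_zeta_sums) auto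
  from sums_le[OF log_zeta_term_341[OF assms] sums_zero this]
  have "0 \<le> Re ?L" .
  then have "1 \<le> exp (3 * Re (log_zeta (of_real \<sigma>)) + 4 * Re (log_zeta (Complex \<sigma> t)) + Re (log_zeta (Complex \<sigma> (2 * t))))"
    by simp
  also have "\<dots> = norm (zeta (of_real \<sigma>)) ^ 3 * norm (zeta (Complex \<sigma> t)) ^ 4 * norm (zeta (Complex \<sigma> (2 * t)))"
    using assms by (simp add: norm_zeta_eq exp_add flip: exp_of_nat_mult)
  finally show ?thesis .
qed

subsection \<open>Growth and lower bound near the line Re s = 1\<close>

lemma zeta_holomorphic: "zeta holomorphic_on {s. Re s > 1/2} - {1}"
  unfolding zeta_def[abs_def]
  by (intro holomorphic_intros holomorphic_on_subset[OF zeta_rem_holomorphic]) auto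

lemma norm_higher_deriv_inverse_le:
  fixes s :: complex
  assumes r: "0 < r" "r \<le> 1" "norm (s - 1) \<ge> r" and j: "j \<le> 2"
  shows "norm ((deriv ^^ j) (\<lambda>s. 1 / (s - 1)) s) \<le> 2 * (2 / r) / (r / 2)\<^sup>2"
proof (rule norm_higher_deriv_le_2)
  have ge: "norm (w - 1) \<ge> r / 2" if "w \<in> cball s (r / 2)" for w
    using that r norm_triangle_ineq[of "w - 1" "s - w"] by (simp add: dist_norm)
  show "cball s (r / 2) \<subseteq> - {1}" using ge[of 1] r by auto
  show "norm (1 / (w - 1)) \<le> 2 / r" if "w \<in> cball s (r / 2)" for w
    using r ge[OF that] frac_le[of 1 1 "r / 2" "norm (w - 1)"] by (simp add: norm_divide)
qed (use r j in \<open>auto intro!: holomorphic_intros\<close>)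

lemma zeta_growth:
  assumes "\<epsilon> > 0" "r > 0"
  obtains C where "C > 0" "\<And>s j. Re s \<ge> 1 \<Longrightarrow> norm (s - 1) \<ge> r \<Longrightarrow> j \<le> 2 \<Longrightarrow> norm ((deriv ^^ j) zeta s) \<le> C * norm s powr \<epsilon>"
proof -
  obtain C where C: "C > 0" "\<And>s j. Re s \<ge> 1 \<Longrightarrow> j \<le> 2 \<Longrightarrow> norm ((deriv ^^ j) zeta_rem s) \<le> C * norm s powr \<epsilon>"
    using zeta_rem_growth[OF assms(1)] by metis
  \<comment> \<open>Cauchy's estimate in the form used needs a radius at most 1; points at distance
    at least \<open>r\<close> from 1 are also at distance at least \<open>q\<close>.\<close>
  define q where "q = min r 1"
  have q: "0 < q" "q \<le> 1" "q \<le> r" using assms by (auto simp: q_def)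
  define B where "B = 2 * (2 / q) / (q / 2)\<^sup>2"
  have "B \<ge> 0" using q by (simp add: B_def)
  show ?thesis
  proof (rule that[of "B + C"])
    show "B + C > 0" using C \<open>B \<ge> 0\<close> by simp
    fix s :: complex and j :: nat assume s: "Re s \<ge> 1" "norm (s - 1) \<ge> r" and j: "j \<le> 2"
    have n1: "norm s \<ge> 1" using s complex_Re_le_cmod[of s] by linarith
    have "s \<noteq> 1" using s assms by auto
    have op: "open ({s. Re s > 1/2} - {1})"
      by (intro open_Diff open_halfspace_Re_gt) auto
    have "(deriv ^^ j) zeta s = (deriv ^^ j) (\<lambda>s. 1 / (s - 1)) s + (deriv ^^ j) zeta_rem s"
      unfolding zeta_def[abs_def]
    proof (rule higher_deriv_add[OF _ _ op])
      show "(\<lambda>s. 1 / (s - 1)) holomorphic_on {s. Re s > 1/2} - {1}" by (intro holomorphic_intros) auto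
      show "zeta_rem holomorphic_on {s. Re s > 1/2} - {1}"
        by (rule holomorphic_on_subset[OF zeta_rem_holomorphic]) auto
    qed (use s \<open>s \<noteq> 1\<close> in auto)
    also have "norm \<dots> \<le> B + C * norm s powr \<epsilon>"
      using norm_higher_deriv_inverse_le[OF q(1,2) order.trans[OF q(3) s(2)] j] C(2)[OF s(1) j]
      by (intro order.trans[OF norm_triangle_ineq] add_mono) (auto simp: B_def)
    also have "\<dots> \<le> B * norm s powr \<epsilon> + C * norm s powr \<epsilon>"
      using n1 \<open>B \<ge> 0\<close> assms by (intro add_right_mono mult_le_cancel_left1[THEN iffD2]) (auto simp: ge_one_powr_ge_zero)
    finally show "norm ((deriv ^^ j) zeta s) \<le> (B + C) * norm s powr \<epsilon>" by (simp add: algebra_simps)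
  qed
qed

lemma zeta_real_bound:
  obtains A where "A \<ge> 1" "\<And>\<tau>. 1 < \<tau> \<Longrightarrow> \<tau> \<le> 2 \<Longrightarrow> norm (zeta (of_real \<tau>)) \<le> A / (\<tau> - 1)"
proof -
  obtain C where C: "C > 0" "\<And>s j. Re s \<ge> 1 \<Longrightarrow> j \<le> 2 \<Longrightarrow> norm ((deriv ^^ j) zeta_rem s) \<le> C * norm s powr 1"
    using zeta_rem_growth[of 1] by auto
  show ?thesis
  proof (rule that[of "1 + 2 * C"])
    fix \<tau> :: real assume \<tau>: "1 < \<tau>" "\<tau> \<le> 2"
    have "norm (zeta (of_real \<tau>)) \<le> norm (1 / (complex_of_real \<tau> - 1)) + norm (zeta_rem (of_real \<tau>))"
      unfolding zeta_def by (rule norm_triangle_ineq)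
    also have "norm (1 / (complex_of_real \<tau> - 1)) = 1 / (\<tau> - 1)"
    proof -
      have "complex_of_real \<tau> - 1 = of_real (\<tau> - 1)" by simp
      then show ?thesis using \<tau> by (simp only: norm_divide norm_of_real norm_one abs_of_pos)
    qed
    also have "norm (zeta_rem (of_real \<tau>)) \<le> C * \<tau>" using C(2)[of "of_real \<tau>" 0] \<tau> by simp
    also have "C * \<tau> \<le> C * 2" using C \<tau> by simp
    also have "1 / (\<tau> - 1) + C * 2 \<le> (1 + 2 * C) / (\<tau> - 1)"
      using mult_left_mono[of 1 "1 / (\<tau> - 1)" "C * 2"] \<tau> C by (simp add: add_divide_distrib mult.commute)
    finally show "norm (zeta (of_real \<tau>)) \<le> (1 + 2 * C) / (\<tau> - 1)" by simp
  qed (use C in auto)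
qed

text \<open>
  The lower bound from the 3-4-1 inequality at abscissa \<open>1 + y\<^sup>4\<close> is moved to the left with the
  bound for the derivative; \<open>y\<close> is chosen such that the loss is half of the bound.
\<close>

lemma zeta_lower_bound:
  assumes "\<epsilon> > 0" "r > 0"
  obtains c where "c > 0" "\<And>s. 1 < Re s \<Longrightarrow> Re s \<le> 2 \<Longrightarrow> \<bar>Im s\<bar> \<ge> r \<Longrightarrow> norm (zeta s) \<ge> c * norm s powr (- \<epsilon>)"
proof -
  \<comment> \<open>With \<open>m = norm s powr \<epsilon>'\<close> the final bound is of order
    \<open>y ^ 3 / m\<close>, where \<open>y\<close> is of order \<open>1 / m ^ 5\<close>; hence it
    is of order \<open>1 / m ^ 16\<close>.\<close>
  define \<epsilon>' where "\<epsilon>' = \<epsilon> / 16"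
  have \<epsilon>': "\<epsilon>' > 0" using assms by (simp add: \<epsilon>'_def)
  obtain C where C: "C > 0" "\<And>s j. Re s \<ge> 1 \<Longrightarrow> norm (s - 1) \<ge> r \<Longrightarrow> j \<le> 2 \<Longrightarrow> norm ((deriv ^^ j) zeta s) \<le> C * norm s powr (4 * \<epsilon>')"
    using zeta_growth[of "4 * \<epsilon>'" r] assms \<epsilon>' by (metis mult_pos_pos zero_less_numeral)
  obtain A where A: "A \<ge> 1" "\<And>\<tau>. 1 < \<tau> \<Longrightarrow> \<tau> \<le> 2 \<Longrightarrow> norm (zeta (of_real \<tau>)) \<le> A / (\<tau> - 1)"
    using zeta_real_bound by metis
  define K where "K = C * 4 powr (4 * \<epsilon>') + 1"
  have K: "K \<ge> 1" using C by (simp add: K_def)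
  \<comment> \<open>A fourth root of the constant from the 3-4-1 inequality. Together with the
    abscissa \<open>1 + y ^ 4\<close> it makes the lower bound for the fourth power of the zeta
    value a perfect fourth power.\<close>
  define a where "a = root 4 (A ^ 3 * K)"
  have "A ^ 3 * K \<ge> 1" using A K by (metis mult_mono' mult_1 one_le_power zero_le_one)
  then have a4: "a ^ 4 = A ^ 3 * K" and a1: "a \<ge> 1" by (auto simp: a_def)
  define c where "c = 1 / a"
  have c: "0 < c" "c \<le> 1" using a1 by (auto simp: c_def)
  show ?thesis
  proof (rule that[of "c ^ 4 / (16 * K ^ 3)"])
    show "c ^ 4 / (16 * K ^ 3) > 0" using c K by simp
    fix s assume s: "1 < Re s" "Re s \<le> 2" "\<bar>Im s\<bar> \<ge> r"
    have n1: "norm s \<ge> 1" using s complex_Re_le_cmod[of s] by linarith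
    then have "s \<noteq> 0" by auto
    define t where "t = Im s"
    have st: "s = Complex (Re s) t" by (simp add: t_def)
    define m where "m = norm s powr \<epsilon>'"
    have m1: "m \<ge> 1" using n1 \<epsilon>' by (simp add: m_def ge_one_powr_ge_zero)
    have m4: "norm s powr (4 * \<epsilon>') = m ^ 4"
      using \<open>s \<noteq> 0\<close> powr_realpow[of "norm s powr \<epsilon>'" 4] by (simp add: m_def powr_powr mult.commute)
    have bd: "norm ((deriv ^^ j) zeta w) \<le> K * m ^ 4" if "Re w \<ge> 1" "\<bar>Im w\<bar> \<ge> r" "norm w \<le> 4 * norm s" "j \<le> 2" for w j
    proof -
      have "norm (w - 1) \<ge> r" using that(2) abs_Im_le_cmod[of "w - 1"] by simp
      then have "norm ((deriv ^^ j) zeta w) \<le> C * norm w powr (4 * \<epsilon>')" using C(2) that by blast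
      also have "norm w powr (4 * \<epsilon>') \<le> (4 * norm s) powr (4 * \<epsilon>')" using that \<epsilon>' by (intro powr_mono2) auto
      also have "\<dots> = 4 powr (4 * \<epsilon>') * m ^ 4" by (simp add: powr_mult m4)
      also have "C * (4 powr (4 * \<epsilon>') * m ^ 4) \<le> K * m ^ 4" using C m1 by (simp add: K_def algebra_simps)
      finally show ?thesis using C by simp
    qed
    \<comment> \<open>The 3-4-1 inequality also involves the height \<open>2 * t\<close>; the factor
      4 covers this and a real part up to 2, as \<open>norm s \<ge> 1\<close>.\<close>
    have nC: "norm (Complex \<tau> (b * t)) \<le> 4 * norm s" if "1 \<le> \<tau>" "\<tau> \<le> 2" "1 \<le> b" "b \<le> 2" for \<tau> b
    proof -
      have "norm (Complex \<tau> (b * t)) \<le> \<bar>\<tau>\<bar> + \<bar>b * t\<bar>" using cmod_le[of "Complex \<tau> (b * t)"] by simp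
      also have "\<bar>b * t\<bar> \<le> 2 * \<bar>t\<bar>" using that by (simp add: abs_mult mult_right_mono)
      also have "\<bar>t\<bar> \<le> norm s" unfolding t_def by (rule abs_Im_le_cmod)
      finally show ?thesis using that n1 by simp
    qed
    have low: "norm (zeta (Complex \<tau> t)) ^ 4 \<ge> (\<tau> - 1) ^ 3 * c ^ 4 / m ^ 4" if \<tau>: "1 < \<tau>" "\<tau> \<le> 2" for \<tau>
    proof -
      have "1 \<le> norm (zeta (of_real \<tau>)) ^ 3 * norm (zeta (Complex \<tau> t)) ^ 4 * norm (zeta (Complex \<tau> (2 * t)))"
        using zeta_341[OF \<tau>(1), of t] by simp
      also have "norm (zeta (Complex \<tau> (2 * t))) \<le> K * m ^ 4"
        using bd[of "Complex \<tau> (2 * t)" 0] \<tau> s nC[of \<tau> 2] by (simp add: t_def)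
      also have "norm (zeta (of_real \<tau>)) ^ 3 \<le> (A / (\<tau> - 1)) ^ 3"
        using A(2)[OF \<tau>] by (intro power_mono) auto
      finally have "1 \<le> (A / (\<tau> - 1)) ^ 3 * norm (zeta (Complex \<tau> t)) ^ 4 * (K * m ^ 4)"
        using K m1 A \<tau> by (auto simp: mult_left_mono mult_right_mono)
      also have "\<dots> = norm (zeta (Complex \<tau> t)) ^ 4 * (a ^ 4 * m ^ 4 / (\<tau> - 1) ^ 3)"
        by (simp add: a4 power_divide)
      finally show ?thesis using \<tau> a1 m1 by (simp add: c_def field_simps)
    qed
    define y where "y = c / (2 * K * m ^ 5)"
    have "1 * 1 \<le> K * m ^ 5" using K m1 by (intro mult_mono) auto
    then have y: "0 < y" "y \<le> 1" using c K m1 by (auto simp: y_def field_simps)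
    have low': "norm (zeta (Complex \<tau> t)) \<ge> y ^ 3 * c / m" if \<tau>: "1 + y ^ 4 \<le> \<tau>" "\<tau> \<le> 2" for \<tau>
    proof -
      have "(y ^ 3 * c / m) ^ 4 = (y ^ 4) ^ 3 * c ^ 4 / m ^ 4"
        by (simp add: power_divide power_mult_distrib flip: power_mult)
      also have "\<dots> \<le> (\<tau> - 1) ^ 3 * c ^ 4 / m ^ 4"
        using \<tau> y m1 c by (intro divide_right_mono mult_right_mono power_mono) auto
      also have "\<dots> \<le> norm (zeta (Complex \<tau> t)) ^ 4"
        using \<tau> zero_less_power[OF y(1), of 4] by (intro low) linarith+
      finally have "(y ^ 3 * c / m) ^ Suc 3 \<le> norm (zeta (Complex \<tau> t)) ^ Suc 3" by simp
      then show ?thesis by (rule power_le_imp_le_base) simp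
    qed
    have "norm (zeta s) \<ge> y ^ 3 * c / (2 * m)"
    proof (cases "Re s \<ge> 1 + y ^ 4")
      case True
      have "y ^ 3 * c / (2 * m) \<le> y ^ 3 * c / m" using y c m1 by (intro divide_left_mono) auto
      with low'[OF True s(2)] show ?thesis by (simp add: t_def)
    next
      case False
      define s' where "s' = Complex (1 + y ^ 4) t"
      have y4: "0 < y ^ 4" "y ^ 4 \<le> 1" using y by (auto intro: power_le_one)
      define V where "V = {w. Re w \<ge> 1} \<inter> {w. Re w \<le> 2} \<inter> ({w. Im w \<ge> t} \<inter> {w. Im w \<le> t})"
      have "norm (zeta s' - zeta s) \<le> (K * m ^ 4) * norm (s' - s)"
      proof (rule field_differentiable_bound[where f' = "deriv zeta" and S = V])
        fix w assume w: "w \<in> V"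
        then have wC: "w = Complex (Re w) (1 * t)" by (auto simp: V_def complex_eq_iff)
        show "norm (deriv zeta w) \<le> K * m ^ 4"
          using bd[of w 1] w s nC[of "Re w" 1] wC by (auto simp: V_def t_def)
        have "w \<noteq> 1" using w s assms by (auto simp: V_def t_def)
        then have "zeta field_differentiable at w"
          using w by (intro holomorphic_on_imp_differentiable_at[OF zeta_holomorphic] open_Diff open_halfspace_Re_gt) (auto simp: V_def)
        then show "(zeta has_field_derivative deriv zeta w) (at w within V)"
          by (rule has_field_derivative_at_within[OF field_differentiable_derivI])
      qed (use s y4 in \<open>auto simp: V_def s'_def t_def intro!: convex_Int convex_halfspace_Re_ge convex_halfspace_Re_le convex_halfspace_Im_ge convex_halfspace_Im_le\<close>)
      also have "s' - s = of_real (1 + y ^ 4 - Re s)" by (simp add: s'_def t_def complex_eq_iff)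
      also have "norm (of_real (1 + y ^ 4 - Re s) :: complex) \<le> y ^ 4"
        unfolding norm_of_real using False s by simp
      finally have d: "norm (zeta s' - zeta s) \<le> (K * m ^ 4) * y ^ 4" using K m1 by simp
      define P where "P = y ^ 3 * c / (2 * m)"
      have "(K * m ^ 4) * y ^ 4 = P"
        using K m1 by (simp add: P_def y_def field_simps eval_nat_numeral)
      moreover have "norm (zeta s') \<ge> y ^ 3 * c / m" unfolding s'_def using y4 by (intro low') auto
      moreover have "y ^ 3 * c / m = 2 * P" by (simp add: P_def)
      ultimately have "norm (zeta s) \<ge> P"
        using d norm_triangle_ineq2[of "zeta s'" "zeta s"] by linarith
      then show ?thesis by (simp add: P_def)
    qed
    also have "y ^ 3 * c / (2 * m) = c ^ 4 / (16 * K ^ 3) / m ^ 16"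
      using K m1 by (simp add: y_def field_simps eval_nat_numeral)
    also have "1 / m ^ 16 = norm s powr (- \<epsilon>)"
      using \<open>s \<noteq> 0\<close> powr_realpow[of "norm s powr \<epsilon>'" 16] by (simp add: m_def powr_powr \<epsilon>'_def powr_minus inverse_eq_divide)
    then have "c ^ 4 / (16 * K ^ 3) / m ^ 16 = c ^ 4 / (16 * K ^ 3) * norm s powr (- \<epsilon>)"
      by (metis times_divide_eq_right mult.right_neutral)
    finally show "c ^ 4 / (16 * K ^ 3) * norm s powr (- \<epsilon>) \<le> norm (zeta s)" .
  qed
qed

subsection \<open>The convergent Euler factor\<close>

text \<open>With \<open>w\<close> for \<open>p powr (-s)\<close>, the second factor is the sum of
  \<open>D_omega k (p ^ a) * w ^ a\<close> over \<open>a\<close>, and the first one divides out the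
  factor at \<open>p\<close> of the power \<open>2 / k\<close> of \<open>zeta\<close>. Using one
  function of \<open>w\<close> for all primes allows a single estimate.\<close>

definition euler_local :: "nat \<Rightarrow> complex \<Rightarrow> complex" where
  "euler_local k w = exp (2 / of_nat k * Ln (1 - w)) * (1 + (1 / (1 - w)\<^sup>2 - 1) / of_nat k)"

definition euler_factor :: "nat \<Rightarrow> nat \<Rightarrow> complex \<Rightarrow> complex" where
  "euler_factor k n s = (if prime n then euler_local k (of_nat n powr (-s)) else 1)"

definition euler_limit :: "nat \<Rightarrow> complex \<Rightarrow> complex" where
  "euler_limit k s = lim (\<lambda>N. \<Prod>n<N. euler_factor k n s)"

lemma euler_local_holomorphic: "euler_local k holomorphic_on ball 0 1"
proof -
  have *: "1 - w \<notin> \<real>\<^sub>\<le>\<^sub>0" if "w \<in> ball 0 1" for w :: complex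
    using that complex_Re_le_cmod[of w] by (auto simp: complex_nonpos_Reals_iff)
  then have "1 - w \<noteq> 0" if "w \<in> ball 0 1" for w :: complex
    using that by force
  with * show ?thesis unfolding euler_local_def[abs_def] by (intro holomorphic_intros) auto
qed

lemma euler_local_0 [simp]: "euler_local k 0 = 1"
  by (simp add: euler_local_def)

text \<open>The reason for the exponent \<open>2 / k\<close>: the linear coefficient
  \<open>- (2 / k)\<close> of the power cancels \<open>D_omega k p = 2 / k\<close>. Hence each
  factor differs from 1 by \<open>O(w^2)\<close>, and the product converges to the left of
  \<open>Re s = 1\<close>.\<close>

lemma deriv_euler_local_0: "deriv (euler_local k) 0 = 0"
proof (cases "k = 0")
  \<comment> \<open>Division by 0 makes the function constantly 1.\<close>
  case True
  then show ?thesis by (simp add: euler_local_def[abs_def])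
next
  case False
  have "(euler_local k has_field_derivative (exp (2 / of_nat k * Ln (1 - 0)) * (2 / of_nat k * (- 1 / (1 - 0)))) * (1 + (1 / (1 - 0)\<^sup>2 - 1) / of_nat k)
     + exp (2 / of_nat k * Ln (1 - 0)) * (2 / of_nat k)) (at 0)"
    unfolding euler_local_def[abs_def]
    using False by (auto intro!: derivative_eq_intros simp: power2_eq_square)
  from DERIV_imp_deriv[OF this] show ?thesis by simp
qed

text \<open>Taylor's formula at 0, with the second derivative bounded by compactness of the disc.
  The radius is a convenient number between \<open>2 powr (-(3/4))\<close>, the largest
  \<open>norm w\<close> needed later, and 1.\<close>

lemma euler_local_bound:
  obtains B where "B \<ge> 0" "\<And>w. norm w \<le> 3/5 \<Longrightarrow> norm (euler_local k w - 1) \<le> B * norm w ^ 2"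
proof -
  define S where "S = cball (0::complex) (3/5)"
  have sub: "S \<subseteq> ball 0 1" by (auto simp: S_def)
  have hol2: "(deriv ^^ 2) (euler_local k) holomorphic_on ball 0 1"
    by (intro holomorphic_higher_deriv euler_local_holomorphic) auto
  have "compact ((deriv ^^ 2) (euler_local k) ` S)"
    by (intro compact_continuous_image holomorphic_on_imp_continuous_on holomorphic_on_subset[OF hol2 sub]) (simp add: S_def)
  then obtain B where B: "\<And>w. w \<in> S \<Longrightarrow> norm ((deriv ^^ 2) (euler_local k) w) \<le> B"
    by (meson compact_imp_bounded bounded_iff imageI)
  have B0: "B \<ge> 0" using B[of 0] by (auto simp: S_def intro: order.trans[rotated])
  have "norm (euler_local k w - 1) \<le> B * norm w ^ 2" if w: "norm w \<le> 3/5" for w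
  proof -
    have "norm ((deriv ^^ 0) (euler_local k) w - (\<Sum>i\<le>1. (deriv ^^ i) (euler_local k) 0 * (w - 0) ^ i / fact i)) \<le> B * norm (w - 0) ^ Suc 1 / fact 1"
    proof (rule complex_Taylor[where S = S])
      fix i x assume "x \<in> S" "i \<le> (1::nat)"
      then have "(deriv ^^ i) (euler_local k) field_differentiable at x"
        using sub by (intro holomorphic_on_imp_differentiable_at[where s = "ball 0 1"] holomorphic_higher_deriv euler_local_holomorphic) auto
      then show "((deriv ^^ i) (euler_local k) has_field_derivative (deriv ^^ Suc i) (euler_local k) x) (at x within S)"
        by (simp add: DERIV_deriv_iff_field_differentiable has_field_derivative_at_within)
    qed (use B w in \<open>auto simp: S_def numeral_2_eq_2\<close>)
    then show ?thesis by (simp add: deriv_euler_local_0 power2_eq_square)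
  qed
  with B0 show ?thesis using that by blast
qed

lemma norm_prime_powr_le:
  assumes "prime n" "Re s \<ge> 3/4"
  shows "norm (of_nat n powr (-s)) \<le> 3/5" "norm (of_nat n powr (-s)) \<le> real n powr (-(3/4))"
proof -
  have n: "n \<ge> 2" using assms by (simp add: prime_ge_2_nat)
  have "norm (of_nat n powr (-s)) = real n powr (- Re s)" using n norm_powr_real_powr[of "of_nat n" "-s"] by simp
  also have "\<dots> \<le> real n powr (-(3/4))" using n assms by (intro powr_mono) auto
  finally show *: "norm (of_nat n powr (-s)) \<le> real n powr (-(3/4))" .
  also have "\<dots> \<le> 2 powr (-(3/4))" using n by (intro powr_mono2') auto
  also have "\<dots> \<le> 3/5"
  \<comment> \<open>Compared through fourth powers: \<open>1/8\<close> against
    \<open>81/625\<close>.\<close>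
  proof (rule power_le_imp_le_base[of _ 3])
    have "(2 powr (-(3/4)) :: real) ^ 4 = 2 powr (-3)" by (simp add: powr_power)
    also have "\<dots> = 1/8" by (simp add: powr_minus)
    finally have "(2 powr (-(3/4)) :: real) ^ 4 = 1/8" .
    then show "(2 powr (-(3/4)) :: real) ^ Suc 3 \<le> (3/5) ^ Suc 3" by (simp add: power_divide)
  qed auto
  finally show "norm (of_nat n powr (-s)) \<le> 3/5" .
qed

lemma euler_factor_bound:
  obtains B where "B \<ge> 0" "\<And>s n. Re s \<ge> 3/4 \<Longrightarrow> norm (euler_factor k n s - 1) \<le> B * real n powr (-(3/2))"
proof -
  obtain B where B: "B \<ge> 0" "\<And>w. norm w \<le> 3/5 \<Longrightarrow> norm (euler_local k w - 1) \<le> B * norm w ^ 2"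
    using euler_local_bound by metis
  have "norm (euler_factor k n s - 1) \<le> B * real n powr (-(3/2))" if s: "Re s \<ge> 3/4" for s n
  proof (cases "prime n")
    case True
    note le = norm_prime_powr_le[OF True s]
    have "norm (euler_factor k n s - 1) \<le> B * norm (of_nat n powr (-s)) ^ 2"
      using True B(2)[OF le(1)] by (simp add: euler_factor_def)
    also have "\<dots> \<le> B * (real n powr (-(3/4))) ^ 2"
      using le(2) B(1) by (intro mult_left_mono power_mono) auto
    also have "(real n powr (-(3/4))) ^ 2 = real n powr (-(3/2))"
      using True by (simp add: powr_power prime_gt_0_nat)
    finally show ?thesis .
  qed (use B in \<open>auto simp: euler_factor_def\<close>)
  with B(1) show ?thesis using that by blast
qed

lemma euler_factor_holomorphic: "euler_factor k n holomorphic_on {s. Re s > 3/4}"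
proof (cases "prime n")
  case True
  have "(\<lambda>s. euler_local k (of_nat n powr (-s))) holomorphic_on {s. Re s > 3/4}"
  proof (rule holomorphic_on_compose_gen[OF _ euler_local_holomorphic, unfolded o_def])
    show "(\<lambda>s. of_nat n powr (-s)) holomorphic_on {s. Re s > 3/4}"
      using True by (intro holomorphic_intros) (auto simp: prime_gt_0_nat)
    show "(\<lambda>s. of_nat n powr (-s)) ` {s. Re s > 3/4} \<subseteq> ball 0 1"
    proof (rule image_subsetI)
      fix s assume "s \<in> {s. Re s > 3/4}"
      then show "of_nat n powr (-s) \<in> ball 0 1" using norm_prime_powr_le(1)[OF True, of s] by simp
    qed
  qed
  then show ?thesis using True by (simp add: euler_factor_def[abs_def])
qed (simp add: euler_factor_def[abs_def])

lemma euler_factor_uniform_limit: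
  assumes "cball s d \<subseteq> {s. Re s > 3/4}"
  shows "uniform_limit (cball s d) (\<lambda>N s. \<Prod>n<N. euler_factor k n s) (euler_limit k) sequentially"
proof -
  obtain B where B: "B \<ge> 0" "\<And>s n. Re s \<ge> 3/4 \<Longrightarrow> norm (euler_factor k n s - 1) \<le> B * real n powr (-(3/2))"
    using euler_factor_bound[of k] by metis
  have "uniformly_convergent_on (cball s d) (\<lambda>N s. \<Sum>n<N. norm (euler_factor k n s - 1))"
  proof (rule Weierstrass_m_test')
    show "summable (\<lambda>n. B * real n powr (-(3/2)))"
      by (intro summable_mult) (simp add: summable_real_powr_iff)
    show "norm (norm (euler_factor k n u - 1)) \<le> B * real n powr (-(3/2))" if "u \<in> cball s d" for n u
      using B(2)[of u n] that assms by auto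
  qed
  then have "uniformly_convergent_on (cball s d) (\<lambda>N s. \<Prod>n<N. euler_factor k n s)"
    by (intro uniformly_convergent_on_prod' holomorphic_on_imp_continuous_on holomorphic_on_subset[OF euler_factor_holomorphic assms]) auto
  then show ?thesis
    by (simp add: uniformly_convergent_uniform_limit_iff euler_limit_def[abs_def])
qed

lemma euler_limit_holomorphic: "euler_limit k holomorphic_on {s. Re s > 3/4}"
proof (rule holomorphic_uniform_sequence)
  show "open {s. Re s > 3/4}" by (rule open_halfspace_Re_gt)
  show "(\<lambda>s. \<Prod>n<N. euler_factor k n s) holomorphic_on {s. Re s > 3/4}" for N
    by (intro holomorphic_intros euler_factor_holomorphic)
  fix s assume "s \<in> {s. Re s > 3/4}"
  then obtain d where d: "d > 0" "cball s d \<subseteq> {s. Re s > 3/4}"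
    using open_contains_cball open_halfspace_Re_gt by metis
  with euler_factor_uniform_limit[OF d(2)]
  show "\<exists>d>0. cball s d \<subseteq> {s. Re s > 3/4} \<and> uniform_limit (cball s d) (\<lambda>N s. \<Prod>n<N. euler_factor k n s) (euler_limit k) sequentially"
    by blast
qed

lemma euler_limit_tendsto:
  assumes "Re s > 3/4"
  shows "(\<lambda>N. \<Prod>n<N. euler_factor k n s) \<longlonglongrightarrow> euler_limit k s"
proof -
  have "cball s 0 \<subseteq> {s. Re s > 3/4}" using assms by auto
  from tendsto_uniform_limitI[OF euler_factor_uniform_limit[OF this]] show ?thesis by simp
qed

text \<open>By \<open>1 + x \<le> exp x\<close> all partial products are bounded by the exponential
  of one convergent sum that does not depend on \<open>s\<close>.\<close>

lemma euler_limit_bounded: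
  obtains B where "B > 0" "\<And>s. Re s > 3/4 \<Longrightarrow> norm (euler_limit k s) \<le> B"
proof -
  obtain B where B: "B \<ge> 0" "\<And>s n. Re s \<ge> 3/4 \<Longrightarrow> norm (euler_factor k n s - 1) \<le> B * real n powr (-(3/2))"
    using euler_factor_bound[of k] by metis
  have sm: "summable (\<lambda>n. B * real n powr (-(3/2)))"
    by (intro summable_mult) (simp add: summable_real_powr_iff)
  show ?thesis
  proof (rule that[of "exp (\<Sum>n. B * real n powr (-(3/2)))"])
    fix s :: complex assume s: "Re s > 3/4"
    show "norm (euler_limit k s) \<le> exp (\<Sum>n. B * real n powr (-(3/2)))"
    proof (rule LIMSEQ_le_const2[OF tendsto_norm[OF euler_limit_tendsto[OF s]]], intro exI allI impI)
      fix N :: nat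
      have "norm (\<Prod>n<N. euler_factor k n s) = (\<Prod>n<N. norm (euler_factor k n s))" by (simp add: prod_norm)
      also have "\<dots> \<le> (\<Prod>n<N. exp (B * real n powr (-(3/2))))"
      proof (intro prod_mono conjI)
        fix n
        have "norm (euler_factor k n s) \<le> 1 + norm (euler_factor k n s - 1)"
          using norm_triangle_ineq[of 1 "euler_factor k n s - 1"] by simp
        also have "\<dots> \<le> 1 + B * real n powr (-(3/2))" using B(2)[of s n] s by simp
        also have "\<dots> \<le> exp (B * real n powr (-(3/2)))" by (rule exp_ge_add_one_self)
        finally show "norm (euler_factor k n s) \<le> exp (B * real n powr (-(3/2)))" .
      qed auto
      also have "\<dots> = exp (\<Sum>n<N. B * real n powr (-(3/2)))" by (simp add: exp_sum)
      also have "\<dots> \<le> exp (\<Sum>n. B * real n powr (-(3/2)))"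
        using B by (subst exp_le_cancel_iff) (intro sum_le_suminf sm, auto)
      finally show "norm (\<Prod>n<N. euler_factor k n s) \<le> exp (\<Sum>n. B * real n powr (-(3/2)))" .
    qed
  qed auto
qed

text \<open>The room between \<open>3/4\<close> and 1 is used here: discs of radius
  \<open>1/8\<close> around points with \<open>Re s \<ge> 1\<close> stay in the half-plane where
  \<open>euler_limit\<close> is bounded.\<close>

lemma euler_limit_deriv_bounded:
  obtains B where "B > 0" "\<And>s j. Re s \<ge> 1 \<Longrightarrow> j \<le> 2 \<Longrightarrow> norm ((deriv ^^ j) (euler_limit k) s) \<le> B"
proof -
  obtain B where B: "B > 0" "\<And>s. Re s > 3/4 \<Longrightarrow> norm (euler_limit k s) \<le> B"
    using euler_limit_bounded[of k] by metis
  show ?thesis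
  proof (rule that[of "2 * B / (1/8) ^ 2"])
    fix s :: complex and j :: nat assume s: "Re s \<ge> 1" and j: "j \<le> 2"
    have ge: "Re w > 3/4" if "w \<in> cball s (1/8)" for w
      using that s complex_Re_le_cmod[of "s - w"] by (simp add: dist_norm)
    have sub: "cball s (1/8) \<subseteq> {s. Re s > 3/4}" using ge by auto
    show "norm ((deriv ^^ j) (euler_limit k) s) \<le> 2 * B / (1/8)\<^sup>2"
      by (rule norm_higher_deriv_le_2[OF euler_limit_holomorphic sub _ _ j]) (use B(2) ge in auto)
  qed (use B in auto)
qed

lemma euler_limit_1:
  assumes "k \<ge> 2"
  shows "euler_limit k 1 = of_real (euler_product k)"
proof -
  have eq: "euler_factor k n 1 = of_real (if prime n then local_factor k n else 1)" for n
  proof (cases "prime n")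
    case True
    then have n: "n \<ge> 2" by (simp add: prime_ge_2_nat)
    define q where "q = 1 - 1 / real n"
    have q: "q > 0" using n by (simp add: q_def)
    have w: "complex_of_nat n powr (-1) = of_real (1 / real n)"
      using n by (simp add: powr_minus_divide)
    have "1 - complex_of_nat n powr (-1) = of_real q" unfolding w by (simp add: q_def)
    then have "euler_factor k n 1 = exp (2 / of_nat k * Ln (of_real q)) * (1 + (1 / (of_real q)\<^sup>2 - 1) / of_nat k)"
      using True by (simp add: euler_factor_def euler_local_def)
    also have "\<dots> = of_real (exp (2 / real k * ln q) * (1 + (1 / q\<^sup>2 - 1) / real k))"
      using q by (simp add: Ln_of_real exp_of_real[symmetric])
    also have "exp (2 / real k * ln q) = q powr (2 / real k)" using q by (simp add: powr_def)
    also have "1 / q\<^sup>2 - 1 = (2 * real n - 1) / (real n - 1)\<^sup>2"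
    proof -
      have "q = (real n - 1) / real n" using n by (simp add: q_def field_simps)
      then have "1 / q\<^sup>2 - 1 = (real n)\<^sup>2 / (real n - 1)\<^sup>2 - (real n - 1)\<^sup>2 / (real n - 1)\<^sup>2"
        using n by (simp add: power_divide)
      also have "\<dots> = ((real n)\<^sup>2 - (real n - 1)\<^sup>2) / (real n - 1)\<^sup>2"
        by (rule diff_divide_distrib[symmetric])
      also have "(real n)\<^sup>2 - (real n - 1)\<^sup>2 = 2 * real n - 1"
        by (simp add: power2_eq_square algebra_simps)
      finally show ?thesis .
    qed
    also have "q powr (2 / real k) * (1 + (2 * real n - 1) / (real n - 1)\<^sup>2 / real k) = local_factor k n"
      by (simp add: local_factor_def q_def mult.commute)
    finally show ?thesis using True by simp
  qed (simp add: euler_factor_def)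
  \<comment> \<open>Convergence identifies the value of \<open>prodinf\<close> with the limit of its
    partial products; these run over \<open>n \<le> N\<close>, hence the shift of the index
    afterwards.\<close>
  have "convergent_prod (\<lambda>p. if prime p then local_factor k p else 1)"
    using abs_convergent_local_factors[OF assms] by (rule abs_convergent_prod_imp_convergent_prod)
  then have "(\<lambda>N. \<Prod>n\<le>N. if prime n then local_factor k n else 1) \<longlonglongrightarrow> euler_product k"
    unfolding euler_product_def by (rule convergent_prod_LIMSEQ)
  then have "(\<lambda>N. complex_of_real (\<Prod>n<Suc N. if prime n then local_factor k n else 1)) \<longlonglongrightarrow> of_real (euler_product k)"
    unfolding lessThan_Suc_atMost by (rule tendsto_of_real)
  then have "(\<lambda>N. complex_of_real (\<Prod>n<N. if prime n then local_factor k n else 1)) \<longlonglongrightarrow> of_real (euler_product k)"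
    by (rule LIMSEQ_imp_Suc)
  then have "(\<lambda>N. \<Prod>n<N. euler_factor k n 1) \<longlonglongrightarrow> of_real (euler_product k)"
    by (simp only: eq of_real_prod)
  moreover have "(\<lambda>N. \<Prod>n<N. euler_factor k n 1) \<longlonglongrightarrow> euler_limit k 1"
    by (rule euler_limit_tendsto) simp
  ultimately show ?thesis using LIMSEQ_unique by blast
qed

subsection \<open>The Dirichlet series of D_omega\<close>

lemma divisor_count_mult:
  assumes "coprime m n" "m > 0" "n > 0"
  shows "divisor_count (m * n) = divisor_count m * divisor_count n"
proof -
  have "bij_betw (\<lambda>(a, b). a * b) ({d. d dvd m} \<times> {d. d dvd n}) {d. d dvd m * n}"
    unfolding bij_betw_def
  proof
    show "inj_on (\<lambda>(a, b). a * b) ({d. d dvd m} \<times> {d. d dvd n})"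
    proof (rule inj_onI, clarsimp)
      fix a b a' b' assume *: "a dvd m" "b dvd n" "a' dvd m" "b' dvd n" "a * b = a' * b'"
      have g: "gcd m (x * y) = x" if "x dvd m" "y dvd n" for x y
      proof -
        have "coprime m y" using assms(1) that(2) by (meson coprime_divisors dvd_refl)
        then have "gcd m (x * y) = gcd m x" by (rule gcd_mult_right_right_cancel)
        also have "\<dots> = x" using that(1) by (simp add: gcd_nat.absorb2)
        finally show ?thesis .
      qed
      have "a = a'" using g[of a b] g[of a' b'] * by metis
      moreover have "a \<noteq> 0" using * assms by auto
      ultimately show "a = a' \<and> b = b'" using * by auto
    qed
    show "(\<lambda>(a, b). a * b) ` ({d. d dvd m} \<times> {d. d dvd n}) = {d. d dvd m * n}"
      using division_decomp[of _ m n] by (auto simp: mult_dvd_mono image_iff)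
  qed
  from bij_betw_same_card[OF this] show ?thesis
    by (simp add: divisor_count_def card_cartesian_product)
qed

lemma omega_mult:
  assumes "coprime m n" "m > 0" "n > 0"
  shows "omega (m * n) = omega m + omega n"
proof -
  have "{p. prime p \<and> p dvd m * n} = {p. prime p \<and> p dvd m} \<union> {p. prime p \<and> p dvd n}"
    by (auto simp: prime_dvd_mult_iff)
  moreover have "finite {p. prime p \<and> p dvd j}" if "j > 0" for j :: nat
    using that by (intro finite_subset[OF _ finite_divisors_nat[of j]]) auto
  moreover have "{p. prime p \<and> p dvd m} \<inter> {p. prime p \<and> p dvd n} = {}"
    using assms(1) by (auto simp: disjoint_iff) (metis coprime_common_divisor not_prime_unit)
  ultimately show ?thesis using assms unfolding omega_def by (simp add: card_Un_disjoint)
qed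

text \<open>All numbers divide 0, and the cardinality of an infinite set is 0. With this value the
  sums over all \<open>n\<close> start at 1 in effect, and multiplicativity extends to 0.\<close>

lemma D_omega_0 [simp]: "D_omega k 0 = 0"
  by (simp add: D_omega_def divisor_count_def)

lemma omega_1 [simp]: "omega (Suc 0) = 0"
proof -
  have "{p. prime p \<and> p dvd (1::nat)} = {}" using not_prime_unit by blast
  then show ?thesis by (simp add: omega_def)
qed

lemma D_omega_1 [simp]: "D_omega k (Suc 0) = 1"
  by (simp add: D_omega_def divisor_count_def)

lemma D_omega_mult:
  assumes "coprime m n"
  shows "D_omega k (m * n) = D_omega k m * D_omega k n"
proof (cases "m = 0 \<or> n = 0")
  case False
  then show ?thesis using assms
    by (simp add: D_omega_def divisor_count_mult omega_mult power_add)
qed auto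

lemma D_omega_prime_power:
  assumes "prime p" "a > 0"
  shows "D_omega k (p ^ a) = real (Suc a) / real k"
proof -
  have "{d. d dvd p ^ a} = (\<lambda>i. p ^ i) ` {..a}"
    using divides_primepow_nat[OF assms(1)] by auto
  moreover have "inj_on (\<lambda>i. p ^ i) {..a}" using assms prime_gt_1_nat[OF assms(1)] by (intro inj_onI) simp
  ultimately have "divisor_count (p ^ a) = Suc a" by (simp add: divisor_count_def card_image)
  moreover have "{q. prime q \<and> q dvd p ^ a} = {p}"
    using assms prime_dvd_power[of _ p a] primes_dvd_imp_eq[of _ p] dvd_power[of a p] by blast
  then have "omega (p ^ a) = 1" by (simp add: omega_def)
  ultimately show ?thesis by (simp add: D_omega_def)
qed

lemma D_omega_nonneg: "D_omega k n \<ge> 0"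
  by (simp add: D_omega_def)

lemma D_omega_le_divisor_count:
  assumes "k > 0"
  shows "D_omega k n \<le> real (divisor_count n)"
proof -
  have "real k ^ omega n \<ge> 1" using assms by (intro one_le_power) simp
  then show ?thesis unfolding D_omega_def by (simp add: divide_le_eq mult_le_cancel_left1)
qed

text \<open>Sending \<open>(n, d)\<close> with \<open>d dvd n\<close> to \<open>(d, n div d)\<close>
  embeds the partial sums into a product of two partial sums of \<open>n powr (- c)\<close>.\<close>

lemma summable_divisor_count:
  assumes c: "c > 1"
  shows "summable (\<lambda>n. real (divisor_count n) * real n powr (- c))"
proof (rule bounded_imp_summable)
  define S where "S = (\<Sum>n. real n powr (- c))"
  have S: "(\<Sum>n<N. real n powr (- c)) \<le> S" for N
    unfolding S_def using c by (intro sum_le_suminf) (auto simp: summable_real_powr_iff)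
  fix N :: nat
  define A where "A = (SIGMA n:{1..<Suc N}. {d. d dvd n})"
  define g where "g = (\<lambda>(n, d::nat). (d, n div d))"
  have inj: "inj_on g A"
    by (rule inj_onI) (auto simp: A_def g_def elim!: dvdE)
  have img: "g ` A \<subseteq> {..<Suc N} \<times> {..<Suc N}"
    by (auto simp: A_def g_def less_Suc_eq_le dest!: dvd_imp_le intro: order.trans[OF div_le_dividend])
  have "(\<Sum>n\<le>N. real (divisor_count n) * real n powr (- c)) = (\<Sum>n\<in>{1..<Suc N}. real (divisor_count n) * real n powr (- c))"
    by (rule sum.mono_neutral_right) (auto simp: divisor_count_def)
  also have "\<dots> = (\<Sum>n\<in>{1..<Suc N}. \<Sum>d | d dvd n. real n powr (- c))"
    by (simp add: divisor_count_def)
  also have "\<dots> = (\<Sum>(n, d)\<in>A. real n powr (- c))"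
    unfolding A_def by (rule sum.Sigma) auto
  also have "\<dots> = (\<Sum>x\<in>A. (\<lambda>(a, b). real a powr (- c) * real b powr (- c)) (g x))"
  proof (rule sum.cong)
    fix x assume "x \<in> A"
    then obtain d e where "x = (d * e, d)" "d * e > 0" by (auto simp: A_def elim!: dvdE)
    then show "(case x of (n, d) \<Rightarrow> real n powr (- c)) = (\<lambda>(a, b). real a powr (- c) * real b powr (- c)) (g x)"
      by (simp add: g_def powr_mult)
  qed simp
  also have "\<dots> = (\<Sum>(a, b)\<in>g ` A. real a powr (- c) * real b powr (- c))"
    by (subst sum.reindex[OF inj]) simp
  also have "\<dots> \<le> (\<Sum>(a, b)\<in>{..<Suc N} \<times> {..<Suc N}. real a powr (- c) * real b powr (- c))"
    by (rule sum_mono2[OF _ img]) auto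
  also have "\<dots> = (\<Sum>a<Suc N. real a powr (- c)) * (\<Sum>b<Suc N. real b powr (- c))"
    by (simp add: sum_product sum.cartesian_product del: sum.lessThan_Suc)
  also have "\<dots> \<le> S * S" using S[of "Suc N"] S[of 0] by (intro mult_mono sum_nonneg) auto
  finally show "(\<Sum>n\<le>N. real (divisor_count n) * real n powr (- c)) \<le> S * S" .
qed auto

definition D_series :: "nat \<Rightarrow> complex \<Rightarrow> complex" where
  "D_series k s = (\<Sum>n. of_real (D_omega k n) * of_nat n powr (-s))"

lemma summable_D_omega:
  assumes "k > 0" "c > 1"
  shows "summable (\<lambda>n. D_omega k n * real n powr (- c))"
  by (rule summable_comparison_test'[OF summable_divisor_count[OF assms(2)]])
     (auto simp: D_omega_nonneg intro!: mult_right_mono D_omega_le_divisor_count assms)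

lemma norm_D_term_le: "norm (of_real (D_omega k n) * of_nat n powr (-s)) \<le> D_omega k n * real n powr (- Re s)"
  by (cases "n = 0") (auto simp: norm_mult norm_nat_powr D_omega_nonneg)

text \<open>The identity holds factor by factor for the finite products over \<open>p < N\<close>,
  and both sides are the limits of these.\<close>

lemma D_series_eq:
  assumes k: "k > 0" and s: "Re s > 1"
  shows "D_series k s = euler_limit k s * exp (2 / of_nat k * log_zeta s)"
proof -
  define h where "h = (\<lambda>n. of_real (D_omega k n) * complex_of_nat n powr (-s))"
  let ?Q = "\<lambda>N. (\<Prod>n<N. euler_factor k n s) * exp (2 / of_nat k * (\<Sum>n<N. log_zeta_term n s))"
  have "(\<lambda>N. \<Prod>p<N. if prime p then (\<Sum>a. h (p ^ a)) else 1) \<longlonglongrightarrow> (\<Sum>n. h n)"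
  proof (rule euler_product_tendsto)
    show "h (m * n) = h m * h n" if "coprime m n" for m n
      using that by (simp add: h_def D_omega_mult nat_mult_powr del: of_nat_mult)
    show "summable (\<lambda>n. norm (h n))"
      by (rule summable_comparison_test'[OF summable_D_omega[OF k s]]) (use norm_D_term_le in \<open>simp add: h_def\<close>)
  qed (auto simp: h_def)
  moreover have "(\<Prod>p<N. if prime p then (\<Sum>a. h (p ^ a)) else 1) = ?Q N" for N
    unfolding sum_distrib_left exp_sum[OF finite_lessThan] prod.distrib[symmetric]
  proof (rule prod.cong)
    fix p
    show "(if prime p then (\<Sum>a. h (p ^ a)) else 1) = euler_factor k p s * exp (2 / of_nat k * log_zeta_term p s)"
    proof (cases "prime p")
      case True
      define w where "w = complex_of_nat p powr (-s)"
      have lt: "norm w < 1" unfolding w_def using norm_prime_powr_less[OF True s] by simp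
      have h: "h (p ^ a) = (if a = 0 then 1 else of_nat (Suc a) * w ^ a / of_nat k)" for a
        unfolding h_def w_def using True
        by (simp add: nat_power_powr prime_gt_0_nat D_omega_prime_power del: of_nat_power of_nat_Suc)
      have "(\<lambda>a. of_nat (Suc a) * w ^ a / of_nat k) sums (1 / (1 - w)\<^sup>2 / of_nat k)"
        by (intro sums_divide geometric_deriv_sums lt)
      \<comment> \<open>The formula \<open>Suc a / k\<close> for the value at \<open>p ^ a\<close>
        would give \<open>1 / k\<close> at \<open>a = 0\<close>, where the value is 1; this series
        supplies the difference.\<close>
      moreover have "(\<lambda>a. if a = 0 then 1 - 1 / of_nat k else 0) sums (1 - 1 / of_nat k :: complex)"
        using sums_If_finite_set[of "{0}" "\<lambda>a. 1 - 1 / of_nat k :: complex"] by simp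
      ultimately have "(\<lambda>a. of_nat (Suc a) * w ^ a / of_nat k + (if a = 0 then 1 - 1 / of_nat k else 0)) sums (1 / (1 - w)\<^sup>2 / of_nat k + (1 - 1 / of_nat k))"
        by (rule sums_add)
      also have "(\<lambda>a. of_nat (Suc a) * w ^ a / of_nat k + (if a = 0 then 1 - 1 / of_nat k else 0)) = (\<lambda>a. h (p ^ a))"
        by (auto simp: h)
      finally have "(\<Sum>a. h (p ^ a)) = 1 + (1 / (1 - w)\<^sup>2 - 1) / of_nat k"
        by (simp add: sums_iff diff_divide_distrib)
      moreover have "euler_factor k p s = exp (2 / of_nat k * Ln (1 - w)) * (1 + (1 / (1 - w)\<^sup>2 - 1) / of_nat k)"
        using True by (simp add: euler_factor_def euler_local_def w_def)
      moreover have "exp (2 / of_nat k * log_zeta_term p s) = inverse (exp (2 / of_nat k * Ln (1 - w)))"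
        using True by (simp add: log_zeta_term_def w_def exp_minus)
      ultimately show ?thesis using True by simp
    qed (simp add: log_zeta_term_def euler_factor_def)
  qed simp
  ultimately have "?Q \<longlonglongrightarrow> D_series k s"
    by (simp add: D_series_def h_def)
  moreover have "?Q \<longlonglongrightarrow> euler_limit k s * exp (2 / of_nat k * log_zeta s)"
    using log_zeta_sums[OF s] s by (intro tendsto_mult euler_limit_tendsto tendsto_exp tendsto_const) (auto simp: sums_def)
  ultimately show ?thesis using LIMSEQ_unique by blast
qed

text \<open>Termwise differentiation is justified by uniform convergence on a smaller half-plane.
  The two signs from differentiating \<open>n powr (-s)\<close> cancel, so the new coefficients are
  again nonnegative.\<close>

lemma D_series_deriv2_sums:
  assumes k: "k > 0" and s: "Re s > 1"
  shows "(\<lambda>n. of_real (D_omega k n * (ln (real n))\<^sup>2) * of_nat n powr (-s)) sums ((deriv ^^ 2) (D_series k) s)"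
proof -
  define d where "d = (Re s - 1) / 2"
  have d: "d > 0" using s by (simp add: d_def)
  define A where "A = {s. Re s > 1 + d}"
  define g where "g = (\<lambda>N s. \<Sum>n<N. of_real (D_omega k n) * complex_of_nat n powr (-s))"
  have "uniform_limit A g (D_series k) sequentially"
    unfolding D_series_def[abs_def] g_def
  proof (rule Weierstrass_m_test)
    show "summable (\<lambda>n. D_omega k n * real n powr (- (1 + d)))"
      using d by (intro summable_D_omega k) simp
    fix n u assume "u \<in> A"
    then have "real n powr (- Re u) \<le> real n powr (- (1 + d))"
      by (cases "n = 0") (auto intro!: powr_mono simp: A_def)
    then show "norm (of_real (D_omega k n) * of_nat n powr (-u)) \<le> D_omega k n * real n powr (- (1 + d))"
      by (intro order.trans[OF norm_D_term_le] mult_left_mono D_omega_nonneg)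
  qed
  moreover have der1: "((\<lambda>s. \<Sum>n<N. of_real (c n) * complex_of_nat n powr (-s)) has_field_derivative (\<Sum>n<N. of_real (- c n * ln (real n)) * complex_of_nat n powr (-s))) (at s)" for N s c
  proof (rule DERIV_sum)
    fix n
    show "((\<lambda>s. of_real (c n) * complex_of_nat n powr (-s)) has_field_derivative of_real (- c n * ln (real n)) * complex_of_nat n powr (-s)) (at s)"
    proof (cases "n = 0")
      case False
      then show ?thesis
        by (auto intro!: derivative_eq_intros DERIV_chain2[OF has_field_derivative_powr_right] simp: Ln_of_nat)
    qed simp
  qed
  then have d1: "deriv (\<lambda>s. \<Sum>n<N. of_real (c n) * complex_of_nat n powr (-s)) = (\<lambda>s. \<Sum>n<N. of_real (- c n * ln (real n)) * complex_of_nat n powr (-s))" for N c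
    by (intro ext DERIV_imp_deriv)
  have "g N holomorphic_on A" for N
    unfolding g_def holomorphic_on_def using der1 field_differentiable_at_within field_differentiable_def by blast
  ultimately have "(\<lambda>N. (deriv ^^ 2) (g N) s) \<longlonglongrightarrow> (deriv ^^ 2) (D_series k) s"
  proof (intro higher_deriv_complex_uniform_limit[where A = A])
    show "open A" unfolding A_def by (rule open_halfspace_Re_gt)
    show "s \<in> A" using s by (simp add: A_def d_def field_simps)
  qed auto
  moreover have "(deriv ^^ 2) (g N) s = (\<Sum>n<N. of_real (D_omega k n * (ln (real n))\<^sup>2) * of_nat n powr (-s))" for N
  proof -
    have "deriv (g N) = (\<lambda>s. \<Sum>n<N. of_real (- D_omega k n * ln (real n)) * of_nat n powr (-s))"
      unfolding g_def by (rule d1)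
    then have "(deriv ^^ 2) (g N) s = deriv (\<lambda>s. \<Sum>n<N. of_real (- D_omega k n * ln (real n)) * of_nat n powr (-s)) s"
      by (simp only: numeral_2_eq_2 funpow.simps o_def id_def)
    also have "\<dots> = (\<Sum>n<N. of_real (- (- D_omega k n * ln (real n)) * ln (real n)) * of_nat n powr (-s))"
      unfolding d1 ..
    finally show ?thesis by (simp add: power2_eq_square mult.assoc)
  qed
  ultimately show ?thesis by (simp add: sums_def)
qed

lemma summable_D_omega_ln2:
  assumes "k > 0" "c > 1"
  shows "summable (\<lambda>n. D_omega k n * (ln (real n))\<^sup>2 * real n powr (- c))"
proof -
  have "(\<lambda>n. of_real (D_omega k n * (ln (real n))\<^sup>2) * of_nat n powr (- complex_of_real c)) sums ((deriv ^^ 2) (D_series k) (of_real c))"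
    using assms by (intro D_series_deriv2_sums) auto
  also have "(\<lambda>n. of_real (D_omega k n * (ln (real n))\<^sup>2) * of_nat n powr (- complex_of_real c)) = (\<lambda>n. complex_of_real (D_omega k n * (ln (real n))\<^sup>2 * real n powr (- c)))"
    using powr_of_real[of "real _" "- c"] by auto
  finally have "summable (\<lambda>n. complex_of_real (D_omega k n * (ln (real n))\<^sup>2 * real n powr (- c)))"
    by (rule sums_summable)
  then show ?thesis by (simp only: summable_complex_of_real)
qed

subsection \<open>The second derivative of the Dirichlet series\<close>

text \<open>Used with \<open>E = 1\<close> and \<open>z = 1\<close> for the derivatives of
  \<open>log_zeta\<close>, with \<open>L = log_zeta\<close> away from 1, and with
  \<open>L s = - Ln (s - 1)\<close> near 1.\<close>

lemma deriv_mult_exp: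
  fixes E L F :: "complex \<Rightarrow> complex"
  assumes U: "open U" and E: "E holomorphic_on U" and L: "L holomorphic_on U"
    and F: "\<And>s. s \<in> U \<Longrightarrow> F s = E s * exp (z * L s)" and s: "s \<in> U"
  shows deriv_mult_exp_1: "deriv F s = exp (z * L s) * (deriv E s + z * E s * deriv L s)"
    and deriv_mult_exp_2: "(deriv ^^ 2) F s = exp (z * L s) * (deriv (deriv E) s + 2 * z * deriv E s * deriv L s
          + z * E s * deriv (deriv L) s + z\<^sup>2 * E s * (deriv L s)\<^sup>2)" (is "_ = ?R")
proof -
  note E1 = holomorphic_derivI[OF E U] and E2 = holomorphic_derivI[OF holomorphic_deriv[OF E U] U]
  note L1 = holomorphic_derivI[OF L U] and L2 = holomorphic_derivI[OF holomorphic_deriv[OF L U] U]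
  define G where "G = (\<lambda>s. exp (z * L s) * (deriv E s + z * E s * deriv L s))"
  have F1: "deriv F s = G s" if "s \<in> U" for s
  proof (rule DERIV_imp_deriv, rule has_field_derivative_transform_within_open[OF _ U that])
    show "((\<lambda>s. E s * exp (z * L s)) has_field_derivative G s) (at s)"
      unfolding G_def by (rule derivative_eq_intros E1[OF that] L1[OF that] refl)+ (simp add: algebra_simps)
  qed (simp add: F)
  then show "deriv F s = exp (z * L s) * (deriv E s + z * E s * deriv L s)" using s by (simp add: G_def)
  have "deriv (deriv F) s = ?R"
  proof (rule DERIV_imp_deriv, rule has_field_derivative_transform_within_open[OF _ U s])
    show "(G has_field_derivative ?R) (at s)"
      unfolding G_def
      by (rule derivative_eq_intros E1[OF s] L1[OF s] E2[OF s] L2[OF s] refl)+ (simp add: algebra_simps power2_eq_square)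
  qed (simp add: F1)
  then show "(deriv ^^ 2) F s = ?R"
    by (simp add: numeral_2_eq_2)
qed

lemma log_zeta_derivs:
  assumes "Re s > 1"
  shows "deriv log_zeta s = deriv zeta s / zeta s"
    and "deriv (deriv log_zeta) s = (deriv ^^ 2) zeta s / zeta s - (deriv zeta s / zeta s)\<^sup>2"
proof -
  have op: "open {s. Re s > 1}" by (rule open_halfspace_Re_gt)
  have F: "zeta s = 1 * exp (1 * log_zeta s)" if "s \<in> {s. Re s > 1}" for s
    using exp_log_zeta[of s] that by simp
  have s: "s \<in> {s. Re s > 1}" using assms by simp
  have e: "exp (log_zeta s) = zeta s" by (rule exp_log_zeta[OF assms])
  have nz: "zeta s \<noteq> 0" by (rule zeta_nonzero[OF assms])
  show 1: "deriv log_zeta s = deriv zeta s / zeta s"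
    using deriv_mult_exp_1[OF op holomorphic_on_const log_zeta_holomorphic F s] nz by (simp add: e)
  show "deriv (deriv log_zeta) s = (deriv ^^ 2) zeta s / zeta s - (deriv zeta s / zeta s)\<^sup>2"
    using deriv_mult_exp_2[OF op holomorphic_on_const log_zeta_holomorphic F s] nz
    by (simp add: e 1 field_simps power2_eq_square)
qed

lemma euler_limit_holomorphic': "euler_limit k holomorphic_on {s. Re s > 1}"
  by (rule holomorphic_on_subset[OF euler_limit_holomorphic]) auto

text \<open>Besides the exponential and the bounded derivatives of \<open>euler_limit\<close>, only
  quotients of derivatives of \<open>zeta\<close> by \<open>zeta\<close> enter. So growth of the
  derivatives and a lower bound for \<open>zeta\<close> suffice.\<close>

lemma D_series_deriv2_far:
  assumes k: "k \<ge> 2" and \<epsilon>: "\<epsilon> > 0" and r: "r > 0"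
  obtains C where "C > 0" "\<And>s. 1 < Re s \<Longrightarrow> Re s \<le> 2 \<Longrightarrow> \<bar>Im s\<bar> \<ge> r \<Longrightarrow> norm ((deriv ^^ 2) (D_series k) s) \<le> C * norm s powr \<epsilon>"
proof -
  define z where "z = 2 / real k"
  have z: "0 < z" "z \<le> 1" using k by (auto simp: z_def)
  \<comment> \<open>Each quotient by \<open>zeta\<close> costs \<open>S ^ 2\<close>, at most two of
    them are multiplied, and the exponential costs one more \<open>S\<close>: in all
    \<open>S ^ 5\<close>.\<close>
  define \<epsilon>' where "\<epsilon>' = \<epsilon> / 5"
  have \<epsilon>': "\<epsilon>' > 0" using \<epsilon> by (simp add: \<epsilon>'_def)
  obtain C1 where C1: "C1 > 0" "\<And>s j. Re s \<ge> 1 \<Longrightarrow> norm (s - 1) \<ge> r \<Longrightarrow> j \<le> 2 \<Longrightarrow> norm ((deriv ^^ j) zeta s) \<le> C1 * norm s powr \<epsilon>'"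
    using zeta_growth[OF \<epsilon>' r] by metis
  obtain c where c: "c > 0" "\<And>s. 1 < Re s \<Longrightarrow> Re s \<le> 2 \<Longrightarrow> \<bar>Im s\<bar> \<ge> r \<Longrightarrow> norm (zeta s) \<ge> c * norm s powr (- \<epsilon>')"
    using zeta_lower_bound[OF \<epsilon>' r] by metis
  obtain B where B: "B > 0" "\<And>s j. Re s \<ge> 1 \<Longrightarrow> j \<le> 2 \<Longrightarrow> norm ((deriv ^^ j) (euler_limit k) s) \<le> B"
    using euler_limit_deriv_bounded[of k] by metis
  define Q where "Q = C1 / c"
  have Q: "Q > 0" using C1 c by (simp add: Q_def)
  define K where "K = (1 + C1) * (B * (1 + 2 * Q + (Q + Q\<^sup>2) + Q\<^sup>2))"
  show ?thesis
  proof (rule that[of K])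
    show "K > 0" using C1(1) B(1) Q unfolding K_def by (intro mult_pos_pos add_pos_pos) auto
    fix s assume s: "1 < Re s" "Re s \<le> 2" "\<bar>Im s\<bar> \<ge> r"
    have n1: "norm s \<ge> 1" using s complex_Re_le_cmod[of s] by linarith
    then have "s \<noteq> 0" by auto
    define S where "S = norm s powr \<epsilon>'"
    have S: "S \<ge> 1" using n1 \<epsilon>' by (simp add: S_def ge_one_powr_ge_zero)
    have S5: "S ^ 5 = norm s powr \<epsilon>"
      using \<open>s \<noteq> 0\<close> powr_realpow[of "norm s powr \<epsilon>'" 5] by (simp add: S_def powr_powr \<epsilon>'_def)
    have "norm (s - 1) \<ge> r" using s abs_Im_le_cmod[of "s - 1"] by simp
    then have zj: "norm ((deriv ^^ j) zeta s) \<le> C1 * S" if "j \<le> 2" for j using C1(2) s that by (simp add: S_def)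
    have zl: "norm (zeta s) \<ge> c / S" using c(2)[OF s] by (simp add: S_def powr_minus field_simps)
    have q: "norm ((deriv ^^ j) zeta s / zeta s) \<le> Q * S\<^sup>2" if "j \<le> 2" for j
    proof -
      have "norm ((deriv ^^ j) zeta s / zeta s) \<le> (C1 * S) / (c / S)"
        unfolding norm_divide using zj[OF that] zl c(1) C1(1) S by (intro frac_le) auto
      also have "\<dots> = Q * S\<^sup>2" by (simp add: Q_def power2_eq_square)
      finally show ?thesis .
    qed
    note ld = log_zeta_derivs[OF s(1)]
    have L1: "norm (deriv log_zeta s) \<le> Q * S\<^sup>2" using q[of 1] by (simp add: ld)
    have L1': "norm (deriv log_zeta s) ^ 2 \<le> Q\<^sup>2 * S ^ 4"
      using power_mono[OF L1, of 2] by (simp add: power_mult_distrib flip: power_mult)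
    have S24: "S\<^sup>2 \<le> S ^ 4" using S by (intro power_increasing) auto
    have S14: "1 \<le> S ^ 4" using S by (rule one_le_power)
    have L2: "norm (deriv (deriv log_zeta) s) \<le> (Q + Q\<^sup>2) * S ^ 4"
    proof -
      have "norm (deriv (deriv log_zeta) s) \<le> norm ((deriv ^^ 2) zeta s / zeta s) + norm ((deriv zeta s / zeta s)\<^sup>2)"
        unfolding ld by (rule norm_triangle_ineq4)
      also have "norm ((deriv zeta s / zeta s)\<^sup>2) \<le> Q\<^sup>2 * S ^ 4" using L1' by (simp add: ld norm_power)
      also have "norm ((deriv ^^ 2) zeta s / zeta s) \<le> Q * S ^ 4"
        using q[of 2] mult_left_mono[OF S24, of Q] Q by linarith
      finally show ?thesis by (simp add: algebra_simps)
    qed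
    have ex: "norm (exp (of_real z * log_zeta s)) \<le> (1 + C1) * S"
    proof -
      have "norm (exp (of_real z * log_zeta s)) = norm (zeta s) powr z"
        using zeta_nonzero[OF s(1)] by (simp add: norm_zeta_eq[OF s(1)] powr_def)
      \<comment> \<open>Adding 1 to the base allows raising the exponent from \<open>z\<close> to 1
        without knowing whether \<open>norm (zeta s)\<close> exceeds 1.\<close>
      also have "\<dots> \<le> (1 + norm (zeta s)) powr z" using z by (intro powr_mono2) auto
      also have "\<dots> \<le> (1 + norm (zeta s)) powr 1" using z by (intro powr_mono) auto
      also have "\<dots> \<le> 1 * S + C1 * S" using zj[of 0] S by simp
      finally show ?thesis by (simp add: algebra_simps)
    qed
    have E: "norm (euler_limit k s) \<le> B" "norm (deriv (euler_limit k) s) \<le> B" "norm (deriv (deriv (euler_limit k)) s) \<le> B"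
      using B(2)[of s 0] B(2)[of s 1] B(2)[of s 2] s by (auto simp: numeral_2_eq_2)
    have "(deriv ^^ 2) (D_series k) s = exp (of_real z * log_zeta s) * (deriv (deriv (euler_limit k)) s + 2 * of_real z * deriv (euler_limit k) s * deriv log_zeta s
          + of_real z * euler_limit k s * deriv (deriv log_zeta) s + (of_real z)\<^sup>2 * euler_limit k s * (deriv log_zeta s)\<^sup>2)"
      using k by (intro deriv_mult_exp_2[OF open_halfspace_Re_gt euler_limit_holomorphic' log_zeta_holomorphic])
        (auto simp: D_series_eq z_def s)
    also have "norm \<dots> \<le> ((1 + C1) * S) * (B * S ^ 4 + 2 * (B * (Q * S ^ 4)) + B * ((Q + Q\<^sup>2) * S ^ 4) + B * (Q\<^sup>2 * S ^ 4))"
      unfolding norm_mult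
    proof (intro mult_mono ex order.trans[OF norm_triangle_ineq] add_mono)
      show "norm (deriv (deriv (euler_limit k)) s) \<le> B * S ^ 4"
        using E(3) mult_left_mono[OF S14, of B] B(1) by linarith
      have "norm (2 * of_real z * deriv (euler_limit k) s * deriv log_zeta s) = 2 * (z * (norm (deriv (euler_limit k) s) * norm (deriv log_zeta s)))"
        using z by (simp add: norm_mult)
      also have "\<dots> \<le> 2 * (1 * (B * (Q * S ^ 4)))"
        using z E L1 order.trans[OF L1 mult_left_mono[OF S24]] Q B by (intro mult_mono mult_nonneg_nonneg) auto
      finally show "norm (2 * of_real z * deriv (euler_limit k) s * deriv log_zeta s) \<le> 2 * (B * (Q * S ^ 4))" by simp
      have "norm (of_real z * euler_limit k s * deriv (deriv log_zeta) s) = z * (norm (euler_limit k s) * norm (deriv (deriv log_zeta) s))"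
        using z by (simp add: norm_mult)
      also have "\<dots> \<le> 1 * (B * ((Q + Q\<^sup>2) * S ^ 4))"
        using z E L2 Q B by (intro mult_mono mult_nonneg_nonneg) auto
      finally show "norm (of_real z * euler_limit k s * deriv (deriv log_zeta) s) \<le> B * ((Q + Q\<^sup>2) * S ^ 4)" by simp
      have "norm ((of_real z)\<^sup>2 * euler_limit k s * (deriv log_zeta s)\<^sup>2) = z\<^sup>2 * (norm (euler_limit k s) * norm (deriv log_zeta s) ^ 2)"
        using z by (simp add: norm_mult norm_power)
      also have "\<dots> \<le> 1 * (B * (Q\<^sup>2 * S ^ 4))"
        using z E L1' Q B by (intro mult_mono mult_nonneg_nonneg) (auto intro: power_le_one)
      finally show "norm ((of_real z)\<^sup>2 * euler_limit k s * (deriv log_zeta s)\<^sup>2) \<le> B * (Q\<^sup>2 * S ^ 4)" by simp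
    qed (use S C1 in auto)
    also have "\<dots> = K * S ^ 5" by (simp add: K_def algebra_simps eval_nat_numeral)
    finally show "norm ((deriv ^^ 2) (D_series k) s) \<le> K * norm s powr \<epsilon>" by (simp add: S5)
  qed
qed

text \<open>\<open>(s - 1) * zeta s\<close> extends to \<open>H\<close> with \<open>H 1 = 1\<close>,
  so \<open>Ln (H s)\<close> is holomorphic near 1. The difference of the two sides has exponential
  1, hence derivative 0, and is constant on a convex set. At a real point its imaginary part
  vanishes, and its real part does because its exponential has modulus 1.\<close>

lemma log_zeta_near_1:
  obtains \<rho> h where "0 < \<rho>" "\<rho> \<le> 1/4" "h holomorphic_on ball 1 \<rho>" "h 1 = 0"
    "\<And>s. Re s > 1 \<Longrightarrow> s \<in> ball 1 \<rho> \<Longrightarrow> log_zeta s = h s - Ln (s - 1)"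
proof -
  define H where "H = (\<lambda>s. 1 + (s - 1) * zeta_rem s)"
  have holH: "H holomorphic_on {s. Re s > 1/2}"
    unfolding H_def by (intro holomorphic_intros zeta_rem_holomorphic)
  then have "isCont H 1"
    by (intro continuous_on_interior[OF holomorphic_on_imp_continuous_on[OF holH]])
      (subst interior_open[OF open_halfspace_Re_gt], simp)
  then obtain d where d: "d > 0" "\<And>s. dist s 1 < d \<Longrightarrow> dist (H s) (H 1) < 1"
    unfolding continuous_at_eps_delta by (metis zero_less_one)
  \<comment> \<open>\<open>1/4\<close> places the ball inside \<open>Re s > 3/4\<close>, where
    \<open>euler_limit\<close> is holomorphic too.\<close>
  define \<rho> where "\<rho> = min d (1/4)"
  have \<rho>: "0 < \<rho>" "\<rho> \<le> 1/4" using d by (auto simp: \<rho>_def)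
  have H1: "H 1 = 1" by (simp add: H_def)
  have Hpos: "Re (H s) > 0" if "s \<in> ball 1 \<rho>" for s
  proof -
    have "dist (H s) (H 1) < 1" using that by (intro d(2)) (simp add: dist_commute \<rho>_def)
    then show ?thesis using complex_Re_le_cmod[of "H 1 - H s"] by (simp add: H1 dist_norm norm_minus_commute)
  qed
  have sub: "ball 1 \<rho> \<subseteq> {s. Re s > 1/2}"
  proof
    fix s :: complex assume "s \<in> ball 1 \<rho>"
    then show "s \<in> {s. Re s > 1/2}" using complex_Re_le_cmod[of "1 - s"] \<rho> by (simp add: dist_norm)
  qed
  define h where "h = (\<lambda>s. Ln (H s))"
  have "H s \<notin> \<real>\<^sub>\<le>\<^sub>0" if "s \<in> ball 1 \<rho>" for s
    using Hpos[OF that] by (auto simp: complex_nonpos_Reals_iff)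
  then have holh: "h holomorphic_on ball 1 \<rho>"
    unfolding h_def by (intro holomorphic_intros holomorphic_on_subset[OF holH sub])
  define V where "V = ball 1 \<rho> \<inter> {s. Re s > 1}"
  have V: "open V" "convex V" unfolding V_def by (auto intro: open_Int open_halfspace_Re_gt convex_Int convex_halfspace_Re_gt)
  define D where "D = (\<lambda>s. log_zeta s - h s + Ln (s - 1))"
  have holD: "D holomorphic_on V"
    unfolding D_def V_def
    by (intro holomorphic_intros holomorphic_on_subset[OF holh] holomorphic_on_subset[OF log_zeta_holomorphic]) (auto simp: complex_nonpos_Reals_iff)
  have Hz: "H s = (s - 1) * zeta s" if "Re s > 1" for s
    using that by (auto simp: H_def zeta_def field_simps)
  have expD: "exp (D s) = 1" if "s \<in> V" for s
  proof -
    have s: "Re s > 1" "s \<in> ball 1 \<rho>" "s \<noteq> 1" using that by (auto simp: V_def)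
    have "H s \<noteq> 0" using Hpos[OF s(2)] by auto
    then show ?thesis using s zeta_nonzero[OF s(1)]
      by (simp add: D_def exp_add exp_diff exp_log_zeta h_def Hz)
  qed
  define x where "x = 1 + \<rho> / 2"
  have x: "x > 1" "complex_of_real x \<in> V"
    using \<rho> by (auto simp: V_def x_def dist_norm norm_divide)
  have "\<exists>c. \<forall>s\<in>V. D s = c"
  proof (rule has_field_derivative_zero_constant[OF V(2)])
    fix w assume w: "w \<in> V"
    note dD = holomorphic_derivI[OF holD V(1) w]
    have "((\<lambda>s. exp (D s)) has_field_derivative (exp (D w) * deriv D w)) (at w)"
      using dD by (auto intro!: derivative_eq_intros)
    moreover have "((\<lambda>s. exp (D s)) has_field_derivative 0) (at w)"
      by (rule has_field_derivative_transform_within_open[OF DERIV_const[of 1] V(1) w]) (simp add: expD)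
    ultimately have "exp (D w) * deriv D w = 0" by (rule DERIV_unique)
    then show "(D has_field_derivative 0) (at w within V)" using dD by (simp add: has_field_derivative_at_within)
  qed
  with x(2) have "D s = D (of_real x)" if "s \<in> V" for s using that by metis
  moreover have "D (of_real x) = 0"
  proof -
    have "log_zeta (of_real x) = of_real (Re (log_zeta (of_real x)))"
      using Im_log_zeta_of_real[OF x(1)] by (simp add: complex_eq_iff)
    then have "zeta (of_real x) = of_real (exp (Re (log_zeta (of_real x))))"
      using exp_log_zeta[of "of_real x"] x(1) by (metis exp_of_real Re_complex_of_real)
    then have "H (of_real x) = of_real ((x - 1) * exp (Re (log_zeta (of_real x))))"
      using Hz[of "of_real x"] x(1) by simp
    then have "Im (h (of_real x)) = 0" unfolding h_def using x(1) by (simp only: Ln_of_real mult_pos_pos exp_gt_zero Im_complex_of_real diff_gt_0_iff_gt)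
    moreover have "Im (Ln (complex_of_real x - 1)) = 0"
      using x(1) Ln_of_real[of "x - 1"] by simp
    ultimately have "Im (D (of_real x)) = 0" using Im_log_zeta_of_real[OF x(1)] by (simp add: D_def)
    moreover have "exp (Re (D (of_real x))) = 1" using expD[OF x(2)] by (metis norm_exp_eq_Re norm_one)
    ultimately show ?thesis by (simp add: complex_eq_iff)
  qed
  ultimately have "log_zeta s = h s - Ln (s - 1)" if "Re s > 1" "s \<in> ball 1 \<rho>" for s
    using that by (simp add: D_def V_def algebra_simps)
  moreover have "h 1 = 0" by (simp add: h_def H1)
  ultimately show ?thesis using that \<rho> holh by blast
qed

text \<open>Near 1 the series is \<open>K s * (s - 1) powr (- z)\<close> with \<open>K\<close>
  holomorphic at 1 and \<open>K 1\<close> the Euler product. Replacing \<open>K s\<close> by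
  \<open>K 1\<close> in the leading term gains a factor \<open>norm (s - 1)\<close>, and so does
  every derivative that falls on \<open>K\<close>.\<close>

lemma D_series_deriv2_near:
  assumes k: "k \<ge> 2"
  defines "z \<equiv> 2 / real k"
  obtains C \<rho> where "C > 0" "\<rho> > 0" "\<rho> \<le> 1/4"
    "\<And>s. 1 < Re s \<Longrightarrow> norm (s - 1) \<le> \<rho> \<Longrightarrow>
      norm ((deriv ^^ 2) (D_series k) s - of_real (euler_product k * (z * (z + 1))) * (s - 1) powr (- of_real z - 2)) \<le> C * norm (s - 1) powr (- z - 1)"
proof -
  have z: "0 < z" "z \<le> 1" using k by (auto simp: z_def)
  obtain \<rho> h where \<rho>: "0 < \<rho>" "\<rho> \<le> 1/4" and h: "h holomorphic_on ball 1 \<rho>" "h 1 = 0"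
    and lz: "\<And>s. Re s > 1 \<Longrightarrow> s \<in> ball 1 \<rho> \<Longrightarrow> log_zeta s = h s - Ln (s - 1)"
    using log_zeta_near_1 by metis
  define K where "K = (\<lambda>s. euler_limit k s * exp (of_real z * h s))"
  have sub: "ball 1 \<rho> \<subseteq> {s. Re s > 3/4}"
  proof
    fix s :: complex assume "s \<in> ball 1 \<rho>"
    then show "s \<in> {s. Re s > 3/4}" using complex_Re_le_cmod[of "1 - s"] \<rho> by (simp add: dist_norm)
  qed
  have holK: "K holomorphic_on ball 1 \<rho>"
    unfolding K_def by (intro holomorphic_intros h holomorphic_on_subset[OF euler_limit_holomorphic sub])
  have K1: "K 1 = of_real (euler_product k)" using k by (simp add: K_def h euler_limit_1)
  define V where "V = ball 1 \<rho> \<inter> {s. Re s > 1}"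
  have V: "open V" unfolding V_def by (auto intro: open_Int open_halfspace_Re_gt)
  have holL: "(\<lambda>s. - Ln (s - 1)) holomorphic_on V"
    unfolding V_def by (intro holomorphic_intros) (auto simp: complex_nonpos_Reals_iff)
  have F: "D_series k s = K s * exp (of_real z * - Ln (s - 1))" if "s \<in> V" for s
  proof -
    have "exp (of_real z * (h s - Ln (s - 1))) = exp (of_real z * h s) * exp (of_real z * - Ln (s - 1))"
      by (simp add: algebra_simps flip: exp_add)
    moreover have "D_series k s = euler_limit k s * exp (of_real z * log_zeta s)"
      using that k by (simp add: V_def D_series_eq z_def)
    ultimately show ?thesis using that by (simp add: K_def V_def lz)
  qed
  define B where "B = cball (1::complex) (\<rho> / 2)"
  have Bsub: "B \<subseteq> ball 1 \<rho>" using \<rho> by (auto simp: B_def)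
  have bd: "\<exists>M. \<forall>s\<in>B. norm (f s) \<le> M" if "f holomorphic_on ball 1 \<rho>" for f :: "complex \<Rightarrow> complex"
  proof -
    have "compact (f ` B)"
      by (intro compact_continuous_image holomorphic_on_imp_continuous_on holomorphic_on_subset[OF that Bsub]) (simp add: B_def)
    then show ?thesis by (meson compact_imp_bounded bounded_iff imageI)
  qed
  obtain M1 where M1: "\<And>s. s \<in> B \<Longrightarrow> norm (deriv K s) \<le> M1"
    using bd[OF holomorphic_deriv[OF holK]] by auto
  obtain M2 where M2: "\<And>s. s \<in> B \<Longrightarrow> norm (deriv (deriv K) s) \<le> M2"
    using bd[OF holomorphic_deriv[OF holomorphic_deriv[OF holK]]] by auto
  define M where "M = \<bar>M1\<bar> + \<bar>M2\<bar> + 1"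
  have M: "M > 0" "\<And>s. s \<in> B \<Longrightarrow> norm (deriv K s) \<le> M" "\<And>s. s \<in> B \<Longrightarrow> norm (deriv (deriv K) s) \<le> M"
    using M1 M2 by (fastforce simp: M_def)+
  show ?thesis
  proof (rule that[of "M * (1 + 2 * z + (z + z\<^sup>2))" "\<rho> / 2"])
    show "M * (1 + 2 * z + (z + z\<^sup>2)) > 0" using M(1) z by (intro mult_pos_pos add_pos_pos) auto
    fix s assume s: "1 < Re s" "norm (s - 1) \<le> \<rho> / 2"
    have sB: "s \<in> B" using s by (simp add: B_def dist_norm norm_minus_commute)
    have sV: "s \<in> V" using s sB Bsub by (auto simp: V_def)
    define u where "u = s - 1"
    have u: "u \<noteq> 0" "norm u \<le> 1" using s \<rho> by (auto simp: u_def)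
    have KK: "norm (K s - K 1) \<le> M * norm u"
      unfolding u_def
    proof (rule field_differentiable_bound[where f' = "deriv K" and S = B])
      fix w assume "w \<in> B"
      then show "(K has_field_derivative deriv K w) (at w within B)"
        using Bsub by (intro has_field_derivative_at_within[OF holomorphic_derivI[OF holK]]) auto
    qed (use M sB \<rho> in \<open>auto simp: B_def\<close>)
    have d1: "deriv (\<lambda>s. - Ln (s - 1)) w = - (1 / (w - 1))" if "w \<in> V" for w
      using that by (intro DERIV_imp_deriv) (auto intro!: derivative_eq_intros simp: V_def complex_nonpos_Reals_iff inverse_eq_divide)
    have d2: "deriv (deriv (\<lambda>s. - Ln (s - 1))) s = 1 / u\<^sup>2"
    proof (rule DERIV_imp_deriv, rule has_field_derivative_transform_within_open[OF _ V sV])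
      show "((\<lambda>w. - (1 / (w - 1))) has_field_derivative 1 / u\<^sup>2) (at s)"
        using u by (auto intro!: derivative_eq_intros simp: u_def power2_eq_square)
    qed (simp add: d1)
    define X where "X = exp (of_real z * - Ln (s - 1))"
    have F2: "(deriv ^^ 2) (D_series k) s = X * (deriv (deriv K) s + 2 * of_real z * deriv K s * (- (1 / u))
          + of_real z * K s * (1 / u\<^sup>2) + (of_real z)\<^sup>2 * K s * (- (1 / u))\<^sup>2)"
      using deriv_mult_exp_2[OF V holomorphic_on_subset[OF holK] holL F sV] d1[OF sV] d2
      by (simp add: V_def u_def X_def)
    have pw: "u powr (- of_real z - 2) = X * (1 / u\<^sup>2)"
    proof -
      have "u powr (- of_real z - 2) = u powr (- of_real z) * u powr (- of_nat 2)" by (simp flip: powr_add)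
      also have "u powr (- of_nat 2) = 1 / u\<^sup>2" using u by (subst powr_minus) (simp add: field_simps)
      finally show ?thesis using u by (simp add: powr_def u_def X_def)
    qed
    have "(deriv ^^ 2) (D_series k) s - of_real (euler_product k * (z * (z + 1))) * u powr (- of_real z - 2)
      = X * (deriv (deriv K) s + - (2 * of_real z * deriv K s / u) + (of_real z + (of_real z)\<^sup>2) * (K s - K 1) / u\<^sup>2)"
      unfolding F2 pw K1 using u by (simp add: field_simps power2_eq_square)
    also have "norm \<dots> \<le> norm u powr (- z) * (M * (1 / norm u) + 2 * z * M * (1 / norm u) + (z + z\<^sup>2) * M * (1 / norm u))"
      unfolding norm_mult
    proof (intro mult_mono order.trans[OF norm_triangle_ineq] add_mono)
      show "norm X \<le> norm u powr (- z)"
        using u by (simp add: X_def u_def powr_def)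
      have "norm (deriv (deriv K) s) \<le> M * 1" using M(3)[OF sB] by simp
      also have "\<dots> \<le> M * (1 / norm u)" using M(1) u by (intro mult_left_mono) auto
      finally show "norm (deriv (deriv K) s) \<le> M * (1 / norm u)" .
      show "norm (- (2 * of_real z * deriv K s / u)) \<le> 2 * z * M * (1 / norm u)"
        using M(2)[OF sB] z u by (simp add: norm_mult norm_divide divide_right_mono mult_left_mono)
      have "norm ((of_real z + (of_real z)\<^sup>2) * (K s - K 1) / u\<^sup>2) = (z + z\<^sup>2) * norm (K s - K 1) / norm u ^ 2"
        using z by (simp add: norm_mult norm_divide norm_power flip: of_real_power of_real_add)
      also have "\<dots> \<le> (z + z\<^sup>2) * (M * norm u) / norm u ^ 2"
        using KK z by (intro divide_right_mono mult_left_mono) auto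
      also have "\<dots> = (z + z\<^sup>2) * M * (1 / norm u)" using u by (simp add: power2_eq_square)
      finally show "norm ((of_real z + (of_real z)\<^sup>2) * (K s - K 1) / u\<^sup>2) \<le> (z + z\<^sup>2) * M * (1 / norm u)" .
    qed auto
    also have "\<dots> = M * (1 + 2 * z + (z + z\<^sup>2)) * (norm u powr (- z) * (1 / norm u))" by (simp add: algebra_simps add_divide_distrib)
    also have "norm u powr (- z) * (1 / norm u) = norm u powr (- z - 1)"
      using u by (simp add: powr_diff)
    finally show "norm ((deriv ^^ 2) (D_series k) s - of_real (euler_product k * (z * (z + 1))) * (s - 1) powr (- of_real z - 2)) \<le> M * (1 + 2 * z + (z + z\<^sup>2)) * norm (s - 1) powr (- z - 1)"
      by (simp add: u_def)
  qed (use \<rho> in auto)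
qed

subsection \<open>Perron formula for the Riesz means\<close>

lemma integrable_norm_Complex_powr:
  fixes \<beta> :: real
  assumes "\<beta> > 0"
  shows "integrable lborel (\<lambda>t. norm (Complex 1 t) powr (- 1 - \<beta>))"
proof -
  define f where "f = (\<lambda>t::real. indicator {1..} t * t powr (- 1 - \<beta>))"
  have "((\<lambda>x. x powr (- 1 - \<beta>)) has_integral - (1 powr (- 1 - \<beta> + 1)) / (- 1 - \<beta> + 1)) {1::real..}"
    using assms by (intro has_integral_powr_to_inf) auto
  then have "(\<lambda>x::real. x powr (- 1 - \<beta>)) absolutely_integrable_on {1..}"
    by (intro nonnegative_absolutely_integrable_1) (auto simp: has_integral_integrable)
  then have "integrable lebesgue f"
    by (simp add: set_integrable_def f_def)
  then have f: "integrable lborel f"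
    by (subst (asm) integrable_completion) (auto simp: f_def)
  have f': "integrable lborel (\<lambda>t. f (0 + (-1) * t))"
    by (rule lborel_integrable_real_affine[OF f]) simp
  have i: "integrable lborel (indicator {-1..1::real} :: real \<Rightarrow> real)" by simp
  show ?thesis
  proof (rule Bochner_Integration.integrable_bound[OF Bochner_Integration.integrable_add[OF Bochner_Integration.integrable_add[OF f f'] i]])
    show "AE t in lborel. norm (norm (Complex 1 t) powr (- 1 - \<beta>)) \<le> norm (f t + f (0 + (-1) * t) + indicator {-1..1} t)"
    proof (rule AE_I2)
      fix t :: real
      have nn: "0 \<le> f t" "0 \<le> f (0 + (-1) * t)" "0 \<le> (indicator {-1..1} t :: real)" by (auto simp: f_def)
      have "norm (Complex 1 t) powr (- 1 - \<beta>) \<le> f t + f (0 + (-1) * t) + indicator {-1..1} t"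
      proof (cases "\<bar>t\<bar> \<le> 1")
        case True
        have "norm (Complex 1 t) \<ge> 1" using complex_Re_le_cmod[of "Complex 1 t"] by simp
        then have "norm (Complex 1 t) powr (- 1 - \<beta>) \<le> 1 powr (- 1 - \<beta>)"
          using assms by (intro powr_mono2') auto
        moreover have "indicator {-1..1} t = (1::real)" using True by (auto simp: indicator_def)
        ultimately show ?thesis using nn by simp
      next
        case False
        have "norm (Complex 1 t) \<ge> \<bar>t\<bar>" using abs_Im_le_cmod[of "Complex 1 t"] by simp
        then have "norm (Complex 1 t) powr (- 1 - \<beta>) \<le> \<bar>t\<bar> powr (- 1 - \<beta>)"
          using assms False by (intro powr_mono2') auto
        also have "\<dots> \<le> f t + f (0 + (-1) * t)" using False by (auto simp: f_def indicator_def abs_if)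
        finally show ?thesis using nn by linarith
      qed
      then show "norm (norm (Complex 1 t) powr (- 1 - \<beta>)) \<le> norm (f t + f (0 + (-1) * t) + indicator {-1..1} t)"
        using nn by simp
    qed
  qed simp
qed

text \<open>Scaling of \<open>t\<close> by \<open>\<delta>\<close>. With
  \<open>\<delta> = 1 / Y\<close> and \<open>\<beta> = z\<close> this produces the factor
  \<open>Y powr z\<close> in the contribution of the singularity.\<close>

lemma has_bochner_integral_norm_Complex_powr:
  assumes "\<beta> > 0" "\<delta> > 0"
  shows "has_bochner_integral lborel (\<lambda>t. norm (Complex \<delta> t) powr (- 1 - \<beta>)) (\<delta> powr (- \<beta>) * (LBINT t. norm (Complex 1 t) powr (- 1 - \<beta>)))"
proof -
  define J where "J = (LBINT t. norm (Complex 1 t) powr (- 1 - \<beta>))"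
  have "has_bochner_integral lborel (\<lambda>t. norm (Complex 1 t) powr (- 1 - \<beta>)) J"
    unfolding J_def using integrable_norm_Complex_powr[OF assms(1)] by (rule has_bochner_integral_integrable)
  then have "has_bochner_integral lborel (\<lambda>t. norm (Complex 1 (0 + (1 / \<delta>) * t)) powr (- 1 - \<beta>)) (J /\<^sub>R \<bar>1 / \<delta>\<bar>)"
    using assms by (subst (asm) lborel_has_bochner_integral_real_affine_iff[where c = "1 / \<delta>" and t = 0]) auto
  then have "has_bochner_integral lborel (\<lambda>t. \<delta> powr (- 1 - \<beta>) * norm (Complex 1 (0 + (1 / \<delta>) * t)) powr (- 1 - \<beta>)) (\<delta> powr (- 1 - \<beta>) * (J /\<^sub>R \<bar>1 / \<delta>\<bar>))"
    by (rule has_bochner_integral_mult_right)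
  also have "(\<lambda>t. \<delta> powr (- 1 - \<beta>) * norm (Complex 1 (0 + (1 / \<delta>) * t)) powr (- 1 - \<beta>)) = (\<lambda>t. norm (Complex \<delta> t) powr (- 1 - \<beta>))"
  proof
    fix t
    have "Complex \<delta> t = of_real \<delta> * Complex 1 (0 + (1 / \<delta>) * t)" using assms by (simp add: complex_eq_iff)
    then have "norm (Complex \<delta> t) = \<delta> * norm (Complex 1 (0 + (1 / \<delta>) * t))" using assms by (simp add: norm_mult)
    then show "\<delta> powr (- 1 - \<beta>) * norm (Complex 1 (0 + (1 / \<delta>) * t)) powr (- 1 - \<beta>) = norm (Complex \<delta> t) powr (- 1 - \<beta>)"
      using assms by (simp add: powr_mult)
  qed
  also have "\<delta> powr (- 1 - \<beta>) * (J /\<^sub>R \<bar>1 / \<delta>\<bar>) = \<delta> powr (- \<beta>) * J"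
    using assms by (simp add: powr_diff powr_minus field_simps)
  finally show ?thesis by (simp add: J_def)
qed

text \<open>Interpolates between the linear bound and the trivial one. \<open>q = 1\<close> serves
  for the error at the singularity, \<open>q = 1 - z\<close> for the growth along the line.\<close>

lemma norm_exp_minus_1_le:
  fixes w :: complex
  assumes "0 \<le> Re w" "Re w \<le> 2" "0 \<le> q" "q \<le> 1"
  shows "norm (exp w - 1) \<le> 2 * exp 2 * norm w powr q"
proof (cases "w = 0")
  case False
  have 1: "norm (exp w - exp 0) \<le> exp 2 * norm (w - 0)"
  proof (rule field_differentiable_bound[where f' = exp and S = "{w. Re w \<le> 2}"])
    fix u :: complex assume "u \<in> {w. Re w \<le> 2}"
    then show "norm (exp u) \<le> exp 2" by simp
    show "(exp has_field_derivative exp u) (at u within {w. Re w \<le> 2})"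
      by (rule has_field_derivative_at_within[OF DERIV_exp])
  qed (use assms in \<open>auto intro: convex_halfspace_Re_le\<close>)
  have "norm (exp w - 1) \<le> norm (exp w) + norm (1::complex)" by (rule norm_triangle_ineq4)
  also have "\<dots> \<le> exp 2 + exp 2" using assms by (intro add_mono) auto
  finally have 2: "norm (exp w - 1) \<le> 2 * exp 2" by simp
  show ?thesis
  proof (cases "norm w \<le> 1")
    case True
    have "norm w = norm w powr 1" by simp
    also have "\<dots> \<le> norm w powr q" using True False assms by (intro powr_mono') auto
    finally have "exp 2 * norm w \<le> exp 2 * norm w powr q" by (intro mult_left_mono) auto
    also have "\<dots> \<le> 2 * exp 2 * norm w powr q" by simp
    finally have "exp 2 * norm w \<le> 2 * exp 2 * norm w powr q" .
    moreover have "norm (exp w - 1) \<le> exp 2 * norm w" using 1 by simp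
    ultimately show ?thesis by linarith
  next
    case False
    then have "1 \<le> norm w powr q" using assms by (intro ge_one_powr_ge_zero) auto
    then have "2 * exp 2 * 1 \<le> 2 * exp 2 * norm w powr q" by (intro mult_left_mono) auto
    with 2 show ?thesis by linarith
  qed
qed auto

definition D_weight :: "nat \<Rightarrow> nat \<Rightarrow> real" where
  "D_weight k n = D_omega k n * (ln (real n))\<^sup>2"

text \<open>Only finitely many terms differ from 0; the integral over the counting measure has the
  form required by \<open>perron_measure\<close>.\<close>

definition D_riesz :: "nat \<Rightarrow> real \<Rightarrow> real" where
  "D_riesz k X = (LINT n|count_space UNIV. D_weight k n * max (X - ln (real n)) 0)"

definition main_weight :: "real \<Rightarrow> real \<Rightarrow> real" where
  "main_weight z v = indicator {0..} v * (v powr (z + 1) * exp v)"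

definition main_riesz :: "real \<Rightarrow> real \<Rightarrow> real" where
  "main_riesz z X = (LBINT v. main_weight z v * max (X - v) 0)"

lemma D_perron:
  fixes c X :: real
  assumes k: "k > 0" and c: "c > 1"
  defines "f \<equiv> \<lambda>t. (deriv ^^ 2) (D_series k) (Complex c t) * exp (of_real X * Complex c t) / (Complex c t)^2"
  shows "integrable lborel f" "(LBINT t. f t) = of_real (2 * pi * D_riesz k X)"
    and "integrable (count_space UNIV) (\<lambda>n. D_weight k n * max (X - ln (real n)) 0)"
proof -
  have sf: "sigma_finite_measure (count_space (UNIV :: nat set))"
    by (rule sigma_finite_measure_count_space)
  have e: "D_weight k n * exp (- c * ln (real n)) = D_omega k n * (ln (real n))\<^sup>2 * real n powr (- c)" for n
    by (cases "n = 0") (auto simp: D_weight_def powr_def)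
  have int: "integrable (count_space UNIV) (\<lambda>n. D_weight k n * exp (- c * ln (real n)))"
    unfolding integrable_count_space_nat_iff e using summable_D_omega_ln2[OF k c] D_omega_nonneg[of k]
    by (simp add: abs_mult)
  have D: "(LINT n|count_space UNIV. of_real (D_weight k n) * exp (- s * of_real (ln (real n)))) = (deriv ^^ 2) (D_series k) s"
    if "Re s = c" for s
  proof -
    have e': "of_real (D_weight k n) * exp (- s * of_real (ln (real n))) = of_real (D_omega k n * (ln (real n))\<^sup>2) * of_nat n powr (-s)" for n
      by (cases "n = 0") (auto simp: D_weight_def powr_def Ln_of_nat)
    have "integrable (count_space UNIV) (\<lambda>n. of_real (D_weight k n) * exp (- s * of_real (ln (real n))))"
      by (rule Bochner_Integration.integrable_bound[OF int]) (auto simp: norm_mult abs_mult that)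
    from sums_integral_count_space_nat[OF this] have
      "(\<lambda>n. of_real (D_weight k n) * exp (- s * of_real (ln (real n)))) sums (LINT n|count_space UNIV. of_real (D_weight k n) * exp (- s * of_real (ln (real n))))" .
    moreover have "(\<lambda>n. of_real (D_weight k n) * exp (- s * of_real (ln (real n)))) sums (deriv ^^ 2) (D_series k) s"
      unfolding e' using k c that by (intro D_series_deriv2_sums) auto
    ultimately show ?thesis by (rule sums_unique2)
  qed
  have D': "(LINT n|count_space UNIV. of_real (D_weight k n) * exp (- Complex c t * of_real (ln (real n)))) = (deriv ^^ 2) (D_series k) (Complex c t)" for t
    by (rule D) simp
  have "c > 0" using c by simp
  note P = perron_measure[OF sf this, of "D_weight k" "\<lambda>n. ln (real n)", unfolded D', OF _ _ int]
  show "integrable lborel f" unfolding f_def by (rule P(1)) auto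
  show "(LBINT t. f t) = of_real (2 * pi * D_riesz k X)" unfolding f_def D_riesz_def by (rule P(2)) auto
  show "integrable (count_space UNIV) (\<lambda>n. D_weight k n * max (X - ln (real n)) 0)" by (rule P(3)) auto
qed

lemma main_perron:
  fixes z c X :: real
  assumes z: "z > 0" and c: "c > 1"
  defines "f \<equiv> \<lambda>t. of_real (Gamma (z + 2)) * (Complex c t - 1) powr (- of_real z - 2) * exp (of_real X * Complex c t) / (Complex c t)^2"
  shows "integrable lborel f" "(LBINT t. f t) = of_real (2 * pi * main_riesz z X)"
    and "integrable lborel (\<lambda>v. main_weight z v * max (X - v) 0)"
proof -
  have meas [measurable]: "main_weight z \<in> borel_measurable borel"
    unfolding main_weight_def by measurable
  have "integrable lborel (\<lambda>v. indicator {0..} v * (v powr (z + 1) * exp (- (c - 1) * v)))"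
    using has_bochner_integral_laplace_real[of "z + 1" "c - 1"] z c by (auto simp: has_bochner_integral_iff)
  also have "(\<lambda>v. indicator {0..} v * (v powr (z + 1) * exp (- (c - 1) * v))) = (\<lambda>v. main_weight z v * exp (- c * v))"
    by (auto simp: main_weight_def algebra_simps simp flip: exp_add)
  finally have int: "integrable lborel (\<lambda>v. main_weight z v * exp (- c * v))" .
  have D: "(LBINT v. of_real (main_weight z v) * exp (- Complex c t * of_real v)) = of_real (Gamma (z + 2)) * (Complex c t - 1) powr (- of_real z - 2)" for t
  proof -
    have "of_real (main_weight z v) * exp (- Complex c t * of_real v) = of_real (indicator {0..} v * v powr (z + 1)) * exp (- (Complex c t - 1) * of_real v)" for v
      by (simp add: main_weight_def algebra_simps exp_of_real[symmetric] flip: exp_add)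
    moreover have ex: "- complex_of_real z - 2 = - of_real (z + 1) - 1" by simp
    ultimately show ?thesis
      unfolding ex using laplace_powr_complex[of "z + 1" "Complex c t - 1"] z c by (simp add: add.assoc)
  qed
  have "c > 0" using c by simp
  note P = perron_measure[OF lborel.sigma_finite_measure_axioms this, of "main_weight z" "\<lambda>v. v", unfolded D, OF _ _ int]
  show "integrable lborel f" unfolding f_def by (rule P(1)) auto
  show "(LBINT t. f t) = of_real (2 * pi * main_riesz z X)" unfolding f_def main_riesz_def by (rule P(2)) auto
  show "integrable lborel (\<lambda>v. main_weight z v * max (X - v) 0)" by (rule P(3)) auto
qed

text \<open>The two terms of the bound come from the neighbourhood of 1 and from the rest of the
  strip. They are kept apart because the Perron kernel is estimated differently against
  each.\<close>

lemma D_series_deriv2_remainder: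
  assumes k: "k \<ge> 2"
  defines "z \<equiv> 2 / real k"
  obtains C r where "C > 0" "r > 0" "r \<le> 1"
    "\<And>s. 1 < Re s \<Longrightarrow> Re s \<le> 1 + r \<Longrightarrow>
      norm ((deriv ^^ 2) (D_series k) s - of_real (euler_product k / Gamma z * Gamma (z + 2)) * (s - 1) powr (- of_real z - 2))
        \<le> C * (norm (s - 1) powr (- z - 1) + norm s powr (z / 2))"
proof -
  have z: "0 < z" "z \<le> 1" using k by (auto simp: z_def)
  obtain C1 \<rho> where C1: "C1 > 0" "\<rho> > 0" "\<rho> \<le> 1/4" "\<And>s. 1 < Re s \<Longrightarrow> norm (s - 1) \<le> \<rho> \<Longrightarrow>
      norm ((deriv ^^ 2) (D_series k) s - of_real (euler_product k * (z * (z + 1))) * (s - 1) powr (- of_real z - 2)) \<le> C1 * norm (s - 1) powr (- z - 1)"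
    using D_series_deriv2_near[OF k] unfolding z_def by metis
  \<comment> \<open>Half of \<open>\<rho>\<close>, so that \<open>Re s - 1 \<le> r\<close> and
    \<open>\<bar>Im s\<bar> < r\<close> together force
    \<open>norm (s - 1) \<le> \<rho>\<close>.\<close>
  define r where "r = \<rho> / 2"
  have r: "r > 0" "r \<le> 1" using C1 by (auto simp: r_def)
  have z2: "z / 2 > 0" using z by simp
  obtain C2 where C2: "C2 > 0" "\<And>s. 1 < Re s \<Longrightarrow> Re s \<le> 2 \<Longrightarrow> \<bar>Im s\<bar> \<ge> r \<Longrightarrow> norm ((deriv ^^ 2) (D_series k) s) \<le> C2 * norm s powr (z / 2)"
    using D_series_deriv2_far[OF k z2 r(1)] by metis
  define c0 where "c0 = euler_product k * (z * (z + 1))"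
  \<comment> \<open>Writes \<open>z * (z + 1)\<close> as \<open>Gamma (z + 2) / Gamma z\<close>: the
    numerator is absorbed by the Laplace transform of \<open>main_weight\<close>, the denominator is
    the one of the theorem.\<close>
  have "Gamma (z + 2) = Gamma (z + 1 + 1)" by (simp add: add.assoc)
  also have "\<dots> = (z + 1) * Gamma (z + 1)"
    using z by (intro Gamma_plus1) (auto simp: nonpos_Ints_def)
  also have "Gamma (z + 1) = z * Gamma z"
    using z by (intro Gamma_plus1) (auto simp: nonpos_Ints_def)
  finally have c0: "euler_product k / Gamma z * Gamma (z + 2) = c0"
    using Gamma_real_pos[OF z(1)] by (simp add: c0_def)
  define C where "C = C1 + C2 + \<bar>c0\<bar> * r powr (- z - 2)"
  show ?thesis
  proof (rule that[of C r])
    show "C > 0" unfolding C_def using C1(1) C2(1) by (simp add: add_pos_nonneg)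
    fix s :: complex assume s: "1 < Re s" "Re s \<le> 1 + r"
    let ?R = "(deriv ^^ 2) (D_series k) s - of_real c0 * (s - 1) powr (- of_real z - 2)"
    have n1: "norm s \<ge> 1" using s complex_Re_le_cmod[of s] by linarith
    have S: "norm s powr (z / 2) \<ge> 1" using n1 z by (intro ge_one_powr_ge_zero) auto
    have "norm ?R \<le> C1 * norm (s - 1) powr (- z - 1) + (C2 + \<bar>c0\<bar> * r powr (- z - 2)) * norm s powr (z / 2)"
    proof (cases "\<bar>Im s\<bar> \<ge> r")
      case True
      have nr: "norm (s - 1) \<ge> r" using True abs_Im_le_cmod[of "s - 1"] by simp
      have "s \<noteq> 1" using s by auto
      have "norm ((s - 1) powr (- of_real z - 2)) = norm (s - 1) powr (- z - 2)"
      proof -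
        have "- of_real z - 2 = complex_of_real (- z - 2)" by simp
        then show ?thesis using \<open>s \<noteq> 1\<close> by (simp only: powr_def) simp
      qed
      also have "\<dots> \<le> r powr (- z - 2)" using nr r z by (intro powr_mono2') auto
      finally have b: "norm (of_real c0 * (s - 1) powr (- of_real z - 2)) \<le> \<bar>c0\<bar> * r powr (- z - 2)"
        by (simp add: norm_mult mult_left_mono)
      have "norm ?R \<le> C2 * norm s powr (z / 2) + \<bar>c0\<bar> * r powr (- z - 2) * 1"
        using b C2(2)[of s] s r True by (intro order.trans[OF norm_triangle_ineq4] add_mono) auto
      also have "\<dots> \<le> C2 * norm s powr (z / 2) + \<bar>c0\<bar> * r powr (- z - 2) * norm s powr (z / 2)"
        using S by (intro add_left_mono mult_left_mono) auto
      also have "\<dots> \<le> C1 * norm (s - 1) powr (- z - 1) + (C2 + \<bar>c0\<bar> * r powr (- z - 2)) * norm s powr (z / 2)"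
        using C1(1) by (simp add: algebra_simps)
      finally show ?thesis .
    next
      case False
      have "norm (s - 1) \<le> \<bar>Re (s - 1)\<bar> + \<bar>Im (s - 1)\<bar>" by (rule cmod_le)
      also have "\<dots> \<le> \<rho>" using False s by (simp add: r_def)
      finally have "norm ?R \<le> C1 * norm (s - 1) powr (- z - 1)" using C1(4)[of s] s by (simp add: c0_def)
      also have "\<dots> \<le> C1 * norm (s - 1) powr (- z - 1) + (C2 + \<bar>c0\<bar> * r powr (- z - 2)) * norm s powr (z / 2)"
        using C2(1) by simp
      finally show ?thesis .
    qed
    also have "\<dots> \<le> C * norm (s - 1) powr (- z - 1) + C * norm s powr (z / 2)"
      using C1(1) C2(1) by (intro add_mono mult_right_mono) (auto simp: C_def)
    finally show "norm ((deriv ^^ 2) (D_series k) s - of_real (euler_product k / Gamma z * Gamma (z + 2)) * (s - 1) powr (- of_real z - 2))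
        \<le> C * (norm (s - 1) powr (- z - 1) + norm s powr (z / 2))"
      unfolding c0 by (simp add: algebra_simps)
  qed (use r in auto)
qed

subsection \<open>Differences of Riesz means\<close>

text \<open>Up to constants, the factor \<open>(exp (h s) - 1) / s^2\<close> is at most
  \<open>h\<close> against the singular error, whose integral is of order
  \<open>h powr (- z)\<close>. Against the growth \<open>norm s powr (z / 2)\<close> it is at most
  \<open>h powr (1 - z) * norm s powr (- 1 - z)\<close>, which leaves an integrable power. Both give
  \<open>h * h powr (- z)\<close>, that is \<open>Y powr z / Y\<close>.\<close>

lemma riesz_difference_bound:
  assumes k: "k \<ge> 2"
  defines "z \<equiv> 2 / real k"
  obtains C Y0 where "C > 0" "Y0 \<ge> 1"
    "\<And>X Y. Y \<ge> Y0 \<Longrightarrow> 0 \<le> X \<Longrightarrow> X \<le> Y \<Longrightarrow>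
      \<bar>(D_riesz k (X + 1 / Y) - D_riesz k X) - euler_product k / Gamma z * (main_riesz z (X + 1 / Y) - main_riesz z X)\<bar>
        \<le> C * exp X * Y powr z / Y"
proof -
  have z: "0 < z" "z \<le> 1" using k by (auto simp: z_def)
  define c0 where "c0 = euler_product k / Gamma z"
  obtain C r where C: "C > 0" "r > 0" "r \<le> 1"
    "\<And>s. 1 < Re s \<Longrightarrow> Re s \<le> 1 + r \<Longrightarrow>
      norm ((deriv ^^ 2) (D_series k) s - of_real (c0 * Gamma (z + 2)) * (s - 1) powr (- of_real z - 2))
        \<le> C * (norm (s - 1) powr (- z - 1) + norm s powr (z / 2))"
    using D_series_deriv2_remainder[OF k] unfolding z_def c0_def by metis
  define J1 where "J1 = (LBINT t. norm (Complex 1 t) powr (- 1 - z))"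
  define J2 where "J2 = (LBINT t. norm (Complex 1 t) powr (- 1 - z / 2))"
  have J: "J1 \<ge> 0" "J2 \<ge> 0" unfolding J1_def J2_def by (auto intro!: integral_nonneg_AE)
  define K where "K = C * exp 1 * (2 * exp 2) * (J1 + J2) + 1"
  show ?thesis
  \<comment> \<open>For \<open>Y \<ge> 1 / r\<close> the line with abscissa \<open>1 + 1 / Y\<close>
    lies in the strip where the remainder bound holds.\<close>
  proof (rule that[of K "1 / r"])
    show "K > 0" unfolding K_def using C J by (intro add_nonneg_pos mult_nonneg_nonneg) auto
    show "1 / r \<ge> 1" using C by simp
    fix X Y :: real assume Y: "Y \<ge> 1 / r" and X: "0 \<le> X" "X \<le> Y"
    define h where "h = 1 / Y"
    have "1 / r > 0" using C by simp
    with Y have "Y > 0" by linarith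
    then have h: "0 < h" "h \<le> r" using Y C by (auto simp: h_def field_simps)
    with C(3) have "h \<le> 1" by simp
    note h = h this
    have hz: "h powr (- z) = Y powr z" using \<open>Y > 0\<close> by (simp add: h_def powr_minus powr_divide)
    \<comment> \<open>The step \<open>h\<close> of the difference is also the distance of the line
      from the singularity; as \<open>X \<le> Y\<close>, replacing \<open>exp X\<close> by
      \<open>exp (c * X)\<close> costs at most a factor \<open>exp 1\<close>.\<close>
    define c where "c = 1 + h"
    have c: "c > 1" using h by (simp add: c_def)
    define A where "A = (\<lambda>t. (deriv ^^ 2) (D_series k) (Complex c t))"
    define B where "B = (\<lambda>t. of_real (Gamma (z + 2)) * (Complex c t - 1) powr (- of_real z - 2))"
    define f where "f = (\<lambda>X t. A t * exp (of_real X * Complex c t) / (Complex c t)^2)"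
    define g where "g = (\<lambda>X t. B t * exp (of_real X * Complex c t) / (Complex c t)^2)"
    have k0: "k > 0" using k by simp
    have fi: "integrable lborel (f X)" "(LBINT t. f X t) = of_real (2 * pi * D_riesz k X)" for X
      using D_perron[OF k0 c, of X] by (auto simp: f_def A_def)
    have gi: "integrable lborel (g X)" "(LBINT t. g X t) = of_real (2 * pi * main_riesz z X)" for X
      using main_perron[OF z(1) c, of X] by (auto simp: g_def B_def)
    define \<Delta> where "\<Delta> = (D_riesz k (X + h) - D_riesz k X) - c0 * (main_riesz z (X + h) - main_riesz z X)"
    \<comment> \<open>The integrands are subtracted before absolute values are taken, so that the
      leading singularities of order \<open>norm (s - 1) powr (- z - 2)\<close> cancel.\<close>
    define G where "G = (\<lambda>t. (f (X + h) t - f X t) - of_real c0 * (g (X + h) t - g X t))"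
    have Gi: "integrable lborel G"
      unfolding G_def by (intro Bochner_Integration.integrable_diff integrable_mult_right fi gi)
    define w where "w = (\<lambda>t. norm (Complex h t) powr (- 1 - z) + h powr (- z) * norm (Complex 1 t) powr (- 1 - z / 2))"
    define K0 where "K0 = C * exp (c * X) * (2 * exp 2) * h"
    have "(LBINT t. G t) = of_real (2 * pi * \<Delta>)"
      unfolding G_def \<Delta>_def
      by (simp add: fi gi Bochner_Integration.integral_diff Bochner_Integration.integrable_diff integrable_mult_right algebra_simps)
    then have "2 * pi * \<bar>\<Delta>\<bar> = norm (LBINT t. G t)" by (simp add: norm_mult abs_mult)
    also have "\<dots> \<le> (LBINT t. K0 * w t)"
    proof (rule Bochner_Integration.integral_norm_bound_integral[OF Gi])
      show "integrable lborel (\<lambda>t. K0 * w t)"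
        using has_bochner_integral_norm_Complex_powr[OF z(1) h(1)] integrable_norm_Complex_powr[of "z / 2"] z
        unfolding w_def by (intro integrable_mult_right Bochner_Integration.integrable_add) (auto simp: has_bochner_integral_iff)
      fix t :: real
      define s where "s = Complex c t"
      have s: "Re s = c" "s - 1 = Complex h t" by (simp_all add: s_def c_def complex_eq_iff)
      have n1: "norm s \<ge> 1" using c complex_Re_le_cmod[of s] s by linarith
      have n1': "norm s \<ge> norm (Complex 1 t)"
        using one_le_power[of c 2] c unfolding cmod_def s_def by (intro real_sqrt_le_mono) simp
      have n1'': "norm (Complex 1 t) \<ge> 1" using complex_Re_le_cmod[of "Complex 1 t"] by simp
      define R where "R = A t - of_real c0 * B t"
      have R: "norm R \<le> C * (norm (Complex h t) powr (- 1 - z) + norm s powr (z / 2))"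
      proof -
        have e: "- 1 - z = - z - 1" by simp
        have "1 < Re s" "Re s \<le> 1 + r" using c h s by (auto simp: c_def)
        from C(4)[OF this] show ?thesis
          unfolding R_def A_def B_def s_def[symmetric] e s(2)[symmetric] by (simp add: mult.assoc)
      qed
      have ex: "norm (exp (of_real h * s) - 1) \<le> 2 * exp 2 * (h * norm s) powr q" if "0 \<le> q" "q \<le> 1" for q
      proof -
        have "h * c \<le> 1 * 2" using h by (intro mult_mono) (auto simp: c_def)
        then have "norm (exp (of_real h * s) - 1) \<le> 2 * exp 2 * norm (of_real h * s) powr q"
          using h c s that by (intro norm_exp_minus_1_le) auto
        then show ?thesis using h by (simp add: norm_mult)
      qed
      define \<nu> where "\<nu> = norm (exp (of_real h * s) - 1) / norm s ^ 2"
      have e1: "\<nu> \<le> 2 * exp 2 * h"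
      proof -
        have "\<nu> \<le> 2 * exp 2 * (h * norm s) / norm s ^ 2"
          unfolding \<nu>_def using ex[of 1] h by (intro divide_right_mono) auto
        also have "\<dots> = 2 * exp 2 * h * (1 / norm s)" using n1 by (simp add: power2_eq_square field_simps)
        also have "\<dots> \<le> 2 * exp 2 * h * 1" using frac_le[of 1 1 1 "norm s"] n1 h by (intro mult_left_mono) auto
        finally show ?thesis by simp
      qed
      have e2: "norm s powr (z / 2) * \<nu> \<le> 2 * exp 2 * h * (h powr (- z) * norm (Complex 1 t) powr (- 1 - z / 2))"
      proof -
        \<comment> \<open>The exponent \<open>1 - z\<close> is nonnegative because
          \<open>k \<ge> 2\<close>. It leaves \<open>norm s\<close> with exponent
          \<open>z / 2 + (1 - z) - 2 = - 1 - z / 2\<close>.\<close>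
        have "\<nu> \<le> 2 * exp 2 * (h * norm s) powr (1 - z) / norm s ^ 2"
          unfolding \<nu>_def using ex[of "1 - z"] z by (intro divide_right_mono) auto
        then have "norm s powr (z / 2) * \<nu> \<le> norm s powr (z / 2) * (2 * exp 2 * (h * norm s) powr (1 - z) / norm s ^ 2)"
          by (rule mult_left_mono) simp
        also have "norm s ^ 2 = norm s powr 2" using n1 by (simp add: powr_numeral)
        also have "norm s powr (z / 2) * (2 * exp 2 * (h * norm s) powr (1 - z) / norm s powr 2) = 2 * exp 2 * h powr (1 - z) * (norm s powr (z / 2) * norm s powr (1 - z) / norm s powr 2)"
          using h n1 by (simp add: powr_mult)
        also have "norm s powr (z / 2) * norm s powr (1 - z) / norm s powr 2 = norm s powr (- 1 - z / 2)"
        proof -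
          have "- 1 - z / 2 = z / 2 + (1 - z) - 2" by (simp add: field_simps)
          then show ?thesis by (simp only: powr_add powr_diff)
        qed
        also have "h powr (1 - z) = h * h powr (- z)" using h by (simp add: powr_diff powr_minus field_simps)
        also have "2 * exp 2 * (h * h powr (- z)) * norm s powr (- 1 - z / 2) \<le> 2 * exp 2 * (h * h powr (- z)) * norm (Complex 1 t) powr (- 1 - z / 2)"
          using n1' n1'' h z by (intro mult_left_mono powr_mono2') auto
        finally show ?thesis by (simp add: mult.assoc)
      qed
      have "G t = R * (exp (of_real X * s) * ((exp (of_real h * s) - 1) / s\<^sup>2))"
        unfolding G_def f_def g_def R_def s_def
        by (simp add: algebra_simps exp_add add_divide_distrib diff_divide_distrib)
      then have "norm (G t) = exp (c * X) * (norm R * \<nu>)"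
        by (simp add: \<nu>_def norm_mult norm_divide norm_power s mult.commute)
      also have "norm R * \<nu>
         \<le> C * (norm (Complex h t) powr (- 1 - z) + norm s powr (z / 2)) * \<nu>"
        using R by (intro mult_right_mono) (auto simp: \<nu>_def)
      also have "\<dots> = C * (norm (Complex h t) powr (- 1 - z) * \<nu> + norm s powr (z / 2) * \<nu>)"
        by (simp add: algebra_simps add_divide_distrib)
      also have "\<dots> \<le> C * (norm (Complex h t) powr (- 1 - z) * (2 * exp 2 * h) + 2 * exp 2 * h * (h powr (- z) * norm (Complex 1 t) powr (- 1 - z / 2)))"
        using C(1) e1 e2 by (intro mult_left_mono add_mono) auto
      finally have "norm (G t) \<le> exp (c * X) * (C * (norm (Complex h t) powr (- 1 - z) * (2 * exp 2 * h) + 2 * exp 2 * h * (h powr (- z) * norm (Complex 1 t) powr (- 1 - z / 2))))"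
        by (simp add: mult_left_mono)
      then show "norm (G t) \<le> K0 * w t"
        by (simp add: K0_def w_def algebra_simps)
    qed
    also have "\<dots> = C * exp (c * X) * (2 * exp 2) * h * (h powr (- z) * J1 + h powr (- z) * J2)"
    proof -
      have "(LBINT t. w t) = h powr (- z) * J1 + h powr (- z) * J2"
        using has_bochner_integral_norm_Complex_powr[OF z(1) h(1)] integrable_norm_Complex_powr[of "z / 2"] z
        unfolding w_def by (subst Bochner_Integration.integral_add) (auto simp: has_bochner_integral_iff J1_def J2_def)
      then show ?thesis by (simp only: integral_mult_right_zero K0_def)
    qed
    also have "\<dots> = C * exp (c * X) * (2 * exp 2) * (J1 + J2) * (h * h powr (- z))" by (simp add: algebra_simps)
    also have "\<dots> \<le> C * (exp 1 * exp X) * (2 * exp 2) * (J1 + J2) * (h * h powr (- z))"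
    proof -
      have "h * X \<le> 1" using X \<open>Y > 0\<close> by (simp add: h_def)
      then have "exp (c * X) \<le> exp 1 * exp X" by (simp add: c_def algebra_simps flip: exp_add)
      then show ?thesis using C(1) J h by (intro mult_right_mono mult_left_mono) auto
    qed
    also have "\<dots> = (K - 1) * exp X * (h * h powr (- z))" by (simp add: K_def)
    also have "\<dots> \<le> K * exp X * (h * h powr (- z))" using h by (intro mult_right_mono) auto
    finally have "2 * pi * \<bar>\<Delta>\<bar> \<le> K * exp X * (h * h powr (- z))" .
    moreover have "1 * \<bar>\<Delta>\<bar> \<le> 2 * pi * \<bar>\<Delta>\<bar>" using pi_gt3 by (intro mult_right_mono) auto
    ultimately have "\<bar>\<Delta>\<bar> \<le> K * exp X * (h * Y powr z)" by (simp add: hz)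
    then show "\<bar>(D_riesz k (X + 1 / Y) - D_riesz k X) - euler_product k / Gamma z * (main_riesz z (X + 1 / Y) - main_riesz z X)\<bar>
        \<le> K * exp X * Y powr z / Y"
      by (simp add: \<Delta>_def h_def c0_def)
  qed
qed

section \<open>Sums between difference quotients of Riesz means\<close>

definition D_weight_sum :: "nat \<Rightarrow> real \<Rightarrow> real" where
  "D_weight_sum k Y = (\<Sum>n | 0 < n \<and> real n \<le> exp Y. D_weight k n)"

lemma finite_nat_le: "finite {n::nat. 0 < n \<and> real n \<le> x}"
  by (rule finite_subset[of _ "{..nat \<lfloor>x\<rfloor>}"]) (auto simp: le_nat_floor)

lemma D_weight_nonneg: "D_weight k n \<ge> 0"
  by (simp add: D_weight_def D_omega_nonneg)

text \<open>As a function of \<open>ln n\<close>, the difference of the two hinges lies between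
  \<open>h\<close> times the indicator of \<open>ln n \<le> X\<close> and \<open>h\<close> times
  that of \<open>ln n \<le> X + h\<close>; nonnegative weights preserve this.\<close>

lemma D_riesz_diff_bounds:
  assumes k: "k > 0" and h: "h > 0"
  shows "h * D_weight_sum k X \<le> D_riesz k (X + h) - D_riesz k X"
    and "D_riesz k (X + h) - D_riesz k X \<le> h * D_weight_sum k (X + h)"
proof -
  have int: "integrable (count_space UNIV) (\<lambda>n. D_weight k n * max (X - ln (real n)) 0)" for X
    using D_perron(3)[OF k, of 2 X] by simp
  have eq: "D_riesz k (X + h) - D_riesz k X = (LINT n|count_space UNIV. D_weight k n * max (X + h - ln (real n)) 0 - D_weight k n * max (X - ln (real n)) 0)"
    unfolding D_riesz_def by (rule Bochner_Integration.integral_diff[symmetric, OF int int])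
  define I where "I = (\<lambda>X n. h * (D_weight k n * indicator {n. 0 < n \<and> real n \<le> exp X} n))"
  have fin: "finite {n. I X n \<noteq> 0}" for X
    by (rule finite_subset[OF _ finite_nat_le[of "exp X"]]) (auto simp: I_def indicator_def split: if_splits)
  have int': "integrable (count_space UNIV) (I X)" for X
    unfolding integrable_count_space_nat_iff
    by (rule summable_finite[OF finite_nat_le[of "exp X"]]) (auto simp: I_def indicator_def)
  have sum: "h * D_weight_sum k X = (LINT n|count_space UNIV. I X n)" for X
  proof -
    have "(LINT n|count_space UNIV. I X n)
      = (\<Sum>n | I X n \<noteq> 0. I X n)"
      using fin[of X] by (subst lebesgue_integral_count_space_finite_support) auto
    also have "\<dots> = (\<Sum>n | 0 < n \<and> real n \<le> exp X. I X n)"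
      by (rule sum.mono_neutral_left) (auto simp: I_def finite_nat_le indicator_def split: if_splits)
    also have "\<dots> = h * D_weight_sum k X"
      unfolding D_weight_sum_def sum_distrib_left by (rule sum.cong) (auto simp: I_def)
    finally show ?thesis ..
  qed
  have ln_le: "ln (real n) \<le> X \<longleftrightarrow> real n \<le> exp X" if "n > 0" for n X
    using that by (metis exp_le_cancel_iff exp_ln of_nat_0_less_iff)
  show "h * D_weight_sum k X \<le> D_riesz k (X + h) - D_riesz k X"
    unfolding eq sum
  proof (rule integral_mono[OF int' Bochner_Integration.integrable_diff[OF int int]])
    fix n
    have "h * indicator {n. 0 < n \<and> real n \<le> exp X} n \<le> max (X + h - ln (real n)) 0 - max (X - ln (real n)) 0"
      using h ln_le[of n X] by (auto simp: indicator_def max_def)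
    from mult_left_mono[OF this D_weight_nonneg[of k n]]
    show "I X n \<le> D_weight k n * max (X + h - ln (real n)) 0 - D_weight k n * max (X - ln (real n)) 0"
      by (simp add: I_def algebra_simps)
  qed
  show "D_riesz k (X + h) - D_riesz k X \<le> h * D_weight_sum k (X + h)"
    unfolding eq sum
  proof (rule integral_mono[OF Bochner_Integration.integrable_diff[OF int int] int'])
    fix n
    show "D_weight k n * max (X + h - ln (real n)) 0 - D_weight k n * max (X - ln (real n)) 0 \<le> I (X + h) n"
    proof (cases "n = 0")
      case False
      have "max (X + h - ln (real n)) 0 - max (X - ln (real n)) 0 \<le> h * indicator {n. 0 < n \<and> real n \<le> exp (X + h)} n"
        using h ln_le[of n "X + h"] False by (auto simp: indicator_def max_def)
      from mult_left_mono[OF this D_weight_nonneg[of k n]] show ?thesis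
        by (simp add: I_def algebra_simps)
    qed (simp add: D_weight_def I_def)
  qed
qed

text \<open>The lower bound integrates the derivative of \<open>v powr (z + 1) * exp v\<close>; the
  second part of that derivative is of lower order, by the upper bound for the exponent
  \<open>z\<close>.\<close>

lemma main_integral_bounds:
  fixes z X :: real
  assumes z: "z > 0" and X: "X \<ge> 0"
  shows "set_integrable lborel {0..X} (\<lambda>v. v powr (z + 1) * exp v)"
    and "(LBINT v:{0..X}. v powr (z + 1) * exp v) \<le> X powr (z + 1) * exp X"
    and "(LBINT v:{0..X}. v powr (z + 1) * exp v) \<ge> X powr (z + 1) * exp X - (z + 1) * (X powr z * exp X)"
proof -
  have int: "set_integrable lborel {0..X} (\<lambda>v. v powr a * exp v)" if "a > 0" for a
    using that by (intro borel_integrable_atLeastAtMost' continuous_intros continuous_on_powr') auto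
  show "set_integrable lborel {0..X} (\<lambda>v. v powr (z + 1) * exp v)" using z by (intro int) simp
  have i: "(LBINT v:{0..X}. v powr a * exp v) = integral {0..X} (\<lambda>v. v powr a * exp v)" "(\<lambda>v. v powr a * exp v) integrable_on {0..X}"
    if "a > 0" for a
    using set_borel_integral_eq_integral[OF int[OF that]] by auto
  have ub: "integral {0..X} (\<lambda>v. v powr a * exp v) \<le> X powr a * exp X" if "a > 0" for a
  proof -
    have "(exp has_integral (exp X - exp 0)) {0..X}"
      using X by (intro fundamental_theorem_of_calculus) (auto intro!: derivative_eq_intros simp flip: has_real_derivative_iff_has_vector_derivative)
    then have e: "((\<lambda>v. X powr a * exp v) has_integral (X powr a * (exp X - exp 0))) {0..X}"
      by (rule has_integral_mult_right)
    have "integral {0..X} (\<lambda>v. v powr a * exp v) \<le> integral {0..X} (\<lambda>v. X powr a * exp v)"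
      using e that by (intro integral_le i) (auto intro!: powr_mono2)
    also have "\<dots> = X powr a * (exp X - exp 0)" using e by (rule integral_unique)
    also have "\<dots> \<le> X powr a * exp X" by (intro mult_left_mono) auto
    finally show ?thesis .
  qed
  show "(LBINT v:{0..X}. v powr (z + 1) * exp v) \<le> X powr (z + 1) * exp X"
    using ub[of "z + 1"] i(1)[of "z + 1"] z by simp
  have "((\<lambda>v. v powr (z + 1) * exp v + (z + 1) * (v powr z * exp v)) has_integral (X powr (z + 1) * exp X - 0 powr (z + 1) * exp 0)) {0..X}"
  proof (rule fundamental_theorem_of_calculus_interior[OF X])
    show "continuous_on {0..X} (\<lambda>v. v powr (z + 1) * exp v)"
      using z by (intro continuous_intros continuous_on_powr') auto
    fix v assume "v \<in> {0<..<X}"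
    then show "((\<lambda>v. v powr (z + 1) * exp v) has_vector_derivative v powr (z + 1) * exp v + (z + 1) * (v powr z * exp v)) (at v)"
      unfolding has_real_derivative_iff_has_vector_derivative[symmetric]
      by (auto intro!: derivative_eq_intros simp: algebra_simps)
  qed
  then have "X powr (z + 1) * exp X = integral {0..X} (\<lambda>v. v powr (z + 1) * exp v + (z + 1) * (v powr z * exp v))"
    using z by (simp add: integral_unique)
  also have "\<dots> = integral {0..X} (\<lambda>v. v powr (z + 1) * exp v) + (z + 1) * integral {0..X} (\<lambda>v. v powr z * exp v)"
    using z i(2)[of "z + 1"] i(2)[of z] by (subst integral_add) (auto intro: integrable_on_mult_right)
  also have "\<dots> \<le> integral {0..X} (\<lambda>v. v powr (z + 1) * exp v) + (z + 1) * (X powr z * exp X)"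
    using ub[of z] z by (intro add_left_mono mult_left_mono) auto
  finally show "(LBINT v:{0..X}. v powr (z + 1) * exp v) \<ge> X powr (z + 1) * exp X - (z + 1) * (X powr z * exp X)"
    using i(1)[of "z + 1"] z by simp
qed

lemma main_riesz_diff_bounds:
  assumes z: "z > 0" and h: "h > 0" and X: "X \<ge> 0"
  shows "h * (X powr (z + 1) * exp X - (z + 1) * (X powr z * exp X)) \<le> main_riesz z (X + h) - main_riesz z X"
    and "main_riesz z (X + h) - main_riesz z X \<le> h * ((X + h) powr (z + 1) * exp (X + h))"
proof -
  have int: "integrable lborel (\<lambda>v. main_weight z v * max (X - v) 0)" for X
    using main_perron(3)[OF z, of 2 X] by simp
  have eq: "main_riesz z (X + h) - main_riesz z X = (LBINT v. main_weight z v * max (X + h - v) 0 - main_weight z v * max (X - v) 0)"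
    unfolding main_riesz_def by (rule Bochner_Integration.integral_diff[symmetric, OF int int])
  have int': "integrable lborel (\<lambda>v. h * (indicator {0..X} v *\<^sub>R (v powr (z + 1) * exp v)))" if "X \<ge> 0" for X
    using main_integral_bounds(1)[OF z that] unfolding set_integrable_def by (rule integrable_mult_right)
  have eq': "h * (LBINT v:{0..X}. v powr (z + 1) * exp v) = (LBINT v. h * (indicator {0..X} v *\<^sub>R (v powr (z + 1) * exp v)))" for X
    unfolding set_lebesgue_integral_def by simp
  have "h * (X powr (z + 1) * exp X - (z + 1) * (X powr z * exp X)) \<le> h * (LBINT v:{0..X}. v powr (z + 1) * exp v)"
    using main_integral_bounds(3)[OF z X] h by (intro mult_left_mono) auto
  also have "\<dots> \<le> main_riesz z (X + h) - main_riesz z X"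
    unfolding eq eq'
  proof (rule integral_mono[OF int'[OF X] Bochner_Integration.integrable_diff[OF int int]])
    fix v
    have "h * indicator {..X} v \<le> max (X + h - v) 0 - max (X - v) 0"
      using h by (auto simp: indicator_def max_def)
    from mult_left_mono[OF this, of "main_weight z v"]
    show "h * (indicator {0..X} v *\<^sub>R (v powr (z + 1) * exp v)) \<le> main_weight z v * max (X + h - v) 0 - main_weight z v * max (X - v) 0"
      by (auto simp: main_weight_def indicator_def algebra_simps)
  qed
  finally show "h * (X powr (z + 1) * exp X - (z + 1) * (X powr z * exp X)) \<le> main_riesz z (X + h) - main_riesz z X" .
  have Xh: "X + h \<ge> 0" using X h by simp
  have "main_riesz z (X + h) - main_riesz z X \<le> h * (LBINT v:{0..X + h}. v powr (z + 1) * exp v)"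
    unfolding eq eq'
  proof (rule integral_mono[OF Bochner_Integration.integrable_diff[OF int int] int'[OF Xh]])
    fix v
    have "max (X + h - v) 0 - max (X - v) 0 \<le> h * indicator {..X + h} v"
      using h by (auto simp: indicator_def max_def)
    from mult_left_mono[OF this, of "main_weight z v"]
    show "main_weight z v * max (X + h - v) 0 - main_weight z v * max (X - v) 0 \<le> h * (indicator {0..X + h} v *\<^sub>R (v powr (z + 1) * exp v))"
      by (auto simp: main_weight_def indicator_def algebra_simps)
  qed
  also have "\<dots> \<le> h * ((X + h) powr (z + 1) * exp (X + h))"
    using main_integral_bounds(2)[OF z Xh] h by (intro mult_left_mono) auto
  finally show "main_riesz z (X + h) - main_riesz z X \<le> h * ((X + h) powr (z + 1) * exp (X + h))" .
qed

subsection \<open>The Tauberian step\<close>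

text \<open>A shift by \<open>1 / Y\<close> changes \<open>Y powr (z + 1) * exp Y\<close> by a
  factor \<open>1 + O(1 / Y)\<close>, which is why this step is affordable.\<close>

lemma main_term_error_bigo:
  fixes z :: real
  assumes "z > 0"
  shows "(\<lambda>Y. (Y + 1 / Y) powr (z + 1) * exp (Y + 1 / Y) - Y powr (z + 1) * exp Y) \<in> O(\<lambda>Y. Y powr z * exp Y)"
    and "(\<lambda>Y. Y powr (z + 1) * exp Y - ((Y - 1 / Y) powr (z + 1) * exp (Y - 1 / Y) - (z + 1) * ((Y - 1 / Y) powr z * exp (Y - 1 / Y)))) \<in> O(\<lambda>Y. Y powr z * exp Y)"
    and "(\<lambda>Y. (z + 1) * (Y powr z * exp Y)) \<in> O(\<lambda>Y. Y powr z * exp Y)"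
  using assms by real_asymp+

text \<open>The sum lies between the difference quotient of \<open>D_riesz\<close> that ends at
  \<open>Y\<close> and the one that starts at \<open>Y\<close>. Both are compared with those of
  \<open>main_riesz\<close>, which deviate from the main term only by the errors just
  bounded.\<close>

lemma D_weight_sum_asymptotics:
  assumes k: "k \<ge> 2"
  defines "z \<equiv> 2 / real k"
  shows "(\<lambda>Y. D_weight_sum k Y - euler_product k / Gamma z * (Y powr (z + 1) * exp Y)) \<in> O(\<lambda>Y. Y powr z * exp Y)"
proof -
  have z: "z > 0" using k by (simp add: z_def)
  have k0: "k > 0" using k by simp
  define c where "c = euler_product k / Gamma z"
  obtain C Y0 where C: "C > 0" "Y0 \<ge> 1" "\<And>X Y. Y \<ge> Y0 \<Longrightarrow> 0 \<le> X \<Longrightarrow> X \<le> Y \<Longrightarrow>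
      \<bar>(D_riesz k (X + 1 / Y) - D_riesz k X) - c * (main_riesz z (X + 1 / Y) - main_riesz z X)\<bar> \<le> C * exp X * Y powr z / Y"
    using riesz_difference_bound[OF k] unfolding z_def c_def by metis
  define E1 where "E1 = (\<lambda>Y. (Y + 1 / Y) powr (z + 1) * exp (Y + 1 / Y) - Y powr (z + 1) * exp Y)"
  define E2 where "E2 = (\<lambda>Y. Y powr (z + 1) * exp Y - ((Y - 1 / Y) powr (z + 1) * exp (Y - 1 / Y) - (z + 1) * ((Y - 1 / Y) powr z * exp (Y - 1 / Y))))"
  define E3 where "E3 = (\<lambda>Y. (z + 1) * (Y powr z * exp Y))"
  \<comment> \<open>Absolute values turn the one-sided errors at \<open>Y\<close> and at
    \<open>Y - 1 / Y\<close> into one bound that can be multiplied by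
    \<open>\<bar>c\<bar>\<close>.\<close>
  define W where "W = (\<lambda>Y. \<bar>E1 Y\<bar> + \<bar>E2 Y\<bar> + \<bar>E3 Y\<bar>)"
  have "(\<lambda>Y. D_weight_sum k Y - c * (Y powr (z + 1) * exp Y)) \<in> O(\<lambda>Y. \<bar>c\<bar> * W Y + C * (Y powr z * exp Y))"
  proof (rule bigoI[of _ 1], use eventually_ge_at_top[of Y0] in eventually_elim)
    case (elim Y)
    define h where "h = 1 / Y"
    have Y: "Y \<ge> 1" using elim C by simp
    have h: "h > 0" using Y by (simp add: h_def)
    have X: "Y - h \<ge> 0" "Y \<ge> 0" using Y by (auto simp: h_def field_simps mult_mono[of 1 Y 1 Y, simplified])
    define M where "M = Y powr (z + 1) * exp Y"
    define P where "P = Y powr z * exp Y"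
    define d where "d = (\<lambda>X. (D_riesz k (X + h) - D_riesz k X) / h)"
    define m where "m = (\<lambda>X. (main_riesz z (X + h) - main_riesz z X) / h)"
    have dm: "\<bar>d X - c * m X\<bar> \<le> C * P" if "0 \<le> X" "X \<le> Y" for X
    proof -
      have "\<bar>d X - c * m X\<bar> = \<bar>(D_riesz k (X + h) - D_riesz k X) - c * (main_riesz z (X + h) - main_riesz z X)\<bar> / h"
      proof -
        have "d X - c * m X = ((D_riesz k (X + h) - D_riesz k X) - c * (main_riesz z (X + h) - main_riesz z X)) / h"
          using h by (simp add: d_def m_def field_simps)
        then show ?thesis using h by simp
      qed
      also have "\<dots> \<le> (C * exp X * Y powr z / Y) / h"
        unfolding h_def using C(3)[OF elim that] Y by (intro divide_right_mono) auto
      also have "\<dots> = (C * Y powr z) * exp X" using Y by (simp add: h_def)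
      also have "\<dots> \<le> (C * Y powr z) * exp Y" using C(1) that by (intro mult_left_mono) auto
      finally show ?thesis by (simp add: P_def mult.assoc)
    qed
    have "M - E3 Y \<le> m Y" "m Y \<le> M + E1 Y"
      using main_riesz_diff_bounds[OF z h X(2)] h
      by (simp_all add: m_def M_def E1_def E3_def h_def field_simps)
    moreover have "M - E2 Y \<le> m (Y - h)" "m (Y - h) \<le> M"
      using main_riesz_diff_bounds[OF z h X(1)] h
      by (simp_all add: m_def M_def E2_def h_def pos_le_divide_eq pos_divide_le_eq mult.commute)
    ultimately have mM: "\<bar>m X - M\<bar> \<le> W Y" if "X \<in> {Y - h, Y}" for X
      using that unfolding W_def by auto
    have dM: "\<bar>d X - c * M\<bar> \<le> \<bar>c\<bar> * W Y + C * P" if "X \<in> {Y - h, Y}" for X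
    proof -
      have "\<bar>c * m X - c * M\<bar> \<le> \<bar>c\<bar> * W Y"
        using mM[OF that] by (simp add: abs_mult mult_left_mono flip: right_diff_distrib)
      moreover have "\<bar>d X - c * m X\<bar> \<le> C * P" using dm[of X] X h that by auto
      ultimately show ?thesis by linarith
    qed
    have "D_weight_sum k Y \<le> d Y"
      using D_riesz_diff_bounds(1)[OF k0 h, of Y] h by (simp add: d_def field_simps)
    moreover have "d (Y - h) \<le> D_weight_sum k Y"
      using D_riesz_diff_bounds(2)[OF k0 h, of "Y - h"] h by (simp add: d_def field_simps)
    ultimately have "\<bar>D_weight_sum k Y - c * M\<bar> \<le> \<bar>c\<bar> * W Y + C * P"
      using dM[of Y] dM[of "Y - h"] by (auto simp: abs_le_iff)
    then show ?case by (simp add: M_def P_def)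
  qed
  also have "(\<lambda>Y. \<bar>c\<bar> * W Y + C * (Y powr z * exp Y)) \<in> O(\<lambda>Y. Y powr z * exp Y)"
  proof (rule sum_in_bigo)
    have "(\<lambda>Y. \<bar>E1 Y\<bar>) \<in> O(\<lambda>Y. Y powr z * exp Y)" "(\<lambda>Y. \<bar>E2 Y\<bar>) \<in> O(\<lambda>Y. Y powr z * exp Y)" "(\<lambda>Y. \<bar>E3 Y\<bar>) \<in> O(\<lambda>Y. Y powr z * exp Y)"
      using main_term_error_bigo[OF z] unfolding E1_def E2_def E3_def landau_o.big.abs_in_iff by blast+
    then have "W \<in> O(\<lambda>Y. Y powr z * exp Y)"
      unfolding W_def by (intro sum_in_bigo)
    then show "(\<lambda>Y. \<bar>c\<bar> * W Y) \<in> O(\<lambda>Y. Y powr z * exp Y)"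
      unfolding cmult_in_bigo_iff by blast
  qed simp
  finally show ?thesis by (simp add: c_def)
qed

section \<open>Removal of the weight \<open>(ln n)^2\<close>\<close>

lemma D_weight_sum_mono: "X \<le> Y \<Longrightarrow> D_weight_sum k X \<le> D_weight_sum k Y"
  unfolding D_weight_sum_def
  by (intro sum_mono2 finite_nat_le) (auto simp: D_weight_nonneg intro: order.trans)

lemma D_weight_sum_nonneg: "D_weight_sum k X \<ge> 0"
  unfolding D_weight_sum_def by (intro sum_nonneg D_weight_nonneg)

lemma D_riesz_nonpos:
  assumes "X \<le> 0"
  shows "D_riesz k X = 0"
proof -
  have "D_weight k n * max (X - ln (real n)) 0 = 0" for n
  proof (cases "n = 0")
    case False
    then have "ln (real n) \<ge> 0" by simp
    with assms have "max (X - ln (real n)) 0 = 0" by (simp add: max_def)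
    then show ?thesis by simp
  qed (simp add: D_weight_def)
  then show ?thesis unfolding D_riesz_def by (simp only: Bochner_Integration.integral_zero)
qed

text \<open>In unit steps \<open>D_riesz\<close> grows by at most \<open>D_weight_sum\<close>, which
  is of exponential size, so the increments are dominated by the last one as in a geometric series;
  \<open>2 \<le> exp 1\<close> makes the constant 2 reproduce itself.\<close>

lemma D_riesz_bigo:
  assumes k: "k \<ge> 2"
  defines "z \<equiv> 2 / real k"
  shows "D_riesz k \<in> O(\<lambda>Y. Y powr (z + 1) * exp Y)"
proof -
  let ?g = "\<lambda>Y. Y powr (z + 1) * exp Y"
  have z: "z > 0" using k by (simp add: z_def)
  have k0: "k > 0" using k by simp
  define c where "c = euler_product k / Gamma z"
  have "(\<lambda>Y. D_weight_sum k Y - c * (Y powr (z + 1) * exp Y)) \<in> O(\<lambda>Y. Y powr z * exp Y)"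
    using D_weight_sum_asymptotics[OF k] by (simp add: c_def z_def)
  also have "(\<lambda>Y. Y powr z * exp Y) \<in> O(?g)" by real_asymp
  finally have 1: "(\<lambda>Y. D_weight_sum k Y - c * (Y powr (z + 1) * exp Y)) \<in> O(?g)" .
  have 2: "(\<lambda>Y. c * (Y powr (z + 1) * exp Y)) \<in> O(?g)" by simp
  from sum_in_bigo(1)[OF 1 2] have "D_weight_sum k \<in> O(?g)" by simp
  then obtain C where C: "C > 0" "eventually (\<lambda>Y. norm (D_weight_sum k Y) \<le> C * norm (Y powr (z + 1) * exp Y)) at_top"
    by (elim landau_o.bigE)
  then obtain Y1 where "\<And>Y. Y \<ge> Y1 \<Longrightarrow> \<bar>D_weight_sum k Y\<bar> \<le> C * (Y powr (z + 1) * exp Y)"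
    by (auto simp: eventually_at_top_linorder)
  then have Y1: "\<And>Y. Y \<ge> Y1 \<Longrightarrow> D_weight_sum k Y \<le> C * (Y powr (z + 1) * exp Y)"
    by (rule abs_le_D1)
  define B where "B = C + D_weight_sum k Y1"
  have B: "B \<ge> 0" using C(1) D_weight_sum_nonneg[of k Y1] by (simp add: B_def)
  show ?thesis
  proof (rule bigoI[of _ "2 * B"], use eventually_ge_at_top[of 1] in eventually_elim)
    case (elim Y)
    define G where "G = B * Y powr (z + 1)"
    have G: "G \<ge> 0" using B by (simp add: G_def)
    have Yz: "Y powr (z + 1) \<ge> 1" using elim z by (intro ge_one_powr_ge_zero) auto
    have T: "D_weight_sum k V \<le> G * exp V" if V: "0 \<le> V" "V \<le> Y" for V
    proof (cases "V \<ge> Y1")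
      case True
      have "D_weight_sum k V \<le> C * (V powr (z + 1) * exp V)" by (rule Y1[OF True])
      also have "\<dots> \<le> B * (Y powr (z + 1) * exp V)"
        using V z C(1) D_weight_sum_nonneg[of k Y1] B by (intro mult_mono powr_mono2) (auto simp: B_def)
      finally show ?thesis by (simp add: G_def mult.assoc)
    next
      case False
      then have "D_weight_sum k V \<le> D_weight_sum k Y1" by (intro D_weight_sum_mono) simp
      also have "\<dots> \<le> B * (1 * 1)" using C(1) by (simp add: B_def)
      also have "\<dots> \<le> B * (Y powr (z + 1) * exp V)"
        using B Yz V by (intro mult_left_mono mult_mono) auto
      finally show ?thesis by (simp add: G_def mult.assoc)
    qed
    \<comment> \<open>The power of \<open>Y\<close> is frozen in \<open>G\<close>, so the induction
      over unit intervals only has to follow the exponential.\<close>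
    have R: "D_riesz k V \<le> 2 * G * exp V" if "V \<le> real m" "V \<le> Y" for V m
      using that
    proof (induction m arbitrary: V)
      case 0
      then show ?case using G by (simp add: D_riesz_nonpos)
    next
      case (Suc m)
      show ?case
      proof (cases "V \<ge> 0")
        case True
        have "D_riesz k V \<le> D_riesz k (V - 1) + D_weight_sum k V"
          using D_riesz_diff_bounds(2)[OF k0, of 1 "V - 1"] by simp
        also have "\<dots> \<le> 2 * G * exp (V - 1) + G * exp V"
          using Suc.prems by (intro add_mono Suc.IH T True) auto
        also have "2 * G * exp (V - 1) \<le> 1 * (G * exp V)"
        proof -
          have "(2::real) \<le> exp 1" using exp_ge_add_one_self[of 1] by simp
          then have "2 * exp (-1) \<le> (1::real)" by (simp add: exp_minus field_simps)
          then have "2 * exp (-1) * (G * exp V) \<le> 1 * (G * exp V)" using G by (intro mult_right_mono) auto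
          then show ?thesis by (simp add: exp_diff exp_minus field_simps)
        qed
        finally show ?thesis by simp
      qed (use G in \<open>simp add: D_riesz_nonpos\<close>)
    qed
    obtain m where "Y \<le> real m" using real_arch_simple by blast
    then have "D_riesz k Y \<le> 2 * G * exp Y" by (intro R) auto
    moreover have "D_riesz k Y \<ge> 0"
      unfolding D_riesz_def by (intro integral_nonneg_AE) (auto simp: D_weight_nonneg)
    ultimately show ?case using elim by (simp add: G_def mult.assoc)
  qed
qed

text \<open>For \<open>ln n \<le> Y / 2\<close> Rankin's trick with exponent \<open>3/2\<close>
  bounds the term, at a cost of \<open>x powr (3/4)\<close> with \<open>x = exp Y\<close>. For
  larger \<open>n\<close> the weight can be inserted, as \<open>1 \<le> 4 * (ln n / Y)^2\<close>,
  and the factor \<open>2 * (Y - ln n) / Y\<close> produces the Riesz mean; the constants multiply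
  to 8.\<close>

lemma D_omega_minus_weight_bounds:
  assumes Y: "Y > 0" and n: "n > 0" "real n \<le> exp Y"
  shows "0 \<le> D_omega k n - D_weight k n / Y\<^sup>2"
    and "D_omega k n - D_weight k n / Y\<^sup>2 \<le> exp (3 / 4 * Y) * (D_omega k n * real n powr (- (3 / 2))) + 8 / Y ^ 3 * (D_weight k n * max (Y - ln (real n)) 0)" (is "_ \<le> ?R")
proof -
  define l where "l = ln (real n)"
  have l: "0 \<le> l" "l \<le> Y" using n by (auto simp: l_def) (metis exp_le_cancel_iff exp_ln of_nat_0_less_iff)
  have f: "D_omega k n \<ge> 0" by (rule D_omega_nonneg)
  have eq: "D_omega k n - D_weight k n / Y\<^sup>2 = D_omega k n * (1 - l\<^sup>2 / Y\<^sup>2)"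
    by (simp add: D_weight_def l_def algebra_simps)
  have "l\<^sup>2 / Y\<^sup>2 \<le> 1" using l Y by (simp add: power_mono)
  then show "0 \<le> D_omega k n - D_weight k n / Y\<^sup>2" unfolding eq using f by simp
  show "D_omega k n - D_weight k n / Y\<^sup>2 \<le> ?R"
  proof (cases "l \<le> Y / 2")
    case True
    have "exp (3 / 4 * Y) * real n powr (- (3 / 2)) = exp (3 / 4 * Y - 3 / 2 * l)"
      using n by (simp add: powr_def l_def flip: exp_add)
    also have "\<dots> \<ge> 1" using True by simp
    finally have "D_omega k n * 1 \<le> D_omega k n * (exp (3 / 4 * Y) * real n powr (- (3 / 2)))"
      using f by (intro mult_left_mono) auto
    moreover have "D_omega k n * (1 - l\<^sup>2 / Y\<^sup>2) \<le> D_omega k n * 1"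
      using f by (intro mult_left_mono) auto
    moreover have "8 / Y ^ 3 * (D_weight k n * max (Y - ln (real n)) 0) \<ge> 0" using Y by (simp add: D_weight_nonneg)
    ultimately show ?thesis unfolding eq by (simp add: mult_ac)
  next
    case False
    have "1 - l\<^sup>2 / Y\<^sup>2 = (Y - l) * (Y + l) / Y\<^sup>2" using Y by (simp add: field_simps power2_eq_square)
    also have "\<dots> \<le> (Y - l) * (2 * Y) / Y\<^sup>2" using l Y by (intro divide_right_mono mult_left_mono) auto
    also have "\<dots> = 2 / Y * (Y - l)" using Y by (simp add: power2_eq_square field_simps)
    finally have a: "1 - l\<^sup>2 / Y\<^sup>2 \<le> 2 / Y * (Y - l)" .
    have "(Y / 2)\<^sup>2 \<le> l\<^sup>2" using False Y by (intro power_mono) auto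
    then have b: "1 \<le> 4 / Y\<^sup>2 * l\<^sup>2" using Y by (simp add: field_simps power2_eq_square)
    have "D_omega k n * (1 - l\<^sup>2 / Y\<^sup>2) \<le> D_omega k n * ((4 / Y\<^sup>2 * l\<^sup>2) * (2 / Y * (Y - l)))"
      using a mult_right_mono[OF b, of "2 / Y * (Y - l)"] l Y f by (intro mult_left_mono) auto
    also have "\<dots> = 8 / Y ^ 3 * (D_weight k n * max (Y - ln (real n)) 0)"
      using l Y by (simp add: D_weight_def l_def power2_eq_square power3_eq_cube max_def)
    also have "\<dots> \<le> ?R"
      using f by simp
    finally show ?thesis unfolding eq .
  qed
qed

lemma D_omega_sum_minus_weight_sum:
  assumes k: "k > 0" and Y: "Y > 0"
  shows "\<bar>(\<Sum>n | 0 < n \<and> real n \<le> exp Y. D_omega k n) - D_weight_sum k Y / Y\<^sup>2\<bar>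
    \<le> exp (3 / 4 * Y) * (\<Sum>n. D_omega k n * real n powr (- (3 / 2))) + 8 / Y ^ 3 * D_riesz k Y" (is "_ \<le> ?R")
proof -
  let ?S = "{n. 0 < n \<and> real n \<le> exp Y}"
  have int: "integrable (count_space UNIV) (\<lambda>n. D_weight k n * max (Y - ln (real n)) 0)"
    using D_perron(3)[OF k, of 2 Y] by simp
  have eq: "(\<Sum>n\<in>?S. D_omega k n) - D_weight_sum k Y / Y\<^sup>2 = (\<Sum>n\<in>?S. D_omega k n - D_weight k n / Y\<^sup>2)"
    by (simp add: D_weight_sum_def sum_subtractf sum_divide_distrib)
  have nonneg: "0 \<le> (\<Sum>n\<in>?S. D_omega k n - D_weight k n / Y\<^sup>2)"
    using D_omega_minus_weight_bounds(1)[OF Y] by (intro sum_nonneg) auto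
  have "(\<Sum>n\<in>?S. D_omega k n - D_weight k n / Y\<^sup>2) \<le> (\<Sum>n\<in>?S. exp (3 / 4 * Y) * (D_omega k n * real n powr (- (3 / 2))) + 8 / Y ^ 3 * (D_weight k n * max (Y - ln (real n)) 0))"
    using D_omega_minus_weight_bounds(2)[OF Y] by (intro sum_mono) auto
  also have "\<dots> = exp (3 / 4 * Y) * (\<Sum>n\<in>?S. D_omega k n * real n powr (- (3 / 2))) + 8 / Y ^ 3 * (\<Sum>n\<in>?S. D_weight k n * max (Y - ln (real n)) 0)"
    by (simp add: sum.distrib sum_distrib_left)
  also have "\<dots> \<le> ?R"
  proof (intro add_mono mult_left_mono)
    show "(\<Sum>n\<in>?S. D_omega k n * real n powr (- (3 / 2))) \<le> (\<Sum>n. D_omega k n * real n powr (- (3 / 2)))"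
      using summable_D_omega[OF k, of "3 / 2"] by (intro sum_le_suminf finite_nat_le) (auto simp: D_omega_nonneg)
    have "D_riesz k Y = (\<Sum>n. D_weight k n * max (Y - ln (real n)) 0)"
      unfolding D_riesz_def using int by (rule integral_count_space_nat)
    moreover have "summable (\<lambda>n. D_weight k n * max (Y - ln (real n)) 0)"
      using int unfolding integrable_count_space_nat_iff by (rule summable_norm_cancel)
    ultimately show "(\<Sum>n\<in>?S. D_weight k n * max (Y - ln (real n)) 0) \<le> D_riesz k Y"
      by (simp add: sum_le_suminf finite_nat_le D_weight_nonneg)
  qed (use Y in auto)
  finally show ?thesis using nonneg unfolding eq by simp
qed

theorem theorem3:
  fixes k :: nat
  assumes "k \<ge> 2"
  shows "(\<lambda>x::real. (\<Sum>n | 0 < n \<and> real n \<le> x. D_omega k n)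
            - x * ln x powr (2 / real k - 1) / Gamma (2 / real k) * euler_product k)
         \<in> O[at_top](\<lambda>x. x * ln x powr (2 / real k - 2))"
proof -
  define z where "z = 2 / real k"
  have z: "z > 0" using assms by (simp add: z_def)
  have k0: "k > 0" using assms by simp
  define c where "c = euler_product k / Gamma z"
  define S where "S = (\<lambda>Y. \<Sum>n | 0 < n \<and> real n \<le> exp Y. D_omega k n)"
  define T where "T = (\<lambda>Y. D_weight_sum k Y)"
  let ?g = "\<lambda>Y::real. exp Y * Y powr (z - 2)"
  let ?M = "\<lambda>x y. x * y powr (z - 1) / Gamma z * euler_product k"
  define F where "F = (\<Sum>n. D_omega k n * real n powr (- (3 / 2)))"
  have "(\<lambda>Y. S Y - T Y / Y\<^sup>2) \<in> O(\<lambda>Y. exp (3 / 4 * Y) * F + 8 / Y ^ 3 * D_riesz k Y)"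
  proof (rule bigoI[of _ 1], use eventually_gt_at_top[of 0] in eventually_elim)
    case (elim Y)
    then show ?case using D_omega_sum_minus_weight_sum[OF k0 elim]
      unfolding S_def T_def F_def by (simp only: real_norm_def mult_1)
  qed
  \<comment> \<open>The first summand is exponentially smaller; in the second one the factor
    \<open>1 / Y ^ 3\<close> turns the size \<open>Y powr (z + 1) * exp Y\<close> of the Riesz mean
    into exactly the error allowed.\<close>
  also have "(\<lambda>Y. exp (3 / 4 * Y) * F + 8 / Y ^ 3 * D_riesz k Y) \<in> O(?g)"
  proof (rule sum_in_bigo)
    show "(\<lambda>Y. exp (3 / 4 * Y) * F) \<in> O(?g)" by real_asymp
    have "(\<lambda>Y. 8 / Y ^ 3 * D_riesz k Y) \<in> O(\<lambda>Y. 8 / Y ^ 3 * (Y powr (z + 1) * exp Y))"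
      using D_riesz_bigo[OF assms] by (intro landau_o.big.mult landau_o.big_refl) (simp add: z_def)
    also have "(\<lambda>Y. 8 / Y ^ 3 * (Y powr (z + 1) * exp Y)) \<in> O(?g)" by real_asymp
    finally show "(\<lambda>Y. 8 / Y ^ 3 * D_riesz k Y) \<in> O(?g)" .
  qed
  finally have 1: "(\<lambda>Y. S Y - T Y / Y\<^sup>2) \<in> O(?g)" .
  have "(\<lambda>Y. 1 / Y\<^sup>2 * (T Y - c * (Y powr (z + 1) * exp Y))) \<in> O(\<lambda>Y. 1 / Y\<^sup>2 * (Y powr z * exp Y))"
    using D_weight_sum_asymptotics[OF assms] by (intro landau_o.big.mult landau_o.big_refl) (simp add: z_def c_def T_def)
  also have "(\<lambda>Y. 1 / Y\<^sup>2 * (Y powr z * exp Y)) \<in> O(?g)" by real_asymp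
  finally have 2: "(\<lambda>Y. 1 / Y\<^sup>2 * (T Y - c * (Y powr (z + 1) * exp Y))) \<in> O(?g)" .
  have "(\<lambda>Y. S Y - ?M (exp Y) Y) \<in> O(?g)"
  proof (rule landau_o.big.in_cong[THEN iffD1, OF _ sum_in_bigo(1)[OF 1 2]])
    show "eventually (\<lambda>Y. S Y - T Y / Y\<^sup>2 + 1 / Y\<^sup>2 * (T Y - c * (Y powr (z + 1) * exp Y)) = S Y - ?M (exp Y) Y) at_top"
      using eventually_gt_at_top[of 0]
    proof eventually_elim
      case (elim Y)
      have "Y powr (z + 1) = Y powr (z - 1) * Y\<^sup>2"
        using elim by (simp add: powr_add powr_diff power2_eq_square)
      then show ?case using elim by (simp add: c_def field_simps)
    qed
  qed
  \<comment> \<open>The substitution \<open>Y = ln x\<close>, under which \<open>exp Y\<close>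
    becomes \<open>x\<close> once \<open>x > 0\<close>.\<close>
  from landau_o.big.compose[OF this ln_at_top]
  have comp: "(\<lambda>x. S (ln x) - ?M (exp (ln x)) (ln x)) \<in> O(\<lambda>x. exp (ln x) * ln x powr (z - 2))" .
  have ev: "eventually (\<lambda>x::real. exp (ln x) = x) at_top"
    using eventually_gt_at_top[of 0] by eventually_elim simp
  have ev1: "eventually (\<lambda>x. S (ln x) - ?M (exp (ln x)) (ln x)
      = (\<Sum>n | 0 < n \<and> real n \<le> x. D_omega k n) - ?M x (ln x)) at_top"
    using ev by eventually_elim (simp add: S_def)
  have ev2: "eventually (\<lambda>x. exp (ln x) * ln x powr (z - 2) = x * ln x powr (z - 2)) at_top"
    using ev by eventually_elim simp
  have "(\<lambda>x. (\<Sum>n | 0 < n \<and> real n \<le> x. D_omega k n) - ?M x (ln x)) \<in> O(\<lambda>x. x * ln x powr (z - 2))"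
    using landau_o.big.in_cong[OF ev1, THEN iffD1, OF comp] unfolding landau_o.big.cong[OF ev2] .
  then show ?thesis by (simp add: z_def)
qed

end
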